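(* Let $\mathcal G$ be of one of the types B0, C0, D0, CI, DIII, BI(a), BI(b), CII, DI(a) for $\mathfrak g_N$. Every finite-dimensional irreducible representation $V$ of $X(\mathfrak g_N,\mathcal G)^{tw}$ is a highest weight representation. Additionally, $V$ contains a unique highest weight vector $\eta$ up to scalar multiplication.
   Context: Let $N=2n$ or $N=2n+1$; $\mathfrak g_N=\mathfrak{so}_N$ ($N\ge3$) or $\mathfrak g_N=\mathfrak{sp}_N$ ($N=2n\ge2$). Rows and columns of $N\times N$ matrices are indexed by $-n,\ldots,-1,(0),1,\ldots,n$ ($0$ occurring only if $N$ is odd); $E_{ij}$ are the matrix units. Set $\theta_{ij}=1$ in the orthogonal case, $\theta_{ij}=\mathrm{sign}(i)\,\mathrm{sign}(j)$ in the symplectic case, $(E_{ij})^t=\theta_{ij}E_{-j,-i}$, $P=\sum_{i,j}E_{ij}\otimes E_{ji}$, $Q=\sum_{i,j}\theta_{ij}E_{ij}\otimes E_{-i,-j}$, $\kappa=N/2-1$ for $\mathfrak{so}_N$, $\kappa=N/2+1$ for $\mathfrak{sp}_N$, $R(u)=I-\frac{P}{u}+\frac{Q}{u-\kappa}$. Extended Yangian $X(\mathfrak g_N)$: the unital associative $\mathbb C$-algebra generated by $t_{ij}^{(r)}$ ($r\ge 0$, $t_{ij}^{(0)}=\delta_{ij}$) subject to $R(u-v)T_1(u)T_2(v)=T_2(v)T_1(u)R(u-v)$, where $t_{ij}(u)=\sum_{r\ge0}t_{ij}^{(r)}u^{-r}$, $T(u)=\sum E_{ij}\otimes t_{ij}(u)$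 and $T_1,T_2$ denote $T$ placed in the first, resp. second, copy of $\mathrm{End}(\mathbb C^N)$. Put $T^t(u)=\sum(E_{ij})^t\otimes t_{ij}(u)$. The diagonal matrix $\mathcal G=\sum g_{ii}E_{ii}$ (with $p\ge q>0$, $p+q=N$ where $p,q$ occur): B0 ($\mathfrak{so}_{2n+1}$), C0 ($\mathfrak{sp}_{2n}$), D0 ($\mathfrak{so}_{2n}$): $\mathcal G=I$. CI ($\mathfrak{sp}_{2n}$), DIII ($\mathfrak{so}_{2n}$): $\mathcal G=\sum_{i=1}^n(E_{ii}-E_{-i,-i})$. BI(a) ($\mathfrak{so}_{2n+1}$, $p$ odd, $q$ even): $g_{ii}=1$ for $|i|\le\frac{p-1}2$, $g_{ii}=-1$ for $|i|\ge\frac{p+1}2$. BI(b) ($\mathfrak{so}_{2n+1}$, $p$ even, $q$ odd): $g_{ii}=-1$ for $|i|\le\frac{q-1}2$, $g_{ii}=1$ for $|i|\ge\frac{q+1}2$. CII ($\mathfrak{sp}_{2n}$) and DI(a) ($\mathfrak{so}_{2n}$), $p,q$ even: $g_{ii}=1$ for $1\le|i|\le\frac p2$, $g_{ii}=-1$ for $|i|>\frac p2$. Define $\mathcal G(u)=\mathcal G$ for types B0, C0, D0, CI, DIII, and for CII, DI(a) with $p=q$; otherwise $\mathcal G(u)=(I-c\,u\,\mathcal G)(1-cu)^{-1}$ with $c=\frac4{p-q}$ (expanded in $u^{-1}$). Extended twisted Yangian $X(\mathfrak g_N,\mathcal G)^{tw}$: the subalgebra of $X(\mathfrak g_N)$ generated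 by the coefficients of the entries $s_{ij}(u)=\sum_{r\ge0}s_{ij}^{(r)}u^{-r}$ of $S(u)=T(u-\kappa/2)\,\mathcal G(u)\,T^t(-u+\kappa/2)$. Let $\mathcal I_N=\{0,\ldots,n\}$ if $N=2n+1$, $\mathcal I_N=\{1,\ldots,n\}$ if $N=2n$. A representation $V$ of $X(\mathfrak g_N,\mathcal G)^{tw}$ is a highest weight representation if there is a nonzero $\eta\in V$ (a highest weight vector) such that $V=X(\mathfrak g_N,\mathcal G)^{tw}\eta$, $s_{ij}(u)\eta=0$ for all $-n\le i<j\le n$, and $s_{ii}(u)\eta=\mu_i(u)\eta$ for all $i\in\mathcal I_N$, for some series $\mu_i(u)\in g_{ii}+u^{-1}\mathbb C[[u^{-1}]]$. *)

theory Defs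
  imports
    Complex_Main
    "HOL-Library.Poly_Mapping"
    "HOL-Computational_Algebra.Formal_Power_Series"
    "HOL-Algebra.QuotRing"
    "HOL-Algebra.Generated_Rings"
begin

unbundle fps_syntax

section \<open>Free associative algebras\<close>

text \<open>The additively written free monoid on \<open>'g\<close>. Its monoid algebra over the complex numbers,
  the type \<open>'g word \<Rightarrow>\<^sub>0 complex\<close> with the convolution product, is the free unital associative
  algebra on \<open>'g\<close>.\<close>

datatype 'g word = Word (letters: "'g list")

instantiation word :: (type) monoid_add
begin
definition zero_word :: "'a word" where "0 = Word []"
definition plus_word :: "'a word \<Rightarrow> 'a word \<Rightarrow> 'a word"
  where "v + w = Word (letters v @ letters w)"
instance by standard (simp_all add: zero_word_def plus_word_def)
end

type_synonym 'g free_alg = "'g word \<Rightarrow>\<^sub>0 complex"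

definition scalar :: "complex \<Rightarrow> 'g free_alg"
  where "scalar c = Poly_Mapping.single 0 c"

definition free_ring :: "'g set \<Rightarrow> 'g free_alg ring"
  where "free_ring G =
    \<lparr>carrier = {p. \<forall>w\<in>Poly_Mapping.keys p. set (letters w) \<subseteq> G},
     mult = (*), one = 1, zero = 0, add = (+)\<rparr>"

section \<open>The symmetric pairs\<close>

datatype pair_type = B0 | C0 | D0 | CI | DIII | BIa nat nat | BIb nat nat | CII nat nat | DIa nat nat
  \<comment> \<open>the arguments are \<open>p\<close> and \<open>q\<close>\<close>

fun symplectic :: "pair_type \<Rightarrow> bool" where
  "symplectic C0 = True"
| "symplectic CI = True"
| "symplectic (CII p q) = True"
| "symplectic _ = False"

definition pq_split :: "nat \<Rightarrow> nat \<Rightarrow> nat \<Rightarrow> bool"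
  where "pq_split N p q \<longleftrightarrow> p \<ge> q \<and> q > 0 \<and> p + q = N"

fun type_for :: "pair_type \<Rightarrow> nat \<Rightarrow> bool" where
  "type_for B0 N \<longleftrightarrow> odd N \<and> N \<ge> 3"
| "type_for C0 N \<longleftrightarrow> even N \<and> N \<ge> 2"
| "type_for D0 N \<longleftrightarrow> even N \<and> N \<ge> 3"
| "type_for CI N \<longleftrightarrow> even N \<and> N \<ge> 2"
| "type_for DIII N \<longleftrightarrow> even N \<and> N \<ge> 3"
| "type_for (BIa p q) N \<longleftrightarrow> odd N \<and> N \<ge> 3 \<and> pq_split N p q \<and> odd p \<and> even q"
| "type_for (BIb p q) N \<longleftrightarrow> odd N \<and> N \<ge> 3 \<and> pq_split N p q \<and> even p \<and> odd q"
| "type_for (CII p q) N \<longleftrightarrow> even N \<and> N \<ge> 2 \<and> pq_split N p q \<and> even p \<and> even q"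
| "type_for (DIa p q) N \<longleftrightarrow> even N \<and> N \<ge> 3 \<and> pq_split N p q \<and> even p \<and> even q"

text \<open>Row and column indices \<open>-n, \<dots>, -1, (0), 1, \<dots>, n\<close>.\<close>

definition idx :: "nat \<Rightarrow> int set"
  where "idx N = {i. \<bar>i\<bar> \<le> int (N div 2) \<and> (even N \<longrightarrow> i \<noteq> 0)}"

definition theta :: "pair_type \<Rightarrow> int \<Rightarrow> int \<Rightarrow> complex"
  where "theta ty i j = (if symplectic ty then of_int (sgn i * sgn j) else 1)"

definition kappa :: "pair_type \<Rightarrow> nat \<Rightarrow> complex"
  where "kappa ty N = (if symplectic ty then of_nat N / 2 + 1 else of_nat N / 2 - 1)"

text \<open>The diagonal entries \<open>g\<^sub>i\<^sub>i\<close> of the matrix \<open>\<G>\<close>. The halves are exact for the parities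
  required by \<open>type_for\<close>.\<close>

fun gmat :: "pair_type \<Rightarrow> int \<Rightarrow> complex" where
  "gmat B0 i = 1"
| "gmat C0 i = 1"
| "gmat D0 i = 1"
| "gmat CI i = (if i > 0 then 1 else -1)"
| "gmat DIII i = (if i > 0 then 1 else -1)"
| "gmat (BIa p q) i = (if \<bar>i\<bar> \<le> (int p - 1) div 2 then 1 else -1)"
| "gmat (BIb p q) i = (if \<bar>i\<bar> \<le> (int q - 1) div 2 then -1 else 1)"
| "gmat (CII p q) i = (if \<bar>i\<bar> \<le> int p div 2 then 1 else -1)"
| "gmat (DIa p q) i = (if \<bar>i\<bar> \<le> int p div 2 then 1 else -1)"

text \<open>Throughout, a power series in \<open>u\<^sup>-\<^sup>1\<close> is an \<open>fps\<close> whose indeterminate \<open>fps_X\<close> stands for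
  \<open>u\<^sup>-\<^sup>1\<close>. The entry \<open>(1 - c u g) (1 - c u)\<^sup>-\<^sup>1\<close> with \<open>c = 4/(p - q)\<close> is, after multiplying
  numerator and denominator by \<open>u\<^sup>-\<^sup>1\<close>, the series \<open>(u\<^sup>-\<^sup>1 - c g) (u\<^sup>-\<^sup>1 - c)\<^sup>-\<^sup>1\<close>.\<close>

definition g_frac :: "nat \<Rightarrow> nat \<Rightarrow> complex \<Rightarrow> complex fps"
  where "g_frac p q g =
    (let c = 4 / (of_nat p - of_nat q)
     in (fps_X - fps_const (c * g)) * inverse (fps_X - fps_const c))"

fun gmat_series :: "pair_type \<Rightarrow> int \<Rightarrow> complex fps" where
  "gmat_series (BIa p q) i = g_frac p q (gmat (BIa p q) i)"
| "gmat_series (BIb p q) i = g_frac p q (gmat (BIb p q) i)"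
| "gmat_series (CII p q) i =
     (if p = q then fps_const (gmat (CII p q) i) else g_frac p q (gmat (CII p q) i))"
| "gmat_series (DIa p q) i =
     (if p = q then fps_const (gmat (DIa p q) i) else g_frac p q (gmat (DIa p q) i))"
| "gmat_series ty i = fps_const (gmat ty i)"

section \<open>The extended Yangian\<close>

text \<open>The letter \<open>(i, j, r)\<close> with \<open>r \<ge> 1\<close> is the generator \<open>t\<^sub>i\<^sub>j\<^sup>(\<^sup>r\<^sup>)\<close>.\<close>

type_synonym gen = "int \<times> int \<times> nat"

definition gens :: "nat \<Rightarrow> gen set"
  where "gens N = {(i, j, r). i \<in> idx N \<and> j \<in> idx N \<and> r \<ge> 1}"

definition t_coeff :: "int \<Rightarrow> int \<Rightarrow> nat \<Rightarrow> gen free_alg"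
  where "t_coeff i j r =
    (if r = 0 then (if i = j then 1 else 0) else Poly_Mapping.single (Word [(i, j, r)]) 1)"

definition t_series :: "int \<Rightarrow> int \<Rightarrow> gen free_alg fps"
  where "t_series i j = Abs_fps (t_coeff i j)"

text \<open>Series in \<open>u\<^sup>-\<^sup>1\<close> and \<open>v\<^sup>-\<^sup>1\<close> have type \<open>_ fps fps\<close>, the outer indeterminate being
  \<open>u\<^sup>-\<^sup>1\<close> and the inner one \<open>v\<^sup>-\<^sup>1\<close>.\<close>

definition t_in_u :: "int \<Rightarrow> int \<Rightarrow> gen free_alg fps fps"
  where "t_in_u i j = Abs_fps (\<lambda>r. fps_const (t_coeff i j r))"

definition t_in_v :: "int \<Rightarrow> int \<Rightarrow> gen free_alg fps fps"
  where "t_in_v i j = fps_const (t_series i j)"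

definition scalar2 :: "complex \<Rightarrow> gen free_alg fps fps"
  where "scalar2 c = fps_const (fps_const (scalar c))"

text \<open>Coefficients of \<open>E\<^sub>i\<^sub>j \<otimes> E\<^sub>k\<^sub>l\<close> in \<open>I\<close>, \<open>P\<close> and \<open>Q\<close>.\<close>

definition I_entry :: "int \<Rightarrow> int \<Rightarrow> int \<Rightarrow> int \<Rightarrow> complex"
  where "I_entry i j k l = (if i = j \<and> k = l then 1 else 0)"

definition P_entry :: "int \<Rightarrow> int \<Rightarrow> int \<Rightarrow> int \<Rightarrow> complex"
  where "P_entry i j k l = (if k = j \<and> l = i then 1 else 0)"

definition Q_entry :: "pair_type \<Rightarrow> int \<Rightarrow> int \<Rightarrow> int \<Rightarrow> int \<Rightarrow> complex"
  where "Q_entry ty i j k l = (if k = - i \<and> l = - j then theta ty i j else 0)"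

text \<open>The relation between rational functions \<open>R(u-v) T\<^sub>1(u) T\<^sub>2(v) = T\<^sub>2(v) T\<^sub>1(u) R(u-v)\<close> is
  read after multiplication by the common denominator \<open>(u-v) (u-v-\<kappa>)\<close>, i.e. with
  \<open>(u-v) (u-v-\<kappa>) R(u-v) = (u-v) (u-v-\<kappa>) I - (u-v-\<kappa>) P + (u-v) Q\<close>.
  To stay within power series in \<open>x = u\<^sup>-\<^sup>1\<close> and \<open>y = v\<^sup>-\<^sup>1\<close>, both sides are moreover multiplied by
  \<open>h\<^sup>2\<close>, where \<open>h = x y\<close>; note \<open>h (u-v) = y - x\<close>. Neither multiplication changes the ideal
  generated by the coefficients of the relation. The following is the coefficient of
  \<open>E\<^sub>i\<^sub>j \<otimes> E\<^sub>k\<^sub>l\<close> in \<open>h\<^sup>2 (u-v) (u-v-\<kappa>) R(u-v)\<close>.\<close>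

definition R_cleared ::
    "pair_type \<Rightarrow> nat \<Rightarrow> int \<Rightarrow> int \<Rightarrow> int \<Rightarrow> int \<Rightarrow> gen free_alg fps fps"
  where "R_cleared ty N i j k l =
    (let x = fps_X; y = fps_const fps_X; h = x * y; z = y - x; z' = z - scalar2 (kappa ty N) * h
     in z * z' * scalar2 (I_entry i j k l) - h * z' * scalar2 (P_entry i j k l)
        + h * z * scalar2 (Q_entry ty i j k l))"

text \<open>The coefficient of \<open>E\<^sub>i\<^sub>j \<otimes> E\<^sub>k\<^sub>l\<close> in \<open>R(u-v) T\<^sub>1(u) T\<^sub>2(v) - T\<^sub>2(v) T\<^sub>1(u) R(u-v)\<close>, with
  denominators cleared as above.\<close>

definition RTT_defect ::
    "pair_type \<Rightarrow> nat \<Rightarrow> int \<Rightarrow> int \<Rightarrow> int \<Rightarrow> int \<Rightarrow> gen free_alg fps fps"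
  where "RTT_defect ty N i j k l =
    (\<Sum>a\<in>idx N. \<Sum>b\<in>idx N. R_cleared ty N i a k b * t_in_u a j * t_in_v b l)
    - (\<Sum>a\<in>idx N. \<Sum>b\<in>idx N. t_in_v k b * t_in_u i a * R_cleared ty N a j b l)"

definition RTT_relations :: "pair_type \<Rightarrow> nat \<Rightarrow> gen free_alg set"
  where "RTT_relations ty N =
    {RTT_defect ty N i j k l $ r $ s | i j k l r s.
       i \<in> idx N \<and> j \<in> idx N \<and> k \<in> idx N \<and> l \<in> idx N}"

definition RTT_ideal :: "pair_type \<Rightarrow> nat \<Rightarrow> gen free_alg set"
  where "RTT_ideal ty N = genideal (free_ring (gens N)) (RTT_relations ty N)"

definition ext_yangian :: "pair_type \<Rightarrow> nat \<Rightarrow> gen free_alg set ring"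
  where "ext_yangian ty N = free_ring (gens N) Quot RTT_ideal ty N"

definition yangian_class :: "pair_type \<Rightarrow> nat \<Rightarrow> gen free_alg \<Rightarrow> gen free_alg set"
  where "yangian_class ty N p = RTT_ideal ty N +>\<^bsub>free_ring (gens N)\<^esub> p"

definition yangian_scalar :: "pair_type \<Rightarrow> nat \<Rightarrow> complex \<Rightarrow> gen free_alg set"
  where "yangian_scalar ty N c = yangian_class ty N (scalar c)"

section \<open>The extended twisted Yangian\<close>

text \<open>The series \<open>s\<^sub>i\<^sub>j(u)\<close> are formed in the free algebra and their coefficients are then mapped
  to the quotient.\<close>

definition lift_series :: "complex fps \<Rightarrow> gen free_alg fps"
  where "lift_series f = Abs_fps (\<lambda>r. scalar (f $ r))"

text \<open>\<open>(u - c)\<^sup>-\<^sup>1 = u\<^sup>-\<^sup>1 (1 - c u\<^sup>-\<^sup>1)\<^sup>-\<^sup>1\<close>; substituting this series (or its negative) for \<open>u\<^sup>-\<^sup>1\<close>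
  turns \<open>f(u)\<close> into \<open>f(u - c)\<close> (or \<open>f(-u + c)\<close>).\<close>

definition shifted_inv :: "complex \<Rightarrow> complex fps"
  where "shifted_inv c = fps_X * inverse (1 - fps_const c * fps_X)"

text \<open>Since \<open>(E\<^sub>i\<^sub>j)\<^sup>t = \<theta>\<^sub>i\<^sub>j E\<^sub>-\<^sub>j\<^sub>,\<^sub>-\<^sub>i\<close>, the coefficient of \<open>E\<^sub>i\<^sub>j\<close> in \<open>T\<^sup>t(u)\<close> is
  \<open>\<theta>\<^sub>-\<^sub>j\<^sub>,\<^sub>-\<^sub>i t\<^sub>-\<^sub>j\<^sub>,\<^sub>-\<^sub>i(u)\<close>.\<close>

definition tt_series :: "pair_type \<Rightarrow> int \<Rightarrow> int \<Rightarrow> gen free_alg fps"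
  where "tt_series ty i j = fps_const (scalar (theta ty (- j) (- i))) * t_series (- j) (- i)"

definition s_series :: "pair_type \<Rightarrow> nat \<Rightarrow> int \<Rightarrow> int \<Rightarrow> gen free_alg fps"
  where "s_series ty N i j =
    (\<Sum>a\<in>idx N.
       (t_series i a oo lift_series (shifted_inv (kappa ty N / 2)))
       * lift_series (gmat_series ty a)
       * (tt_series ty a j oo lift_series (- shifted_inv (kappa ty N / 2))))"

definition s_coeff :: "pair_type \<Rightarrow> nat \<Rightarrow> int \<Rightarrow> int \<Rightarrow> nat \<Rightarrow> gen free_alg set"
  where "s_coeff ty N i j r = yangian_class ty N (s_series ty N i j $ r)"

text \<open>The subalgebra generated by a set is the subring generated by that set and the scalars.\<close>

definition twisted_yangian :: "pair_type \<Rightarrow> nat \<Rightarrow> gen free_alg set set"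
  where "twisted_yangian ty N =
    generate_ring (ext_yangian ty N)
      (range (yangian_scalar ty N) \<union> {s_coeff ty N i j r | i j r. i \<in> idx N \<and> j \<in> idx N})"

section \<open>Representations\<close>

text \<open>A representation on the complex vector space given by the type \<open>'v\<close> and the scalar
  multiplication \<open>scale\<close>: a unital algebra homomorphism from the extended twisted Yangian to
  the linear endomorphisms. Values of \<open>\<rho>\<close> outside the algebra are irrelevant.\<close>

definition representation ::
    "pair_type \<Rightarrow> nat \<Rightarrow> (complex \<Rightarrow> 'v::ab_group_add \<Rightarrow> 'v) \<Rightarrow> (gen free_alg set \<Rightarrow> 'v \<Rightarrow> 'v) \<Rightarrow> bool"
  where "representation ty N scale \<rho> \<longleftrightarrow>
    vector_space scale
    \<and> (\<forall>x\<in>twisted_yangian ty N. Vector_Spaces.linear scale scale (\<rho> x))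
    \<and> (\<forall>x\<in>twisted_yangian ty N. \<forall>y\<in>twisted_yangian ty N.
         \<rho> (x \<oplus>\<^bsub>ext_yangian ty N\<^esub> y) = (\<lambda>v. \<rho> x v + \<rho> y v)
         \<and> \<rho> (x \<otimes>\<^bsub>ext_yangian ty N\<^esub> y) = \<rho> x \<circ> \<rho> y)
    \<and> (\<forall>c. \<rho> (yangian_scalar ty N c) = scale c)"

definition irreducible_representation ::
    "pair_type \<Rightarrow> nat \<Rightarrow> (complex \<Rightarrow> 'v::ab_group_add \<Rightarrow> 'v) \<Rightarrow> (gen free_alg set \<Rightarrow> 'v \<Rightarrow> 'v) \<Rightarrow> bool"
  where "irreducible_representation ty N scale \<rho> \<longleftrightarrow>
    representation ty N scale \<rho>
    \<and> (\<exists>v::'v. v \<noteq> 0)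
    \<and> (\<forall>W. module.subspace scale W \<and> (\<forall>x\<in>twisted_yangian ty N. \<rho> x ` W \<subseteq> W)
           \<longrightarrow> W = {0} \<or> W = UNIV)"

definition highest_weight_vector ::
    "pair_type \<Rightarrow> nat \<Rightarrow> (complex \<Rightarrow> 'v::ab_group_add \<Rightarrow> 'v) \<Rightarrow> (gen free_alg set \<Rightarrow> 'v \<Rightarrow> 'v) \<Rightarrow> 'v \<Rightarrow> bool"
  where "highest_weight_vector ty N scale \<rho> \<eta> \<longleftrightarrow>
    \<eta> \<noteq> 0
    \<and> (\<lambda>x. \<rho> x \<eta>) ` twisted_yangian ty N = UNIV
    \<and> (\<forall>i\<in>idx N. \<forall>j\<in>idx N. i < j \<longrightarrow> (\<forall>r. \<rho> (s_coeff ty N i j r) \<eta> = 0))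
    \<and> (\<exists>\<mu> :: int \<Rightarrow> complex fps. \<forall>i\<in>idx N. i \<ge> 0 \<longrightarrow>
         \<mu> i $ 0 = gmat ty i \<and> (\<forall>r. \<rho> (s_coeff ty N i i r) \<eta> = scale (\<mu> i $ r) \<eta>))"

definition highest_weight_representation ::
    "pair_type \<Rightarrow> nat \<Rightarrow> (complex \<Rightarrow> 'v::ab_group_add \<Rightarrow> 'v) \<Rightarrow> (gen free_alg set \<Rightarrow> 'v \<Rightarrow> 'v) \<Rightarrow> bool"
  where "highest_weight_representation ty N scale \<rho> \<longleftrightarrow>
    representation ty N scale \<rho> \<and> (\<exists>\<eta>. highest_weight_vector ty N scale \<rho> \<eta>)"

end

theory Submission
  imports Defs "HOL-Library.Function_Algebras" "HOL-Library.Multiset"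
    "HOL-Computational_Algebra.Fundamental_Theorem_Algebra"
begin

text \<open>The coefficients of \<open>S(u)\<close> satisfy the reflection equation
  \<open>R(u-v) S\<^sub>1(u) R(u+v) S\<^sub>2(v) = S\<^sub>2(v) R(u+v) S\<^sub>1(u) R(u-v)\<close>, a consequence of the defining
  relation, of its partial transposes and of the same equation for \<open>\<G>(u)\<close>. It shows that
  commutators of generators have smaller degree, so every element is a sum of words in diagonal
  generators, words that begin with a lowering and words that end with a raising generator. The
  element \<open>H = - \<Sum>\<^sub>i\<^sub>>\<^sub>0 i / (2 g\<^sub>i\<^sub>i) s\<^sub>i\<^sub>i\<^sup>(\<^sup>1\<^sup>)\<close> shifts degrees, \<open>[H, s\<^sub>k\<^sub>l(u)] = (l - k) s\<^sub>k\<^sub>l(u)\<close>, hence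
  raising generators kill its top eigenspace. The diagonal generators commute there: the
  reflection equation is invariant under \<open>s\<^sub>i\<^sub>j(u) \<mapsto> s\<^sub>j\<^sub>i(u)\<close> with reversed products, and a
  palindromic choice of the diagonal words is fixed by this reversal (Gelfand's trick). A common
  eigenvector is a highest weight vector, and irreducibility makes the top eigenspace a line that
  contains all highest weight vectors.\<close>

section \<open>Rings of additive endomorphisms\<close>

text \<open>The transposition s_ij -> s_ji is not constructed as a map of the twisted Yangian, where
  every relation would have to be checked. Reordering of words rests on the reflection equation
  alone, so it is enough that the pairs (s_ij, s_ji), multiplied in opposite orders, satisfy that
  equation again: the spanning statement applied to pairs controls an operator together with its
  transpose.

  The shifts by \<kappa>/2 in S(u) come from crossing: transposing one tensor factor of R exchanges
  P and Q, and R(\<kappa> - w) becomes R(w). Two shifts by \<kappa>/2 therefore put exactly R(u+v)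
  between T^t and T.

  Finite dimension enters through eigenvectors: H has a last eigenvalue \<omega> along a chain of
  steps 1, and a commuting family has a common eigenvector. Irreducibility makes the eigenspaces for
  \<omega>, \<omega> - 1, \<omega> - 2, ... span V. Vectors killed by a product of factors H -
  \<omega> + j with j > 0 then serve as a complement of the top eigenspace, and all comparisons are
  made modulo such vectors.\<close>

typedef (overloaded) 'v endo = "{f :: 'v::ab_group_add \<Rightarrow> 'v. \<forall>x y. f (x + y) = f x + f y}"
  morphisms app Endo
  by (rule exI[of _ id]) simp

setup_lifting type_definition_endo

text \<open>Additivity is all that is asked, so that one ring serves both matrices over a
  noncommutative ring and the operators of a representation; complex linearity reappears as
  commutation with scalars. The class is not \<open>ring_1\<close>, which would demand
  \<open>0 \<noteq> 1\<close> even over the zero group.\<close>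

instantiation endo :: (ab_group_add) "{ring, monoid_mult}"
begin
lift_definition zero_endo :: "'a endo" is "\<lambda>_. 0" by simp
lift_definition one_endo :: "'a endo" is "\<lambda>x. x" by simp
lift_definition plus_endo :: "'a endo \<Rightarrow> 'a endo \<Rightarrow> 'a endo" is "\<lambda>f g x. f x + g x"
  by (simp add: algebra_simps)
lift_definition minus_endo :: "'a endo \<Rightarrow> 'a endo \<Rightarrow> 'a endo" is "\<lambda>f g x. f x - g x"
  by (simp add: algebra_simps)
lift_definition uminus_endo :: "'a endo \<Rightarrow> 'a endo" is "\<lambda>f x. - f x"
  by (simp add: algebra_simps)
lift_definition times_endo :: "'a endo \<Rightarrow> 'a endo \<Rightarrow> 'a endo" is "\<lambda>f g x. f (g x)"
  by simp
instance
  by standard (transfer; simp add: algebra_simps fun_eq_iff)+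
end

lemma app_add [simp]: "app f (x + y) = app f x + app f y"
  by transfer simp

lemma endo_eqI: "(\<And>x. app f x = app g x) \<Longrightarrow> f = g"
  by transfer (simp add: fun_eq_iff)

lemma additive_app: "additive (app f)"
  by (simp add: additive_def)

lemma app_zero [simp]: "app f 0 = 0"
  by (rule additive.zero[OF additive_app])

lemma app_simps [simp]:
  "app 0 x = 0" "app 1 x = x" "app (f + g) x = app f x + app g x"
  "app (f - g) x = app f x - app g x" "app (- f) x = - app f x" "app (f * g) x = app f (app g x)"
  by (transfer, simp)+

lemma sum_app: "app (sum f A) x = (\<Sum>a\<in>A. app (f a) x)"
  by (induct A rule: infinite_finite_induct) auto

lemma app_Endo [simp]: "(\<And>x y. f (x + y) = f x + f y) \<Longrightarrow> app (Endo f) = f"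
  by (simp add: Endo_inverse)

section \<open>Central scalars and substitution in power series\<close>

text \<open>The target is of class \<open>ring\<close>, without unit: \<open>ring_1\<close> contains
  \<open>0 \<noteq> 1\<close>, a nontriviality of the quotient algebras that is nowhere established
  here. By \<open>hom_one\<close> the image of 1 acts as a unit.\<close>

locale central_scalars =
  fixes \<phi> :: "'k::comm_ring_1 \<Rightarrow> 'a::ring"
  assumes hom_add: "\<phi> (a + b) = \<phi> a + \<phi> b"
    and hom_mult: "\<phi> (a * b) = \<phi> a * \<phi> b"
    and hom_one: "\<phi> 1 * x = x"
    and central: "\<phi> a * x = x * \<phi> a"
begin

lemma additive_hom: "additive \<phi>"
  by (simp add: additive_def hom_add)

lemma hom_zero: "\<phi> 0 = 0"
  by (rule additive.zero[OF additive_hom])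

lemma hom_diff: "\<phi> (a - b) = \<phi> a - \<phi> b"
  by (rule additive.diff[OF additive_hom])

lemma hom_minus: "\<phi> (- a) = - \<phi> a"
  by (rule additive.minus[OF additive_hom])

lemma hom_sum: "\<phi> (sum f A) = (\<Sum>a\<in>A. \<phi> (f a))"
  by (rule additive.sum[OF additive_hom])

lemma hom_one_right: "x * \<phi> 1 = x"
  using central hom_one by metis

lemma central_left: "y * (\<phi> a * x) = \<phi> a * (y * x)"
  by (metis central mult.assoc)

lemma hom_mult_assoc: "\<phi> a * (\<phi> b * x) = \<phi> (a * b) * x"
  by (simp add: hom_mult mult.assoc)

end

definition fps_map :: "('a \<Rightarrow> 'b) \<Rightarrow> 'a fps \<Rightarrow> 'b fps"
  where "fps_map f F = Abs_fps (\<lambda>n. f (F $ n))"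

lemma fps_map_nth [simp]: "fps_map f F $ n = f (F $ n)"
  by (simp add: fps_map_def)

lemma central_scalars_fps_map:
  assumes "central_scalars \<phi>"
  shows "central_scalars (fps_map \<phi>)"
proof -
  interpret central_scalars \<phi> by fact
  show ?thesis
  proof
    fix F G :: "'a fps" and H :: "'b fps"
    show "fps_map \<phi> (F + G) = fps_map \<phi> F + fps_map \<phi> G"
      by (simp add: fps_eq_iff hom_add)
    show "fps_map \<phi> (F * G) = fps_map \<phi> F * fps_map \<phi> G"
      by (simp add: fps_eq_iff fps_mult_nth hom_mult hom_sum)
    show "fps_map \<phi> 1 * H = H"
    proof (rule fps_ext)
      fix n
      have "(fps_map \<phi> 1 * H) $ n = (\<Sum>i=0..n. if i = 0 then H $ n else 0)"
        unfolding fps_mult_nth by (rule sum.cong) (auto simp: hom_one hom_zero)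
      then show "(fps_map \<phi> 1 * H) $ n = H $ n" by simp
    qed
    show "fps_map \<phi> F * H = H * fps_map \<phi> F"
    proof (rule fps_ext)
      fix n
      have "(fps_map \<phi> F * H) $ n = (\<Sum>i=0..n. H $ (n - i) * \<phi> (F $ i))"
        unfolding fps_mult_nth by (intro sum.cong refl) (simp, rule central)
      also have "\<dots> = (\<Sum>i=0..n. H $ (n - (n - i)) * \<phi> (F $ (n - i)))"
        by (rule sum.atLeastAtMost_rev[of _ 0 n, simplified])
      also have "\<dots> = (H * fps_map \<phi> F) $ n"
        unfolding fps_mult_nth by (rule sum.cong) auto
      finally show "(fps_map \<phi> F * H) $ n = (H * fps_map \<phi> F) $ n" .
    qed
  qed
qed

lemma central_scalars_id: "central_scalars (\<lambda>x :: 'k::comm_ring_1. x)"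
  by standard (simp_all add: mult.commute)

text \<open>The composition \<open>f oo \<alpha>\<close> with the coefficients of
  \<open>\<alpha>\<close> kept in the scalars: their centrality makes it multiplicative although
  \<open>'a\<close> is noncommutative and may lack a unit.\<close>

definition fps_subst :: "('k::comm_ring_1 \<Rightarrow> 'a::ring) \<Rightarrow> 'k fps \<Rightarrow> 'a fps \<Rightarrow> 'a fps"
  where "fps_subst \<phi> \<alpha> f = Abs_fps (\<lambda>n. \<Sum>i=0..n. f $ i * \<phi> (\<alpha> ^ i $ n))"

lemma fps_subst_add: "fps_subst \<phi> \<alpha> (f + g) = fps_subst \<phi> \<alpha> f + fps_subst \<phi> \<alpha> g"
  by (simp add: fps_subst_def fps_eq_iff distrib_right sum.distrib)

context central_scalars
begin

lemma fps_subst_nth: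
  assumes "\<alpha> $ 0 = 0" "n \<le> M"
  shows "fps_subst \<phi> \<alpha> f $ n = (\<Sum>i=0..M. f $ i * \<phi> (\<alpha> ^ i $ n))"
  unfolding fps_subst_def fps_nth_Abs_fps
  by (rule sum.mono_neutral_left)
     (use assms in \<open>auto simp: startsby_zero_power_prefix hom_zero\<close>)

lemma fps_subst_mult:
  assumes "\<alpha> $ 0 = 0"
  shows "fps_subst \<phi> \<alpha> (f * g) = fps_subst \<phi> \<alpha> f * fps_subst \<phi> \<alpha> g"
proof (rule fps_ext)
  fix n
  have pw: "(\<Sum>k=0..n. \<phi> (\<alpha> ^ i $ k) * \<phi> (\<alpha> ^ j $ (n - k))) = \<phi> (\<alpha> ^ (i + j) $ n)" for i j
    by (simp add: power_add fps_mult_nth hom_sum hom_mult)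
  have re: "(a * \<phi> p) * (b * \<phi> q) = a * b * (\<phi> p * \<phi> q)" for a b p q
  proof -
    have "(a * \<phi> p) * (b * \<phi> q) = a * ((\<phi> p * b) * \<phi> q)" by (simp only: mult.assoc)
    also have "\<phi> p * b = b * \<phi> p" by (rule central)
    finally show ?thesis by (simp only: mult.assoc)
  qed
  have "(fps_subst \<phi> \<alpha> f * fps_subst \<phi> \<alpha> g) $ n
      = (\<Sum>k=0..n. (\<Sum>i=0..n. f $ i * \<phi> (\<alpha> ^ i $ k)) * (\<Sum>j=0..n. g $ j * \<phi> (\<alpha> ^ j $ (n - k))))"
    unfolding fps_mult_nth
    by (rule sum.cong) (auto simp: fps_subst_nth[OF assms, of _ n])
  also have "\<dots> = (\<Sum>k=0..n. \<Sum>i=0..n. \<Sum>j=0..n. f $ i * g $ j * (\<phi> (\<alpha> ^ i $ k) * \<phi> (\<alpha> ^ j $ (n - k))))"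
    by (simp only: sum_product re)
  also have "\<dots> = (\<Sum>i=0..n. \<Sum>k=0..n. \<Sum>j=0..n. f $ i * g $ j * (\<phi> (\<alpha> ^ i $ k) * \<phi> (\<alpha> ^ j $ (n - k))))"
    by (rule sum.swap)
  also have "\<dots> = (\<Sum>i=0..n. \<Sum>j=0..n. f $ i * g $ j * (\<Sum>k=0..n. \<phi> (\<alpha> ^ i $ k) * \<phi> (\<alpha> ^ j $ (n - k))))"
    by (rule sum.cong[OF refl], subst sum.swap) (simp add: sum_distrib_left)
  also have "\<dots> = (\<Sum>i=0..n. \<Sum>j=0..n. f $ i * g $ j * \<phi> (\<alpha> ^ (i + j) $ n))"
    by (simp add: pw)
  \<comment> \<open>The power \<open>\<alpha> ^ (i + j)\<close> starts at order i + j, so the square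
    of index pairs shrinks to the triangle needed for a Cauchy product.\<close>
  also have "\<dots> = (\<Sum>i=0..n. \<Sum>j=0..n - i. f $ i * g $ j * \<phi> (\<alpha> ^ (i + j) $ n))"
    by (intro sum.cong refl sum.mono_neutral_right)
       (use assms in \<open>auto simp: startsby_zero_power_prefix hom_zero\<close>)
  also have "\<dots> = (\<Sum>(i, j)\<in>(SIGMA i:{0..n}. {0..n - i}). f $ i * g $ j * \<phi> (\<alpha> ^ (i + j) $ n))"
    by (subst sum.Sigma) auto
  also have "\<dots> = (\<Sum>(m, i)\<in>(SIGMA m:{0..n}. {0..m}). f $ i * g $ (m - i) * \<phi> (\<alpha> ^ m $ n))"
    by (rule sum.reindex_bij_witness[of _ "\<lambda>(m, i). (i, m - i)" "\<lambda>(i, j). (i + j, i)"]) auto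
  also have "\<dots> = (\<Sum>m=0..n. \<Sum>i=0..m. f $ i * g $ (m - i) * \<phi> (\<alpha> ^ m $ n))"
    by (subst sum.Sigma) auto
  also have "\<dots> = fps_subst \<phi> \<alpha> (f * g) $ n"
    by (simp add: fps_subst_def fps_mult_nth sum_distrib_right)
  finally show "fps_subst \<phi> \<alpha> (f * g) $ n = (fps_subst \<phi> \<alpha> f * fps_subst \<phi> \<alpha> g) $ n" ..
qed

lemma fps_subst_map: "fps_subst \<phi> \<alpha> (fps_map \<phi> p) = fps_map \<phi> (fps_subst (\<lambda>x. x) \<alpha> p)"
  by (simp add: fps_subst_def fps_eq_iff hom_sum hom_mult)

lemma fps_subst_const: "fps_subst \<phi> \<alpha> (fps_const c) = fps_const c"
proof (rule fps_ext)
  fix n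
  have "fps_subst \<phi> \<alpha> (fps_const c) $ n = (\<Sum>i=0..n. if i = 0 then c * \<phi> (1 $ n) else 0)"
    unfolding fps_subst_def fps_nth_Abs_fps by (rule sum.cong) auto
  then show "fps_subst \<phi> \<alpha> (fps_const c) $ n = fps_const c $ n"
    by (simp add: hom_one_right hom_zero)
qed

end

lemma fps_subst_id: "fps_subst (\<lambda>x. x) \<alpha> f = f oo \<alpha>"
  by (simp add: fps_subst_def fps_eq_iff fps_compose_nth)

definition outer :: "'a::zero fps \<Rightarrow> 'a fps fps"
  where "outer f = fps_map fps_const f"

lemma outer_nth [simp]: "outer f $ n = fps_const (f $ n)"
  by (simp add: outer_def)

lemma outer_mult: "outer (f * g) = outer f * outer (g :: 'a::ring fps)"
  by (simp add: fps_eq_iff fps_mult_nth fps_sum_nth)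

lemma outer_add: "outer (f + g) = outer f + outer (g :: 'a::ring fps)"
  by (simp add: fps_eq_iff)

lemma outer_sum: "outer (sum f A) = (\<Sum>a\<in>A. outer (f a :: 'a::ring fps))"
  by (induct A rule: infinite_finite_induct) (auto simp: outer_add, simp_all add: fps_eq_iff)

lemma outer_power: "outer (f ^ n) = outer (f :: 'a::ring_1 fps) ^ n"
  by (induct n) (simp_all add: outer_mult, simp add: fps_eq_iff)

definition fps_swap :: "'a fps fps \<Rightarrow> 'a fps fps"
  where "fps_swap F = Abs_fps (\<lambda>n. Abs_fps (\<lambda>m. F $ m $ n))"

lemma fps_swap_nth [simp]: "fps_swap F $ m $ n = F $ n $ m"
  by (simp add: fps_swap_def)

lemma fps_swap_add: "fps_swap (F + G) = fps_swap F + fps_swap (G :: 'a::ring fps fps)"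
  by (simp add: fps_eq_iff)

lemma fps_swap_mult: "fps_swap (F * G) = fps_swap F * fps_swap (G :: 'a::ring fps fps)"
proof -
  have "(F * G) $ m $ n = (fps_swap F * fps_swap G) $ n $ m" for m n
    by (simp add: fps_mult_nth fps_sum_nth) (rule sum.swap)
  then show ?thesis by (simp add: fps_eq_iff)
qed

lemma fps_swap_outer [simp]: "fps_swap (outer f) = fps_const f"
  by (simp add: fps_eq_iff)

lemma fps_swap_const [simp]: "fps_swap (fps_const f) = outer f"
  by (simp add: fps_eq_iff)

lemma fps_swap_map: "fps_swap (fps_map (fps_map f) F) = fps_map (fps_map f) (fps_swap F)"
  by (simp add: fps_eq_iff)

text \<open>Substitution of \<open>\<alpha>\<close> for the outer and of \<open>\<beta>\<close> for the inner indeterminate.\<close>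

definition subst2 ::
    "(complex \<Rightarrow> 'a::ring) \<Rightarrow> complex fps \<Rightarrow> complex fps \<Rightarrow> 'a fps fps \<Rightarrow> 'a fps fps"
  where "subst2 \<phi> \<alpha> \<beta> F = fps_swap (fps_subst (fps_map \<phi>) (outer \<beta>)
      (fps_swap (fps_subst (fps_map \<phi>) (outer \<alpha>) F)))"

context
  fixes \<phi> :: "complex \<Rightarrow> 'a::ring"
  assumes cs: "central_scalars \<phi>"
begin

interpretation central_scalars \<phi> by (rule cs)
interpretation fs: central_scalars "fps_map \<phi>" by (rule central_scalars_fps_map[OF cs])

lemma subst2_add: "subst2 \<phi> \<alpha> \<beta> (F + G) = subst2 \<phi> \<alpha> \<beta> F + subst2 \<phi> \<alpha> \<beta> G"
  by (simp add: subst2_def fps_subst_add fps_swap_add)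

lemma subst2_mult:
  assumes "\<alpha> $ 0 = 0" "\<beta> $ 0 = 0"
  shows "subst2 \<phi> \<alpha> \<beta> (F * G) = subst2 \<phi> \<alpha> \<beta> F * subst2 \<phi> \<alpha> \<beta> G"
  using assms by (simp add: subst2_def fs.fps_subst_mult fps_swap_mult)

lemma subst2_map:
  "subst2 \<phi> \<alpha> \<beta> (fps_map (fps_map \<phi>) P) = fps_map (fps_map \<phi>) (subst2 (\<lambda>x. x) \<alpha> \<beta> P)"
proof -
  have e: "fps_map (\<lambda>x::complex. x) = (\<lambda>x. x)" by (simp add: fun_eq_iff fps_eq_iff)
  show ?thesis by (simp add: subst2_def fs.fps_subst_map fps_swap_map e)
qed

lemma fps_subst_outer:
  "fps_subst (fps_map \<phi>) (outer \<alpha>) (outer f) = outer (fps_subst \<phi> \<alpha> f)"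
proof (rule fps_ext)
  fix n
  have "fps_map \<phi> (fps_const c) = fps_const (\<phi> c)" for c
    by (simp add: fps_eq_iff hom_zero)
  then show "fps_subst (fps_map \<phi>) (outer \<alpha>) (outer f) $ n = outer (fps_subst \<phi> \<alpha> f) $ n"
    by (simp add: fps_subst_def flip: outer_power) (simp add: fps_eq_iff fps_sum_nth)
qed

lemma subst2_outer: "subst2 \<phi> \<alpha> \<beta> (outer f) = outer (fps_subst \<phi> \<alpha> f)"
  by (simp add: subst2_def fps_subst_outer fs.fps_subst_const)

lemma subst2_const: "subst2 \<phi> \<alpha> \<beta> (fps_const f) = fps_const (fps_subst \<phi> \<beta> f)"
  by (simp add: subst2_def fps_subst_outer fs.fps_subst_const)

end

section \<open>Operators on the tensor square\<close>

text \<open>Vectors of the tensor square are functions of two indices. Matrices with entries in a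
  noncommutative ring act on them by additive endomorphisms, which makes products of matrices
  associative for free. Entries outside the index set are annihilated.\<close>

locale rmatrix = central_scalars \<phi> for \<phi> :: "'k::comm_ring_1 \<Rightarrow> 'a::ring" +
  fixes I :: "int set" and \<theta> :: "int \<Rightarrow> int \<Rightarrow> 'k" and \<zeta> :: 'k
  assumes finite_I: "finite I"
    and neg_I: "\<And>i. i \<in> I \<Longrightarrow> - i \<in> I"
    and theta_sym: "\<And>i j. \<theta> i j = \<theta> j i"
    and theta_neg: "\<And>i j. i \<in> I \<Longrightarrow> \<theta> (- i) j = \<zeta> * \<theta> i j"
    and theta_mult: "\<And>i a j. a \<in> I \<Longrightarrow> \<theta> i a * \<theta> a j = \<theta> i j"
    and theta_diag: "\<And>i. i \<in> I \<Longrightarrow> \<theta> i i = 1"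
    and zeta_sq: "\<zeta> * \<zeta> = 1"
begin

lemma neg_I_iff [simp]: "- i \<in> I \<longleftrightarrow> i \<in> I"
  using neg_I[of i] neg_I[of "- i"] by auto

lemma sum_neg_I: "(\<Sum>a\<in>I. f (- a)) = (\<Sum>a\<in>I. f a)"
  by (rule sum.reindex_bij_witness[of _ uminus uminus]) auto

lemma theta_neg_right: "j \<in> I \<Longrightarrow> \<theta> i (- j) = \<zeta> * \<theta> i j"
  using theta_neg theta_sym by metis

lemma zeta_cancel: "\<zeta> * (\<zeta> * x) = x"
  by (simp add: zeta_sq flip: mult.assoc)

definition Sc :: "'k \<Rightarrow> (int \<Rightarrow> int \<Rightarrow> 'a) endo"
  where "Sc p = Endo (\<lambda>f i k. \<phi> p * f i k)"

definition M1 :: "(int \<Rightarrow> int \<Rightarrow> 'a) \<Rightarrow> (int \<Rightarrow> int \<Rightarrow> 'a) endo"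
  where "M1 U = Endo (\<lambda>f i k. if i \<in> I \<and> k \<in> I then \<Sum>a\<in>I. U i a * f a k else 0)"

definition M2 :: "(int \<Rightarrow> int \<Rightarrow> 'a) \<Rightarrow> (int \<Rightarrow> int \<Rightarrow> 'a) endo"
  where "M2 U = Endo (\<lambda>f i k. if i \<in> I \<and> k \<in> I then \<Sum>b\<in>I. U k b * f i b else 0)"

definition D1 :: "(int \<Rightarrow> 'k) \<Rightarrow> (int \<Rightarrow> int \<Rightarrow> 'a) endo"
  where "D1 g = Endo (\<lambda>f i k. \<phi> (g i) * f i k)"

definition D2 :: "(int \<Rightarrow> 'k) \<Rightarrow> (int \<Rightarrow> int \<Rightarrow> 'a) endo"
  where "D2 g = Endo (\<lambda>f i k. \<phi> (g k) * f i k)"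

definition Pm :: "(int \<Rightarrow> int \<Rightarrow> 'a) endo"
  where "Pm = Endo (\<lambda>f i k. f k i)"

definition Qm :: "(int \<Rightarrow> int \<Rightarrow> 'a) endo"
  where "Qm = Endo (\<lambda>f i k. if k = - i \<and> i \<in> I then \<Sum>a\<in>I. \<phi> (\<theta> i a) * f a (- a) else 0)"

text \<open>The value \<open>K i j k l\<close> is the coefficient of E_ij \<otimes> E_kl. Products
  are brought to this form so that \<open>Ker_inj\<close> can compare entries.\<close>

definition Ker :: "(int \<Rightarrow> int \<Rightarrow> int \<Rightarrow> int \<Rightarrow> 'a) \<Rightarrow> (int \<Rightarrow> int \<Rightarrow> 'a) endo"
  where "Ker K = Endo (\<lambda>f i k. if i \<in> I \<and> k \<in> I then \<Sum>j\<in>I. \<Sum>l\<in>I. K i j k l * f j l else 0)"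

lemma app_ops:
  "app (Sc p) f i k = \<phi> p * f i k"
  "app (M1 U) f i k = (if i \<in> I \<and> k \<in> I then \<Sum>a\<in>I. U i a * f a k else 0)"
  "app (M2 U) f i k = (if i \<in> I \<and> k \<in> I then \<Sum>b\<in>I. U k b * f i b else 0)"
  "app (D1 g) f i k = \<phi> (g i) * f i k"
  "app (D2 g) f i k = \<phi> (g k) * f i k"
  "app Pm f i k = f k i"
  "app Qm f i k = (if k = - i \<and> i \<in> I then \<Sum>a\<in>I. \<phi> (\<theta> i a) * f a (- a) else 0)"
  "app (Ker K) f i k = (if i \<in> I \<and> k \<in> I then \<Sum>j\<in>I. \<Sum>l\<in>I. K i j k l * f j l else 0)"
  unfolding Sc_def M1_def M2_def D1_def D2_def Pm_def Qm_def Ker_def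
  by (subst app_Endo; auto simp: fun_eq_iff algebra_simps sum.distrib)+

lemma op_eqI: "(\<And>f i k. app X f i k = app Y f i k) \<Longrightarrow> X = Y"
  by (rule endo_eqI) (simp add: fun_eq_iff)

definition rmat :: "'k \<Rightarrow> 'k \<Rightarrow> 'k \<Rightarrow> (int \<Rightarrow> int \<Rightarrow> 'a) endo"
  where "rmat a b c = Sc a - Sc b * Pm + Sc c * Qm"

lemma Sc_one: "Sc 1 = 1"
  by (rule op_eqI) (simp add: app_ops hom_one)

lemma Sc_zero: "Sc 0 = 0"
  by (rule op_eqI) (simp add: app_ops hom_zero)

lemma Sc_add: "Sc (p + q) = Sc p + Sc q"
  by (rule op_eqI) (simp add: app_ops hom_add distrib_right)

lemma Sc_minus: "Sc (- p) = - Sc p"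
  by (rule op_eqI) (simp add: app_ops hom_minus)

lemma Sc_diff: "Sc (p - q) = Sc p - Sc q"
  by (rule op_eqI) (simp add: app_ops hom_diff left_diff_distrib)

lemma Sc_mult: "Sc (p * q) = Sc p * Sc q"
  by (rule op_eqI) (simp add: app_ops hom_mult mult.assoc)

lemma Sc_central:
  "M1 U * Sc p = Sc p * M1 U" "M2 U * Sc p = Sc p * M2 U" "D1 g * Sc p = Sc p * D1 g"
  "D2 g * Sc p = Sc p * D2 g" "Pm * Sc p = Sc p * Pm" "Qm * Sc p = Sc p * Qm"
  "Ker K * Sc p = Sc p * Ker K"
proof -
  have c: "x * (\<phi> p * f) = \<phi> p * (x * f)" for x f by (rule central_left)
  show "M1 U * Sc p = Sc p * M1 U" "M2 U * Sc p = Sc p * M2 U" "Ker K * Sc p = Sc p * Ker K"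
    by (rule op_eqI; simp only: app_ops app_simps c; simp add: sum_distrib_left)+
  show "D1 g * Sc p = Sc p * D1 g" "D2 g * Sc p = Sc p * D2 g"
    by (rule op_eqI; simp add: app_ops hom_mult_assoc mult.commute)+
  show "Pm * Sc p = Sc p * Pm"
    by (rule op_eqI; simp add: app_ops)
  show "Qm * Sc p = Sc p * Qm"
    by (rule op_eqI; simp add: app_ops sum_distrib_left hom_mult_assoc mult.commute)
qed

section \<open>Relations among P, Q and diagonal matrices\<close>

lemma PP: "Pm * Pm = 1"
  by (rule op_eqI) (simp add: app_ops)

lemma PM: "Pm * M1 U = M2 U * Pm" "Pm * M2 U = M1 U * Pm"
  by (rule op_eqI; simp add: app_ops)+

lemma PD: "Pm * D1 g = D2 g * Pm" "Pm * D2 g = D1 g * Pm"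
  by (rule op_eqI; simp add: app_ops)+

text \<open>Exchanging the tensor factors replaces the row index i of \<open>\<theta> i a\<close> by
  -i. This costs the sign \<open>\<zeta>\<close>: 1 in the orthogonal, -1 in the symplectic
  case.\<close>

lemma PQ: "Pm * Qm = Sc \<zeta> * Qm"
  by (rule op_eqI) (auto simp: app_ops theta_neg sum_distrib_left hom_mult_assoc zeta_cancel intro!: sum.cong)

lemma QP: "Qm * Pm = Sc \<zeta> * Qm"
proof (rule op_eqI)
  fix f i k
  have "(\<Sum>a\<in>I. \<phi> (\<theta> i a) * f (- a) a) = (\<Sum>a\<in>I. \<phi> (\<zeta> * \<theta> i a) * f a (- a))"
    by (subst sum_neg_I[symmetric]) (auto simp: theta_neg_right intro!: sum.cong)
  then show "app (Qm * Pm) f i k = app (Sc \<zeta> * Qm) f i k"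
    by (simp add: app_ops sum_distrib_left hom_mult_assoc)
qed

lemma QQ: "Qm * Qm = Sc (of_nat (card I)) * Qm"
proof (rule op_eqI)
  fix f i k
  have "(\<Sum>a\<in>I. \<phi> (\<theta> i a) * (\<Sum>b\<in>I. \<phi> (\<theta> a b) * f b (- b)))
      = (\<Sum>a\<in>I. \<Sum>b\<in>I. \<phi> (\<theta> i b) * f b (- b))"
    by (simp add: sum_distrib_left hom_mult_assoc theta_mult)
  also have "\<dots> = \<phi> (of_nat (card I)) * (\<Sum>b\<in>I. \<phi> (\<theta> i b) * f b (- b))"
    by (subst sum.swap) (simp add: sum_distrib_left hom_sum[of "\<lambda>_. 1" I, simplified] sum_distrib_right hom_one)
  finally show "app (Qm * Qm) f i k = app (Sc (of_nat (card I)) * Qm) f i k"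
    by (simp add: app_ops)
qed

text \<open>Q has rank one, so Q X Q is a multiple of Q; for a diagonal X in one factor the multiple
  is the trace. \<open>QQ\<close> is the case X = 1.\<close>

lemma QDQ: "Qm * (D1 g * Qm) = Sc (\<Sum>a\<in>I. g a) * Qm"
proof (rule op_eqI)
  fix f i k
  have "(\<Sum>a\<in>I. \<phi> (\<theta> i a) * (\<phi> (g a) * (\<Sum>b\<in>I. \<phi> (\<theta> a b) * f b (- b))))
      = (\<Sum>a\<in>I. \<Sum>b\<in>I. \<phi> (g a * \<theta> i b) * f b (- b))"
  proof (rule sum.cong[OF refl])
    fix a assume "a \<in> I"
    then have "\<theta> i a * (g a * \<theta> a b) = g a * \<theta> i b" for b
      using theta_mult[of a i b] by (metis mult.left_commute)
    then show "\<phi> (\<theta> i a) * (\<phi> (g a) * (\<Sum>b\<in>I. \<phi> (\<theta> a b) * f b (- b)))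
        = (\<Sum>b\<in>I. \<phi> (g a * \<theta> i b) * f b (- b))"
      by (simp add: sum_distrib_left hom_mult_assoc)
  qed
  also have "\<dots> = \<phi> (\<Sum>a\<in>I. g a) * (\<Sum>b\<in>I. \<phi> (\<theta> i b) * f b (- b))"
    by (simp add: hom_sum sum_product hom_mult mult.assoc)
  finally show "app (Qm * (D1 g * Qm)) f i k = app (Sc (\<Sum>a\<in>I. g a) * Qm) f i k"
    by (simp add: app_ops)
qed

lemma Q_D2: "(\<And>i. i \<in> I \<Longrightarrow> g (- i) = \<eta> * g i) \<Longrightarrow> Qm * D2 g = Sc \<eta> * (Qm * D1 g)"
  by (rule op_eqI) (auto simp: app_ops sum_distrib_left hom_mult_assoc mult_ac intro!: sum.cong)

lemma D2_Q: "(\<And>i. i \<in> I \<Longrightarrow> g (- i) = \<eta> * g i) \<Longrightarrow> D2 g * Qm = Sc \<eta> * (D1 g * Qm)"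
  by (rule op_eqI) (auto simp: app_ops hom_mult_assoc)

lemma DD: "D2 g * D1 h = D1 h * D2 g"
  by (rule op_eqI) (simp add: app_ops hom_mult_assoc mult.commute)

lemma D_sq: "(\<And>i. g i * g i = 1) \<Longrightarrow> D1 g * D1 g = 1" "(\<And>i. g i * g i = 1) \<Longrightarrow> D2 g * D2 g = 1"
  by (rule op_eqI; simp add: app_ops hom_mult_assoc hom_one)+

lemma D1_M2: "M2 U * D1 g = D1 g * M2 U" "M1 U * D2 g = D2 g * M1 U"
proof -
  have c: "x * (\<phi> p * f) = \<phi> p * (x * f)" for x f p by (rule central_left)
  show "M2 U * D1 g = D1 g * M2 U" "M1 U * D2 g = D2 g * M1 U"
    by (rule op_eqI; simp only: app_ops app_simps c; simp add: sum_distrib_left)+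
qed

section \<open>Products of matrices as kernels\<close>

lemma Ker_cong:
  "(\<And>i j k l. i \<in> I \<Longrightarrow> j \<in> I \<Longrightarrow> k \<in> I \<Longrightarrow> l \<in> I \<Longrightarrow> K i j k l = K' i j k l) \<Longrightarrow> Ker K = Ker K'"
  by (rule op_eqI) (simp add: app_ops cong: sum.cong)

lemma Ker_inj:
  assumes "Ker K = Ker K'" "i \<in> I" "j \<in> I" "k \<in> I" "l \<in> I"
  shows "K i j k l = K' i j k l"
proof -
  \<comment> \<open>A matrix unit as test vector; \<open>\<phi> 1\<close> stands in for the missing
    unit of \<open>'a\<close>.\<close>
  define f where "f = (\<lambda>a b. if a = j then if b = l then \<phi> 1 else 0 else 0)"
  have "app (Ker K) f i k = K i j k l" for K
  proof -
    have "app (Ker K) f i k = (\<Sum>a\<in>I. if a = j then \<Sum>b\<in>I. if b = l then K i j k l else 0 else 0)"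
      unfolding app_ops using assms by (auto simp: f_def hom_one_right intro!: sum.cong)
    then show ?thesis using assms finite_I by simp
  qed
  then show ?thesis using assms(1) by metis
qed

lemma Ker_add: "Ker K + Ker K' = Ker (\<lambda>i j k l. K i j k l + K' i j k l)"
  by (rule op_eqI) (simp add: app_ops distrib_right sum.distrib)

lemma Ker_diff: "Ker K - Ker K' = Ker (\<lambda>i j k l. K i j k l - K' i j k l)"
  by (rule op_eqI) (simp add: app_ops left_diff_distrib sum_subtractf)

lemma Sc_Ker: "Sc p * Ker K = Ker (\<lambda>i j k l. \<phi> p * K i j k l)"
  by (rule op_eqI) (simp add: app_ops sum_distrib_left mult.assoc)

lemma P_Ker: "Pm * Ker K = Ker (\<lambda>i j k l. K k j i l)"
  by (rule op_eqI) (auto simp: app_ops)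

lemma Ker_P: "Ker K * Pm = Ker (\<lambda>i j k l. K i l k j)"
proof (rule op_eqI)
  fix f i k
  show "app (Ker K * Pm) f i k = app (Ker (\<lambda>i j k l. K i l k j)) f i k"
    by (simp add: app_ops sum.swap[of "\<lambda>j l. K i j k l * f l j"])
qed

lemma Q_Ker: "Qm * Ker K = Ker (\<lambda>i j k l. if k = - i then \<Sum>a\<in>I. \<phi> (\<theta> i a) * K a j (- a) l else 0)"
proof (rule op_eqI)
  fix f i k
  have "(\<Sum>a\<in>I. \<phi> (\<theta> i a) * (\<Sum>j\<in>I. \<Sum>l\<in>I. K a j (- a) l * f j l))
      = (\<Sum>a\<in>I. \<Sum>j\<in>I. \<Sum>l\<in>I. \<phi> (\<theta> i a) * K a j (- a) l * f j l)"
    by (simp add: sum_distrib_left mult.assoc)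
  also have "\<dots> = (\<Sum>j\<in>I. \<Sum>a\<in>I. \<Sum>l\<in>I. \<phi> (\<theta> i a) * K a j (- a) l * f j l)"
    by (rule sum.swap)
  also have "\<dots> = (\<Sum>j\<in>I. \<Sum>l\<in>I. (\<Sum>a\<in>I. \<phi> (\<theta> i a) * K a j (- a) l) * f j l)"
    by (rule sum.cong[OF refl], subst sum.swap) (simp add: sum_distrib_right)
  finally show "app (Qm * Ker K) f i k
      = app (Ker (\<lambda>i j k l. if k = - i then \<Sum>a\<in>I. \<phi> (\<theta> i a) * K a j (- a) l else 0)) f i k"
    by (simp add: app_ops)
qed

lemma Ker_Q: "Ker K * Qm = Ker (\<lambda>i j k l. if l = - j then \<Sum>a\<in>I. K i a k (- a) * \<phi> (\<theta> a j) else 0)"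
proof (rule op_eqI)
  fix f i k
  have "(\<Sum>a\<in>I. \<Sum>b\<in>I. K i a k b * (if b = - a \<and> a \<in> I then \<Sum>j\<in>I. \<phi> (\<theta> a j) * f j (- j) else 0))
      = (\<Sum>a\<in>I. \<Sum>b\<in>I. if b = - a then K i a k (- a) * (\<Sum>j\<in>I. \<phi> (\<theta> a j) * f j (- j)) else 0)"
    by (intro sum.cong refl) auto
  also have "\<dots> = (\<Sum>a\<in>I. \<Sum>j\<in>I. K i a k (- a) * \<phi> (\<theta> a j) * f j (- j))"
    by (simp add: finite_I sum_distrib_left mult.assoc)
  also have "\<dots> = (\<Sum>j\<in>I. (\<Sum>a\<in>I. K i a k (- a) * \<phi> (\<theta> a j)) * f j (- j))"
    by (subst sum.swap) (simp add: sum_distrib_right)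
  also have "\<dots> = (\<Sum>j\<in>I. \<Sum>l\<in>I. if l = - j then (\<Sum>a\<in>I. K i a k (- a) * \<phi> (\<theta> a j)) * f j (- j) else 0)"
    by (simp add: finite_I)
  also have "\<dots> = (\<Sum>j\<in>I. \<Sum>l\<in>I. (if l = - j then \<Sum>a\<in>I. K i a k (- a) * \<phi> (\<theta> a j) else 0) * f j l)"
    by (intro sum.cong refl) auto
  finally show "app (Ker K * Qm) f i k
      = app (Ker (\<lambda>i j k l. if l = - j then \<Sum>a\<in>I. K i a k (- a) * \<phi> (\<theta> a j) else 0)) f i k"
    by (simp add: app_ops)
qed

lemma M1_M2: "M1 U * M2 V = Ker (\<lambda>i j k l. U i j * V k l)"
  by (rule op_eqI) (auto simp: app_ops sum_distrib_left mult.assoc)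

lemma M2_M1: "M2 V * M1 U = Ker (\<lambda>i j k l. V k l * U i j)"
proof (rule op_eqI)
  fix f i k
  have "(\<Sum>l\<in>I. V k l * (\<Sum>j\<in>I. U i j * f j l)) = (\<Sum>j\<in>I. \<Sum>l\<in>I. V k l * U i j * f j l)"
    by (subst sum.swap) (simp add: sum_distrib_left mult.assoc)
  then show "app (M2 V * M1 U) f i k = app (Ker (\<lambda>i j k l. V k l * U i j)) f i k"
    by (auto simp: app_ops)
qed

lemma M1_P_M2: "M1 U * (Pm * M2 V) = Ker (\<lambda>i j k l. if k = j then \<Sum>a\<in>I. U i a * V a l else 0)"
proof (rule op_eqI)
  fix f :: "int \<Rightarrow> int \<Rightarrow> 'a" and i k :: int
  have "(\<Sum>a\<in>I. U i a * (\<Sum>l\<in>I. V a l * f k l)) = (\<Sum>l\<in>I. (\<Sum>a\<in>I. U i a * V a l) * f k l)"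
    by (simp only: sum_distrib_left sum_distrib_right mult.assoc) (rule sum.swap)
  also have "\<dots> = (\<Sum>j\<in>I. if j = k then \<Sum>l\<in>I. (\<Sum>a\<in>I. U i a * V a l) * f k l else 0)" if "k \<in> I"
    using that finite_I by simp
  also have "\<dots> = (\<Sum>j\<in>I. \<Sum>l\<in>I. (if k = j then \<Sum>a\<in>I. U i a * V a l else 0) * f j l)"
    by (intro sum.cong refl) auto
  finally show "app (M1 U * (Pm * M2 V)) f i k
      = app (Ker (\<lambda>i j k l. if k = j then \<Sum>a\<in>I. U i a * V a l else 0)) f i k"
    by (simp add: app_ops)
qed

lemma M1_Q_M2: "M1 U * (Qm * M2 V) = Ker (\<lambda>i j k l. \<phi> (\<theta> (- k) j) * (U i (- k) * V (- j) l))"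
proof (rule op_eqI)
  fix f i k
  have "(\<Sum>a\<in>I. U i a * app (Qm * M2 V) f a k) = (\<Sum>a\<in>I. if a = - k then U i (- k) *
        (\<Sum>j\<in>I. \<phi> (\<theta> (- k) j) * (\<Sum>l\<in>I. V (- j) l * f j l)) else 0)"
    by (intro sum.cong refl) (auto simp: app_ops)
  also have "\<dots> = (\<Sum>j\<in>I. \<Sum>l\<in>I. \<phi> (\<theta> (- k) j) * (U i (- k) * V (- j) l) * f j l)" if "k \<in> I"
    using that finite_I by (simp add: sum_distrib_left mult.assoc central_left[of "U i (- k)"])
  finally have *: "k \<in> I \<Longrightarrow> (\<Sum>a\<in>I. U i a * app (Qm * M2 V) f a k)
      = (\<Sum>j\<in>I. \<Sum>l\<in>I. \<phi> (\<theta> (- k) j) * (U i (- k) * V (- j) l) * f j l)" .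
  have "a \<in> I \<Longrightarrow> k \<notin> I \<Longrightarrow> app (Qm * M2 V) f a k = 0" for a
    by (auto simp: app_ops)
  with * show "app (M1 U * (Qm * M2 V)) f i k
      = app (Ker (\<lambda>i j k l. \<phi> (\<theta> (- k) j) * (U i (- k) * V (- j) l))) f i k"
    unfolding app_simps(6)[of "M1 U"] app_ops(2)[of U] app_ops(8) by (simp cong: sum.cong)
qed

text \<open>Conjugation by P interchanges the tensor factors and reduces this to
  \<open>M1_P_M2\<close>; \<open>M2_Q_M1\<close> follows from \<open>M1_Q_M2\<close> in the same
  way.\<close>

lemma M2_P_M1: "M2 V * (Pm * M1 U) = Ker (\<lambda>i j k l. if i = l then \<Sum>a\<in>I. V k a * U a j else 0)"
proof -
  have "M2 V * (Pm * M1 U) = Pm * (M1 V * (Pm * M2 U)) * Pm"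
  proof -
    have "Pm * (M1 V * (Pm * M2 U)) * Pm = (Pm * M1 V) * Pm * (M2 U * Pm)" by (simp only: mult.assoc)
    also have "\<dots> = M2 V * (Pm * Pm) * (Pm * M1 U)" by (simp only: PM mult.assoc)
    finally show ?thesis by (simp add: PP)
  qed
  also have "\<dots> = Ker (\<lambda>i j k l. if i = l then \<Sum>a\<in>I. V k a * U a j else 0)"
    by (simp add: M1_P_M2 P_Ker Ker_P)
  finally show ?thesis .
qed

lemma M2_Q_M1: "M2 V * (Qm * M1 U) = Ker (\<lambda>i j k l. \<phi> (\<theta> i (- l)) * (V k (- i) * U (- l) j))"
proof -
  have that: "Pm * Qm * Pm = Qm"
    by (simp add: PQ QP mult.assoc) (simp add: zeta_sq Sc_one flip: mult.assoc Sc_mult)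
  have "M2 V * (Qm * M1 U) = Pm * (M1 V * (Qm * M2 U)) * Pm"
  proof -
    have "Pm * (M1 V * (Qm * M2 U)) * Pm = (Pm * M1 V) * Qm * (M2 U * Pm)" by (simp only: mult.assoc)
    also have "\<dots> = M2 V * (Pm * Qm * Pm) * M1 U" by (simp only: PM mult.assoc)
    finally show ?thesis unfolding that by (simp add: mult.assoc)
  qed
  also have "\<dots> = Ker (\<lambda>i j k l. \<phi> (\<theta> (- i) l) * (V k (- i) * U (- l) j))"
    by (simp add: M1_Q_M2 P_Ker Ker_P)
  also have "\<dots> = Ker (\<lambda>i j k l. \<phi> (\<theta> i (- l)) * (V k (- i) * U (- l) j))"
    by (rule Ker_cong) (simp add: theta_neg theta_neg_right)
  finally show ?thesis .
qed

end

section \<open>The RTT relation and its transposes\<close>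

context rmatrix
begin

text \<open>The coefficient of E_ij \<otimes> E_kl in R U_1 V_2 = V_2 U_1 R for R = a I - b P + c Q,
  with the sums against the sparse entries of P and Q already evaluated.\<close>

definition rtt :: "'k \<Rightarrow> 'k \<Rightarrow> 'k \<Rightarrow> (int \<Rightarrow> int \<Rightarrow> 'a) \<Rightarrow> (int \<Rightarrow> int \<Rightarrow> 'a) \<Rightarrow> bool"
  where "rtt a b c U V \<longleftrightarrow> (\<forall>i\<in>I. \<forall>j\<in>I. \<forall>k\<in>I. \<forall>l\<in>I.
    \<phi> a * (U i j * V k l) - \<phi> b * (U k j * V i l)
      + (if k = - i then \<phi> c * (\<Sum>m\<in>I. \<phi> (\<theta> i m) * (U m j * V (- m) l)) else 0)
    = \<phi> a * (V k l * U i j) - \<phi> b * (V k j * U i l)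
      + (if l = - j then \<phi> c * (\<Sum>m\<in>I. \<phi> (\<theta> m j) * (V k (- m) * U i m)) else 0))"

definition mt :: "(int \<Rightarrow> int \<Rightarrow> 'a) \<Rightarrow> int \<Rightarrow> int \<Rightarrow> 'a"
  where "mt U i j = \<phi> (\<theta> i j) * U (- j) (- i)"

lemma rttD:
  assumes "rtt a b c U V" "i \<in> I" "j \<in> I" "k \<in> I" "l \<in> I"
  shows "\<phi> a * (U i j * V k l) - \<phi> b * (U k j * V i l)
      + (if k = - i then \<phi> c * (\<Sum>m\<in>I. \<phi> (\<theta> i m) * (U m j * V (- m) l)) else 0)
    = \<phi> a * (V k l * U i j) - \<phi> b * (V k j * U i l)
      + (if l = - j then \<phi> c * (\<Sum>m\<in>I. \<phi> (\<theta> m j) * (V k (- m) * U i m)) else 0)"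
  using assms unfolding rtt_def by blast

lemma rmat_mult_left: "rmat a b c * X = Sc a * X - Sc b * (Pm * X) + Sc c * (Qm * X)"
  by (simp add: rmat_def algebra_simps)

lemma rmat_mult_right:
  assumes "\<And>p. X * Sc p = Sc p * X"
  shows "X * rmat a b c = Sc a * X - Sc b * (X * Pm) + Sc c * (X * Qm)"
proof -
  have "X * (Sc p * Y) = Sc p * (X * Y)" for p Y
    using assms by (metis mult.assoc)
  then show ?thesis by (simp add: rmat_def algebra_simps assms)
qed

lemma rmat_Ker: "rmat a b c * Ker K = Ker (\<lambda>i j k l. \<phi> a * K i j k l - \<phi> b * K k j i l
    + (if k = - i then \<phi> c * (\<Sum>m\<in>I. \<phi> (\<theta> i m) * K m j (- m) l) else 0))"
  by (simp add: rmat_mult_left P_Ker Q_Ker Sc_Ker Ker_diff Ker_add if_distrib[of "(*) _"] cong: if_cong)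

lemma Ker_rmat: "Ker K * rmat a b c = Ker (\<lambda>i j k l. \<phi> a * K i j k l - \<phi> b * K i l k j
    + (if l = - j then \<phi> c * (\<Sum>m\<in>I. K i m k (- m) * \<phi> (\<theta> m j)) else 0))"
  by (simp add: rmat_mult_right Sc_central Ker_P Ker_Q Sc_Ker Ker_diff Ker_add if_distrib[of "(*) _"] cong: if_cong)

lemma M1_rmat_M2: "M1 U * (rmat a b c * M2 V) = Ker (\<lambda>i j k l.
    \<phi> a * (U i j * V k l) - \<phi> b * (if k = j then \<Sum>m\<in>I. U i m * V m l else 0)
      + \<phi> c * (\<phi> (\<theta> (- k) j) * (U i (- k) * V (- j) l)))"
proof -
  have "M1 U * (rmat a b c * M2 V)
      = Sc a * (M1 U * M2 V) - Sc b * (M1 U * (Pm * M2 V)) + Sc c * (M1 U * (Qm * M2 V))"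
    by (simp add: rmat_mult_left algebra_simps) (simp add: Sc_central flip: mult.assoc)
  then show ?thesis by (simp add: M1_M2 M1_P_M2 M1_Q_M2 Sc_Ker Ker_add Ker_diff)
qed

lemma M2_rmat_M1: "M2 V * (rmat a b c * M1 U) = Ker (\<lambda>i j k l.
    \<phi> a * (V k l * U i j) - \<phi> b * (if i = l then \<Sum>m\<in>I. V k m * U m j else 0)
      + \<phi> c * (\<phi> (\<theta> i (- l)) * (V k (- i) * U (- l) j)))"
proof -
  have "M2 V * (rmat a b c * M1 U)
      = Sc a * (M2 V * M1 U) - Sc b * (M2 V * (Pm * M1 U)) + Sc c * (M2 V * (Qm * M1 U))"
    by (simp add: rmat_mult_left algebra_simps) (simp add: Sc_central flip: mult.assoc)
  then show ?thesis by (simp add: M2_M1 M2_P_M1 M2_Q_M1 Sc_Ker Ker_add Ker_diff)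
qed

lemma rtt_matrix:
  assumes "rtt a b c U V"
  shows "rmat a b c * (M1 U * M2 V) = M2 V * (M1 U * rmat a b c)"
  unfolding mult.assoc[symmetric, of "M2 V"] M1_M2 M2_M1 rmat_Ker Ker_rmat
  using rttD[OF assms] by (intro Ker_cong) (simp add: central[of "\<theta> _ _", symmetric])

text \<open>Transposing the first tensor factor turns P into Q and Q into P, so R becomes a I - b Q
  + c P, which is \<open>rmat a (- c) (- b)\<close>, and it reverses products there, which moves R
  between the two matrices. Entrywise this is \<open>rtt\<close> at (-j, -i, k, l), multiplied by
  \<open>\<theta> i j\<close>.\<close>

lemma rtt_transpose_first:
  assumes "rtt a b c U V"
  shows "M1 (mt U) * (rmat a (- c) (- b) * M2 V) = M2 V * (rmat a (- c) (- b) * M1 (mt U))"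
  unfolding M1_rmat_M2 M2_rmat_M1
proof (rule Ker_cong)
  fix i j k l assume I: "i \<in> I" "j \<in> I" "k \<in> I" "l \<in> I"
  let ?t = "\<theta> i j"
  have c: "U x y * (\<phi> p * f) = \<phi> p * (U x y * f)" "V x y * (\<phi> p * f) = \<phi> p * (V x y * f)" for x y f p
    by (rule central_left)+
  \<comment> \<open>The matrix product that accompanies P after the transposition is the former Q
    term, up to \<open>\<theta> i j\<close>; \<open>s2\<close> is the same on the other
    side.\<close>
  have s1: "(\<Sum>m\<in>I. mt U i m * V m l) = \<phi> ?t * (\<Sum>m\<in>I. \<phi> (\<theta> (- j) m) * (U m (- i) * V (- m) l))"
  proof -
    have "(\<Sum>m\<in>I. mt U i m * V m l) = (\<Sum>m\<in>I. mt U i (- m) * V (- m) l)"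
      by (rule sum_neg_I[symmetric])
    also have "\<dots> = (\<Sum>m\<in>I. \<phi> (?t * \<theta> (- j) m) * (U m (- i) * V (- m) l))"
    proof (rule sum.cong[OF refl])
      fix m assume m: "m \<in> I"
      have "?t * \<theta> (- j) m = \<theta> i (- m)"
        using I m theta_mult[of j i m] by (simp add: theta_neg theta_neg_right mult.left_commute)
      then show "mt U i (- m) * V (- m) l = \<phi> (?t * \<theta> (- j) m) * (U m (- i) * V (- m) l)"
        by (simp add: mt_def mult.assoc)
    qed
    finally show ?thesis by (simp add: sum_distrib_left hom_mult_assoc)
  qed
  have s2: "(\<Sum>m\<in>I. V k m * mt U m j) = \<phi> ?t * (\<Sum>m\<in>I. \<phi> (\<theta> m (- i)) * (V k (- m) * U (- j) m))"
  proof -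
    have "(\<Sum>m\<in>I. V k m * mt U m j) = (\<Sum>m\<in>I. V k (- m) * mt U (- m) j)"
      by (rule sum_neg_I[symmetric])
    also have "\<dots> = (\<Sum>m\<in>I. \<phi> (?t * \<theta> m (- i)) * (V k (- m) * U (- j) m))"
    proof (rule sum.cong[OF refl])
      fix m assume m: "m \<in> I"
      have "?t * \<theta> m (- i) = \<theta> (- m) j"
        using I m theta_mult[of i m j] by (simp add: theta_neg theta_neg_right mult_ac)
      then show "V k (- m) * mt U (- m) j = \<phi> (?t * \<theta> m (- i)) * (V k (- m) * U (- j) m)"
        by (simp add: mt_def c)
    qed
    finally show ?thesis by (simp add: sum_distrib_left hom_mult_assoc)
  qed
  have t1: "\<theta> (- k) j * \<theta> i (- k) = ?t" "\<theta> i (- l) * \<theta> (- l) j = ?t"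
    using I theta_mult[of "- k" i j] theta_mult[of "- l" i j] by (simp_all add: mult.commute)
  have m1: "\<phi> (\<theta> (- k) j) * (mt U i (- k) * V (- j) l) = \<phi> ?t * (U k (- i) * V (- j) l)"
    by (simp add: mt_def hom_mult_assoc t1 mult.assoc)
  have m2: "\<phi> (\<theta> i (- l)) * (V k (- i) * mt U (- l) j) = \<phi> ?t * (V k (- i) * U (- j) l)"
    by (simp add: mt_def c hom_mult_assoc t1)
  have "\<phi> ?t * (\<phi> a * (U (- j) (- i) * V k l) - \<phi> b * (U k (- i) * V (- j) l)
      + (if k = - (- j) then \<phi> c * (\<Sum>m\<in>I. \<phi> (\<theta> (- j) m) * (U m (- i) * V (- m) l)) else 0))
    = \<phi> ?t * (\<phi> a * (V k l * U (- j) (- i)) - \<phi> b * (V k (- i) * U (- j) l)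
      + (if l = - (- i) then \<phi> c * (\<Sum>m\<in>I. \<phi> (\<theta> m (- i)) * (V k (- m) * U (- j) m)) else 0))"
    using rttD[OF assms, of "- j" "- i" k l] I by simp
  then show "\<phi> a * (mt U i j * V k l) - \<phi> (- c) * (if k = j then \<Sum>m\<in>I. mt U i m * V m l else 0)
      + \<phi> (- b) * (\<phi> (\<theta> (- k) j) * (mt U i (- k) * V (- j) l))
    = \<phi> a * (V k l * mt U i j) - \<phi> (- c) * (if i = l then \<Sum>m\<in>I. V k m * mt U m j else 0)
      + \<phi> (- b) * (\<phi> (\<theta> i (- l)) * (V k (- i) * mt U (- l) j))"
    unfolding s1 s2 m1 m2 mt_def[of U i j] by (simp add: algebra_simps hom_minus hom_mult_assoc c split: if_splits)
qed

text \<open>Transposing both factors fixes P and Q and reverses all products: \<open>rtt\<close> is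
  read at (-j, -i, -l, -k).\<close>

lemma rtt_transpose_both:
  assumes "rtt a b c U V"
  shows "M1 (mt U) * (M2 (mt V) * rmat a b c) = rmat a b c * (M2 (mt V) * M1 (mt U))"
  unfolding mult.assoc[symmetric, of "M1 (mt U)"] M1_M2 M2_M1 rmat_Ker Ker_rmat
proof (rule Ker_cong)
  fix i j k l assume I: "i \<in> I" "j \<in> I" "k \<in> I" "l \<in> I"
  let ?t = "\<theta> i j * \<theta> k l"
  have c: "U x y * (\<phi> p * f) = \<phi> p * (U x y * f)" "V x y * (\<phi> p * f) = \<phi> p * (V x y * f)" for x y f p
    by (rule central_left)+
  have UV: "mt U i' j' * mt V k' l' = \<phi> (\<theta> i' j' * \<theta> k' l') * (U (- j') (- i') * V (- l') (- k'))"
    for i' j' k' l' by (simp add: mt_def c hom_mult_assoc mult.assoc mult.commute)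
  have VU: "mt V k' l' * mt U i' j' = \<phi> (\<theta> i' j' * \<theta> k' l') * (V (- l') (- k') * U (- j') (- i'))"
    for i' j' k' l' by (simp add: mt_def c hom_mult_assoc mult.assoc mult.commute)
  \<comment> \<open>By \<open>theta_mult\<close> and \<open>theta_diag\<close> the form behaves like
    a product of signs, so four indices may be paired in either way.\<close>
  have t: "\<theta> i l * \<theta> k j = ?t" "\<theta> k j * \<theta> i l = ?t"
  proof -
    have "\<theta> i l = \<theta> i j * \<theta> j l" "\<theta> k l = \<theta> k j * \<theta> j l" "\<theta> j l * \<theta> j l = 1"
      using I theta_mult[of j i l] theta_mult[of j k l] theta_mult[of l j j] theta_diag[of j]
      by (simp_all add: theta_sym[of l j])
    then show "\<theta> i l * \<theta> k j = ?t" "\<theta> k j * \<theta> i l = ?t"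
      by (simp_all add: mult_ac)
  qed
  have s1: "(\<Sum>m\<in>I. mt U i m * mt V k (- m) * \<phi> (\<theta> m j))
      = \<phi> ?t * (\<Sum>m\<in>I. \<phi> (\<theta> (- j) m) * (U m (- i) * V (- m) (- k)))" if "l = - j"
  proof -
    have "(\<Sum>m\<in>I. mt U i m * mt V k (- m) * \<phi> (\<theta> m j))
        = (\<Sum>m\<in>I. mt U i (- m) * mt V k m * \<phi> (\<theta> (- m) j))"
      by (subst sum_neg_I[symmetric]) simp
    also have "\<dots> = (\<Sum>m\<in>I. \<phi> (?t * \<theta> (- j) m) * (U m (- i) * V (- m) (- k)))"
    proof (rule sum.cong[OF refl])
      fix m assume m: "m \<in> I"
      have "\<theta> m j * \<theta> m j = 1"
        using I m theta_mult[of j m m] theta_diag[of m] by (simp add: theta_sym[of j m])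
      then have "\<theta> (- m) j * (\<theta> i (- m) * \<theta> k m) = ?t * \<theta> (- j) m"
        using I m theta_mult[of j i m] theta_mult[of j k m] that
        by (simp add: theta_neg theta_neg_right mult_ac theta_sym[of j m] zeta_cancel flip: theta_mult[of j i m] theta_mult[of j k m])
      then show "mt U i (- m) * mt V k m * \<phi> (\<theta> (- m) j) = \<phi> (?t * \<theta> (- j) m) * (U m (- i) * V (- m) (- k))"
        unfolding central[of "\<theta> (- m) j" "mt U i (- m) * mt V k m", symmetric] unfolding UV hom_mult_assoc by simp
    qed
    finally show ?thesis by (simp add: sum_distrib_left hom_mult_assoc)
  qed
  have s2: "(\<Sum>m\<in>I. \<phi> (\<theta> i m) * (mt V (- m) l * mt U m j))
      = \<phi> ?t * (\<Sum>m\<in>I. \<phi> (\<theta> m (- i)) * (V (- l) (- m) * U (- j) m))" if "k = - i"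
  proof -
    have "(\<Sum>m\<in>I. \<phi> (\<theta> i m) * (mt V (- m) l * mt U m j))
        = (\<Sum>m\<in>I. \<phi> (\<theta> i (- m)) * (mt V m l * mt U (- m) j))"
      by (subst sum_neg_I[symmetric]) simp
    also have "\<dots> = (\<Sum>m\<in>I. \<phi> (?t * \<theta> m (- i)) * (V (- l) (- m) * U (- j) m))"
    proof (rule sum.cong[OF refl])
      fix m assume m: "m \<in> I"
      have "\<theta> m i * \<theta> m i = 1"
        using I m theta_mult[of i m m] theta_diag[of m] by (simp add: theta_sym[of i m])
      then have "\<theta> i (- m) * (\<theta> (- m) j * \<theta> m l) = ?t * \<theta> m (- i)"
        using I m that
        by (simp add: theta_neg theta_neg_right mult_ac theta_sym[of i m] zeta_cancel flip: theta_mult[of i m j] theta_mult[of i m l])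
      then show "\<phi> (\<theta> i (- m)) * (mt V m l * mt U (- m) j) = \<phi> (?t * \<theta> m (- i)) * (V (- l) (- m) * U (- j) m)"
        unfolding VU hom_mult_assoc by simp
    qed
    finally show ?thesis by (simp add: sum_distrib_left hom_mult_assoc)
  qed
  have e1: "(if l = - j then \<phi> c * (\<Sum>m\<in>I. mt U i m * mt V k (- m) * \<phi> (\<theta> m j)) else 0)
      = (if l = - j then \<phi> c * (\<phi> ?t * (\<Sum>m\<in>I. \<phi> (\<theta> (- j) m) * (U m (- i) * V (- m) (- k)))) else 0)"
    using s1 by simp
  have e2: "(if k = - i then \<phi> c * (\<Sum>m\<in>I. \<phi> (\<theta> i m) * (mt V (- m) l * mt U m j)) else 0)
      = (if k = - i then \<phi> c * (\<phi> ?t * (\<Sum>m\<in>I. \<phi> (\<theta> m (- i)) * (V (- l) (- m) * U (- j) m))) else 0)"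
    using s2 by simp
  have "\<phi> ?t * (\<phi> a * (U (- j) (- i) * V (- l) (- k)) - \<phi> b * (U (- l) (- i) * V (- j) (- k))
      + (if - l = - (- j) then \<phi> c * (\<Sum>m\<in>I. \<phi> (\<theta> (- j) m) * (U m (- i) * V (- m) (- k))) else 0))
    = \<phi> ?t * (\<phi> a * (V (- l) (- k) * U (- j) (- i)) - \<phi> b * (V (- l) (- i) * U (- j) (- k))
      + (if - k = - (- i) then \<phi> c * (\<Sum>m\<in>I. \<phi> (\<theta> m (- i)) * (V (- l) (- m) * U (- j) m)) else 0))"
    using rttD[OF assms, of "- j" "- i" "- l" "- k"] I by simp
  then show "\<phi> a * (mt U i j * mt V k l) - \<phi> b * (mt U i l * mt V k j)
      + (if l = - j then \<phi> c * (\<Sum>m\<in>I. mt U i m * mt V k (- m) * \<phi> (\<theta> m j)) else 0)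
    = \<phi> a * (mt V k l * mt U i j) - \<phi> b * (mt V i l * mt U k j)
      + (if k = - i then \<phi> c * (\<Sum>m\<in>I. \<phi> (\<theta> i m) * (mt V (- m) l * mt U m j)) else 0)"
    unfolding e1 e2 unfolding UV VU t
    by (cases "l = - j"; cases "k = - i") (simp_all add: algebra_simps hom_mult_assoc)
qed

end

section \<open>The reflection equation\<close>

text \<open>The entries of \<open>S\<^sub>1(u) R(u+v) S\<^sub>2(v)\<close> and \<open>R(u-v) S\<^sub>1(u) R(u+v) S\<^sub>2(v)\<close> and of their mirror
  images, where \<open>U\<close> and \<open>V\<close> stand for \<open>S(u)\<close> and \<open>S(v)\<close>, and \<open>R = a I - b P + c Q\<close>.\<close>

definition mid_left ::
    "('k \<Rightarrow> 'a::ring) \<Rightarrow> int set \<Rightarrow> (int \<Rightarrow> int \<Rightarrow> 'k) \<Rightarrow> 'k \<Rightarrow> 'k \<Rightarrow> 'k \<Rightarrow> (int \<Rightarrow> int \<Rightarrow> 'a)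
      \<Rightarrow> (int \<Rightarrow> int \<Rightarrow> 'a) \<Rightarrow> int \<Rightarrow> int \<Rightarrow> int \<Rightarrow> int \<Rightarrow> 'a"
  where "mid_left \<phi> I \<theta> a b c U V i j k l =
    \<phi> a * (U i j * V k l) - \<phi> b * (if k = j then \<Sum>m\<in>I. U i m * V m l else 0)
      + \<phi> c * (\<phi> (\<theta> (- k) j) * (U i (- k) * V (- j) l))"

definition mid_right ::
    "('k \<Rightarrow> 'a::ring) \<Rightarrow> int set \<Rightarrow> (int \<Rightarrow> int \<Rightarrow> 'k) \<Rightarrow> 'k \<Rightarrow> 'k \<Rightarrow> 'k \<Rightarrow> (int \<Rightarrow> int \<Rightarrow> 'a)
      \<Rightarrow> (int \<Rightarrow> int \<Rightarrow> 'a) \<Rightarrow> int \<Rightarrow> int \<Rightarrow> int \<Rightarrow> int \<Rightarrow> 'a"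
  where "mid_right \<phi> I \<theta> a b c U V i j k l =
    \<phi> a * (V k l * U i j) - \<phi> b * (if i = l then \<Sum>m\<in>I. V k m * U m j else 0)
      + \<phi> c * (\<phi> (\<theta> i (- l)) * (V k (- i) * U (- l) j))"

definition refl_left ::
    "('k \<Rightarrow> 'a::ring) \<Rightarrow> int set \<Rightarrow> (int \<Rightarrow> int \<Rightarrow> 'k) \<Rightarrow> 'k \<Rightarrow> 'k \<Rightarrow> 'k
      \<Rightarrow> (int \<Rightarrow> int \<Rightarrow> int \<Rightarrow> int \<Rightarrow> 'a) \<Rightarrow> int \<Rightarrow> int \<Rightarrow> int \<Rightarrow> int \<Rightarrow> 'a"
  where "refl_left \<phi> I \<theta> a b c M i j k l =
    \<phi> a * M i j k l - \<phi> b * M k j i l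
      + (if k = - i then \<phi> c * (\<Sum>m\<in>I. \<phi> (\<theta> i m) * M m j (- m) l) else 0)"

definition refl_right ::
    "('k \<Rightarrow> 'a::ring) \<Rightarrow> int set \<Rightarrow> (int \<Rightarrow> int \<Rightarrow> 'k) \<Rightarrow> 'k \<Rightarrow> 'k \<Rightarrow> 'k
      \<Rightarrow> (int \<Rightarrow> int \<Rightarrow> int \<Rightarrow> int \<Rightarrow> 'a) \<Rightarrow> int \<Rightarrow> int \<Rightarrow> int \<Rightarrow> int \<Rightarrow> 'a"
  where "refl_right \<phi> I \<theta> a b c M i j k l =
    \<phi> a * M i j k l - \<phi> b * M i l k j
      + (if l = - j then \<phi> c * (\<Sum>m\<in>I. \<phi> (\<theta> m j) * M i m k (- m)) else 0)"

context rmatrix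
begin

lemma refl_left_Ker: "rmat a b c * (M1 U * (rmat a' b' c' * M2 V))
    = Ker (refl_left \<phi> I \<theta> a b c (mid_left \<phi> I \<theta> a' b' c' U V))"
  unfolding M1_rmat_M2 rmat_Ker refl_left_def mid_left_def by simp

lemma refl_right_Ker: "M2 V * (rmat a' b' c' * M1 U) * rmat a b c
    = Ker (refl_right \<phi> I \<theta> a b c (mid_right \<phi> I \<theta> a' b' c' U V))"
  unfolding M2_rmat_M1 Ker_rmat refl_right_def mid_right_def
  by (rule Ker_cong) (simp only: central[of "\<theta> _ _", symmetric])

lemma M1_D1_M1:
  "M1 U * (D1 g * M1 V) = M1 (\<lambda>i j. \<Sum>a\<in>I. U i a * (\<phi> (g a) * V a j))"
proof (rule op_eqI)
  fix f :: "int \<Rightarrow> int \<Rightarrow> 'a" and i k :: int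
  have "(\<Sum>a\<in>I. U i a * (\<phi> (g a) * (\<Sum>j\<in>I. V a j * f j k)))
      = (\<Sum>j\<in>I. (\<Sum>a\<in>I. U i a * (\<phi> (g a) * V a j)) * f j k)"
    by (simp only: sum_distrib_left sum_distrib_right mult.assoc) (rule sum.swap)
  then show "app (M1 U * (D1 g * M1 V)) f i k
      = app (M1 (\<lambda>i j. \<Sum>a\<in>I. U i a * (\<phi> (g a) * V a j))) f i k"
    by (simp add: app_ops)
qed

lemma M2_D2_M2:
  "M2 U * (D2 g * M2 V) = M2 (\<lambda>i j. \<Sum>a\<in>I. U i a * (\<phi> (g a) * V a j))"
proof -
  let ?W = "\<lambda>i j. \<Sum>a\<in>I. U i a * (\<phi> (g a) * V a j)"
  have "M2 U * (D2 g * M2 V) * Pm = M2 U * (D2 g * (M2 V * Pm))" by (simp only: mult.assoc)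
  also have "\<dots> = M2 U * ((D2 g * Pm) * M1 V)" unfolding PM(1)[symmetric] by (simp only: mult.assoc)
  also have "\<dots> = (M2 U * Pm) * (D1 g * M1 V)" unfolding PD(1)[symmetric] by (simp only: mult.assoc)
  also have "\<dots> = Pm * (M1 U * (D1 g * M1 V))" unfolding PM(1)[symmetric] by (simp only: mult.assoc)
  also have "\<dots> = M2 ?W * Pm" unfolding M1_D1_M1 PM(1) ..
  finally have "M2 U * (D2 g * M2 V) * Pm * Pm = M2 ?W * Pm * Pm" by simp
  then show ?thesis unfolding mult.assoc[of _ Pm Pm] PP by simp
qed

text \<open>Sklyanin's dressing argument: a solution G of the reflection equation stays one when
  dressed to X G X'. The transposed relations carry the inner factors past R', the RTT relations
  carry the outer ones past R, and the hypothesis \<open>G\<close> acts in the middle; matrices in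
  one factor commute with diagonal matrices in the other.\<close>

theorem reflection_equation:
  assumes TT: "rmat a b c * (M1 X * M2 Y) = M2 Y * (M1 X * rmat a b c)"
    and tt: "rmat a b c * (M1 X' * M2 Y') = M2 Y' * (M1 X' * rmat a b c)"
    and tT: "M1 X' * (rmat a' b' c' * M2 Y) = M2 Y * (rmat a' b' c' * M1 X')"
    and Tt: "M1 X * (rmat a' b' c' * M2 Y') = M2 Y' * (rmat a' b' c' * M1 X)"
    and G: "rmat a b c * (D1 g * (rmat a' b' c' * D2 h)) = D2 h * (rmat a' b' c' * (D1 g * rmat a b c))"
    and U: "U = (\<lambda>i j. \<Sum>m\<in>I. X i m * (\<phi> (g m) * X' m j))"
    and V: "V = (\<lambda>i j. \<Sum>m\<in>I. Y i m * (\<phi> (h m) * Y' m j))"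
    and ij: "i \<in> I" "j \<in> I" "k \<in> I" "l \<in> I"
  shows "refl_left \<phi> I \<theta> a b c (mid_left \<phi> I \<theta> a' b' c' U V) i j k l
       = refl_right \<phi> I \<theta> a b c (mid_right \<phi> I \<theta> a' b' c' U V) i j k l"
proof -
  let ?R = "rmat a b c" and ?R' = "rmat a' b' c'"
  have "?R * (M1 U * (?R' * M2 V)) = ?R * (M1 X * (D1 g * ((M1 X' * (?R' * M2 Y)) * (D2 h * M2 Y'))))"
    by (simp add: U V mult.assoc flip: M1_D1_M1 M2_D2_M2)
  also have "\<dots> = ?R * (M1 X * ((D1 g * M2 Y) * (?R' * ((M1 X' * D2 h) * M2 Y'))))"
    by (simp only: tT mult.assoc)
  also have "\<dots> = ?R * (M1 X * M2 Y) * (D1 g * (?R' * (D2 h * (M1 X' * M2 Y'))))"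
    by (simp only: D1_M2(2) D1_M2(1)[symmetric] mult.assoc)
  also have "\<dots> = M2 Y * (M1 X * ((?R * (D1 g * (?R' * D2 h))) * (M1 X' * M2 Y')))"
    by (simp only: TT mult.assoc)
  also have "\<dots> = M2 Y * (M1 X * (D2 h * (?R' * (D1 g * (?R * (M1 X' * M2 Y'))))))"
    by (simp only: G mult.assoc)
  also have "\<dots> = M2 Y * ((M1 X * D2 h) * (?R' * ((D1 g * M2 Y') * (M1 X' * ?R))))"
    by (simp only: tt mult.assoc)
  also have "\<dots> = M2 Y * (D2 h * ((M1 X * (?R' * M2 Y')) * (D1 g * (M1 X' * ?R))))"
    by (simp only: D1_M2(2) D1_M2(1)[symmetric] mult.assoc)
  also have "\<dots> = M2 Y * (D2 h * (M2 Y' * (?R' * (M1 X * (D1 g * (M1 X' * ?R))))))"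
    by (simp only: Tt mult.assoc)
  also have "\<dots> = M2 V * (?R' * M1 U) * ?R"
    by (simp add: U V mult.assoc flip: M1_D1_M1 M2_D2_M2)
  finally show ?thesis
    unfolding refl_left_Ker refl_right_Ker using ij by (rule Ker_inj)
qed

lemma P_rmat: "Pm * rmat a b c = rmat a b c * Pm"
  by (simp add: rmat_mult_right[OF Sc_central(5)] rmat_mult_left PQ QP)

text \<open>Conjugation by P restores the shape of \<open>rtt_matrix\<close> with U and V exchanged.
  The substitution u -> \<kappa>/2 - v, v -> \<kappa>/2 - u, which preserves u - v, later undoes the
  exchange.\<close>

lemma rtt_transpose_both':
  assumes "rtt a b c U V"
  shows "rmat a b c * (M1 (mt V) * M2 (mt U)) = M2 (mt U) * (M1 (mt V) * rmat a b c)"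
proof -
  have PR: "Pm * rmat a b c = rmat a b c * Pm"
    by (rule P_rmat)
  have "Pm * (M1 (mt U) * (M2 (mt V) * rmat a b c)) * Pm = Pm * (rmat a b c * (M2 (mt V) * M1 (mt U))) * Pm"
    using rtt_transpose_both[OF assms] by simp
  moreover have "Pm * (M1 (mt U) * (M2 (mt V) * rmat a b c)) * Pm = M2 (mt U) * (M1 (mt V) * rmat a b c)"
  proof -
    have "Pm * (M1 (mt U) * (M2 (mt V) * rmat a b c)) * Pm = (Pm * M1 (mt U)) * (M2 (mt V) * (rmat a b c * Pm))"
      by (simp only: mult.assoc)
    also have "\<dots> = M2 (mt U) * ((Pm * M2 (mt V)) * (Pm * rmat a b c))"
      by (simp only: PM(1) PR mult.assoc)
    also have "\<dots> = M2 (mt U) * (M1 (mt V) * ((Pm * Pm) * rmat a b c))"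
      by (simp only: PM(2) mult.assoc)
    finally show ?thesis by (simp add: PP)
  qed
  moreover have "Pm * (rmat a b c * (M2 (mt V) * M1 (mt U))) * Pm = rmat a b c * (M1 (mt V) * M2 (mt U))"
  proof -
    have "Pm * (rmat a b c * (M2 (mt V) * M1 (mt U))) * Pm = (Pm * rmat a b c) * (M2 (mt V) * (M1 (mt U) * Pm))"
      by (simp only: mult.assoc)
    also have "\<dots> = rmat a b c * ((Pm * M2 (mt V)) * (Pm * M2 (mt U)))"
      by (simp only: PM(2)[of "mt U", symmetric] PR mult.assoc)
    also have "\<dots> = rmat a b c * (M1 (mt V) * ((Pm * Pm) * M2 (mt U)))"
      by (simp only: PM mult.assoc)
    finally show ?thesis by (simp add: PP)
  qed
  ultimately show ?thesis by simp
qed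

text \<open>Conjugating \<open>rtt_transpose_first\<close> by P puts the transposed matrix into the
  second factor.\<close>

lemma rtt_transpose_first':
  assumes "rtt a b c U V"
  shows "M1 V * (rmat a (- c) (- b) * M2 (mt U)) = M2 (mt U) * (rmat a (- c) (- b) * M1 V)"
proof -
  let ?R = "rmat a (- c) (- b)"
  have PR: "Pm * ?R = ?R * Pm"
    by (rule P_rmat)
  have *: "Pm * (M1 X * (?R * M2 Y)) * Pm = M2 X * (?R * M1 Y)" for X Y
  proof -
    have "Pm * (M1 X * (?R * M2 Y)) * Pm = (Pm * M1 X) * (?R * (M2 Y * Pm))" by (simp only: mult.assoc)
    also have "\<dots> = M2 X * ((Pm * ?R) * (Pm * M1 Y))" by (simp only: PM(1) mult.assoc)
    also have "\<dots> = M2 X * (?R * ((Pm * Pm) * M1 Y))" by (simp only: PR mult.assoc)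
    finally show ?thesis by (simp add: PP)
  qed
  have **: "Pm * (M2 X * (?R * M1 Y)) * Pm = M1 X * (?R * M2 Y)" for X Y
  proof -
    have "Pm * (M2 X * (?R * M1 Y)) * Pm = (Pm * M2 X) * (?R * (M1 Y * Pm))" by (simp only: mult.assoc)
    also have "\<dots> = M1 X * ((Pm * ?R) * (Pm * M2 Y))" by (simp only: PM(2) mult.assoc)
    also have "\<dots> = M1 X * (?R * ((Pm * Pm) * M2 Y))" by (simp only: PR mult.assoc)
    finally show ?thesis by (simp add: PP)
  qed
  show ?thesis
    using arg_cong[OF rtt_transpose_first[OF assms], of "\<lambda>Z. Pm * Z * Pm"] unfolding * ** by simp
qed

end

section \<open>Diagonal solutions of the reflection equation\<close>

context rmatrix
begin

lemma Sc_left: "Pm * (Sc p * X) = Sc p * (Pm * X)" "Qm * (Sc p * X) = Sc p * (Qm * X)"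
  "D1 g * (Sc p * X) = Sc p * (D1 g * X)" "D2 g * (Sc p * X) = Sc p * (D2 g * X)"
  by (simp_all only: mult.assoc[symmetric] Sc_central)

lemma Sc_Sc: "Sc p * (Sc q * X) = Sc (p * q) * X"
  by (simp add: Sc_mult mult.assoc)

lemma PD': "Pm * (D1 g * X) = D2 g * (Pm * X)" "Pm * (D2 g * X) = D1 g * (Pm * X)"
  by (simp_all only: mult.assoc[symmetric] PD)

lemma PQ': "Pm * (Qm * X) = Sc \<zeta> * (Qm * X)"
  by (simp only: mult.assoc[symmetric] PQ)

lemma QQ': "Qm * (Qm * X) = Sc (of_nat (card I)) * (Qm * X)"
  by (simp only: mult.assoc[symmetric] QQ)

lemma QDQ': "Qm * (D1 g * (Qm * X)) = Sc (\<Sum>a\<in>I. g a) * (Qm * X)"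
  using arg_cong[OF QDQ[of g], of "\<lambda>Z. Z * X"] by (simp only: mult.assoc)

lemma DD': "D2 g * (D1 h * X) = D1 h * (D2 g * X)"
  by (simp only: mult.assoc[symmetric] DD)

lemma rmat_commute: "rmat a b c * rmat a' b' c' = rmat a' b' c' * rmat a b c"
  by (simp add: rmat_def algebra_simps Sc_central Sc_left Sc_Sc PP PQ QP QQ flip: Sc_mult)

lemma D_one: "(\<And>i. g i = 1) \<Longrightarrow> D1 g = 1" "(\<And>i. g i = 1) \<Longrightarrow> D2 g = 1"
  by (rule op_eqI; simp add: app_ops hom_one)+

text \<open>For g = 1 the claim is that two R-matrices commute. Otherwise all terms of the expansion
  cancel except the one with \<open>c * c'\<close>, which is the trace of g times a multiple of Q
  g_1 - g_1 Q.\<close>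

lemma reflection_const:
  assumes sq: "\<And>i. g i * g i = 1" and neg: "\<And>i. i \<in> I \<Longrightarrow> g (- i) = \<eta> * g i"
    and eta: "\<eta> * \<eta> = 1"
    and one_or_tr: "(\<forall>i. g i = 1) \<or> (\<Sum>i\<in>I. g i) = 0"
  shows "rmat a b c * (D1 g * (rmat a' b' c' * D2 g)) = D2 g * (rmat a' b' c' * (D1 g * rmat a b c))"
proof (cases "\<forall>i. g i = 1")
  case True
  then show ?thesis by (simp add: D_one rmat_commute)
next
  case False
  then have tr: "(\<Sum>i\<in>I. g i) = 0" using one_or_tr by blast
  note Q2 = Q_D2[where g = g and \<eta> = \<eta>, OF neg] D2_Q[where g = g and \<eta> = \<eta>, OF neg] note D = D_sq[of g, OF sq]
  have Q2': "D2 g * (Qm * X) = Sc \<eta> * (D1 g * (Qm * X))" for X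
    using arg_cong[OF Q2(2), of "\<lambda>Z. Z * X"] by (simp only: mult.assoc)
  have D': "D1 g * (D1 g * X) = X" "D2 g * (D2 g * X) = X" for X
    using D by (simp_all flip: mult.assoc)
  have DQD: "Qm * (D1 g * D2 g) = Sc \<eta> * Qm" "D1 g * (D2 g * Qm) = Sc \<eta> * Qm"
    "D1 g * (D2 g * (Qm * X)) = Sc \<eta> * (Qm * X)" for X
  proof -
    have "Qm * (D1 g * D2 g) = (Qm * D2 g) * D1 g" by (simp only: DD[symmetric] mult.assoc)
    then show "Qm * (D1 g * D2 g) = Sc \<eta> * Qm" by (simp add: Q2 D mult.assoc)
    show "D1 g * (D2 g * (Qm * X)) = Sc \<eta> * (Qm * X)" for X
      by (simp add: Q2' D' Sc_left)
    from this[of 1] show "D1 g * (D2 g * Qm) = Sc \<eta> * Qm" by simp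
  qed
  have eta': "\<eta> * (\<eta> * p) = p" for p by (simp add: eta flip: mult.assoc)
  have QDP: "Qm * (D1 g * Pm) = Sc (\<zeta> * \<eta>) * (Qm * D1 g)"
  proof -
    have "Qm * (D1 g * Pm) = (Qm * Pm) * D2 g" by (simp only: PD[symmetric] mult.assoc)
    then show ?thesis by (simp add: QP Q2 Sc_Sc mult.assoc)
  qed
  show ?thesis
    by (simp add: rmat_def algebra_simps Sc_central Sc_left Sc_Sc PP PQ PQ' QP QQ PD PD'
        QDQ QDQ' tr Sc_zero Q2 Q2' D D' DD DD' DQD QDP eta' zeta_cancel flip: Sc_mult)
qed

text \<open>Both diagonal matrices are combinations of 1 and g. The defects of the pairs (g, 1), (1,
  g) and (g, g) in the reflection equation lie in the span of \<open>KP\<close> and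
  \<open>KQ\<close>, while that of (1, 1) is zero; \<open>condP\<close> and \<open>condQ\<close> say
  that the two total coefficients vanish.\<close>

lemma reflection_frac:
  assumes sq: "\<And>i. g i * g i = 1" and neg: "\<And>i. i \<in> I \<Longrightarrow> g (- i) = g i"
    and condP: "x * (a * b' + b * a') + y * (a * b' - b * a') = 0"
    and condQ: "x * (a * c' + c * a' - \<zeta> * (b * c' + c * b') + of_nat (card I) * (c * c'))
      + y * (c * a' - a * c' + \<zeta> * (b * c' - c * b')) = \<gamma> * (\<Sum>i\<in>I. g i) * (c * c')"
    and h: "h = (\<lambda>i. w * (x - \<gamma> * g i))" and h': "h' = (\<lambda>i. w' * (y - \<gamma> * g i))"
  shows "rmat a b c * (D1 h * (rmat a' b' c' * D2 h')) = D2 h' * (rmat a' b' c' * (D1 h * rmat a b c))"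
proof -
  let ?E1 = "D1 g" and ?E2 = "D2 g" and ?R = "rmat a b c" and ?R' = "rmat a' b' c'"
  let ?\<tau> = "\<Sum>i\<in>I. g i"
  have Q2: "Qm * ?E2 = Qm * ?E1" "?E2 * Qm = ?E1 * Qm"
    using Q_D2[of g 1] D2_Q[of g 1] neg by (simp_all add: Sc_one)
  note D = D_sq[of g, OF sq]
  have Q2': "?E2 * (Qm * X) = ?E1 * (Qm * X)" for X
    using arg_cong[OF Q2(2), of "\<lambda>Z. Z * X"] by (simp only: mult.assoc)
  have D': "?E1 * (?E1 * X) = X" "?E2 * (?E2 * X) = X" for X
    using D by (simp_all flip: mult.assoc)
  have DQD: "Qm * (?E1 * ?E2) = Qm" "?E1 * (?E2 * Qm) = Qm" "?E1 * (?E2 * (Qm * X)) = Qm * X" for X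
  proof -
    have "Qm * (?E1 * ?E2) = (Qm * ?E2) * ?E1" by (simp only: DD[symmetric] mult.assoc)
    then show "Qm * (?E1 * ?E2) = Qm" by (simp add: Q2 D mult.assoc)
    show "?E1 * (?E2 * (Qm * X)) = Qm * X" for X
      by (simp add: Q2' D')
    from this[of 1] show "?E1 * (?E2 * Qm) = Qm" by simp
  qed
  have QDP: "Qm * (?E1 * Pm) = Sc \<zeta> * (Qm * ?E1)"
  proof -
    have "Qm * (?E1 * Pm) = (Qm * Pm) * ?E2" by (simp only: PD[symmetric] mult.assoc)
    then show ?thesis by (simp add: QP Q2 mult.assoc)
  qed
  note norm = QDP QQ' rmat_def Sc_central Sc_left Sc_Sc PP PQ PQ' QP QQ PD PD'
        QDQ QDQ' Q2 Q2' D D' DD DD' DQD Sc_add Sc_diff zeta_cancel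
  define KP where "KP = ?E1 * Pm - ?E2 * Pm"
  define KQ where "KQ = Qm * ?E1 - ?E1 * Qm"
  have e1: "?R * (?E1 * ?R') - ?R' * (?E1 * ?R) = Sc (b * a' - a * b') * KP
      + Sc (c * a' - a * c' + \<zeta> * (b * c' - c * b')) * KQ"
    by (simp add: KP_def KQ_def algebra_simps norm flip: Sc_mult)
  have e2: "?R * (?R' * ?E2) - ?E2 * (?R' * ?R) = Sc (- (a * b' + b * a')) * KP
      + Sc (a * c' + c * a' - \<zeta> * (b * c' + c * b') + of_nat (card I) * (c * c')) * KQ"
    by (simp add: KP_def KQ_def algebra_simps norm Sc_minus flip: Sc_mult)
  have e3: "?R * (?E1 * (?R' * ?E2)) - ?E2 * (?R' * (?E1 * ?R)) = Sc (?\<tau> * (c * c')) * KQ"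
    by (simp add: KQ_def algebra_simps norm flip: Sc_mult)
  have D1h: "D1 h = Sc w * (Sc x - Sc \<gamma> * ?E1)" and D2h: "D2 h' = Sc w' * (Sc y - Sc \<gamma> * ?E2)"
    by (rule op_eqI; simp add: h h' app_ops hom_diff algebra_simps hom_mult_assoc)+
  have R: "?R * Sc p = Sc p * ?R" "?R * (Sc p * X) = Sc p * (?R * X)"
    "?R' * Sc p = Sc p * ?R'" "?R' * (Sc p * X) = Sc p * (?R' * X)" for p X
    by (simp_all add: rmat_def algebra_simps Sc_central Sc_left Sc_Sc flip: Sc_mult)
  have "?R * (D1 h * (?R' * D2 h')) - D2 h' * (?R' * (D1 h * ?R)) = Sc (w * w') *
      (Sc (x * y) * (?R * ?R' - ?R' * ?R) - Sc (\<gamma> * x) * (?R * (?R' * ?E2) - ?E2 * (?R' * ?R))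
       - Sc (\<gamma> * y) * (?R * (?E1 * ?R') - ?R' * (?E1 * ?R))
       + Sc (\<gamma> * \<gamma>) * (?R * (?E1 * (?R' * ?E2)) - ?E2 * (?R' * (?E1 * ?R))))"
    unfolding D1h D2h by (simp add: algebra_simps R Sc_central Sc_left Sc_Sc flip: Sc_mult)
  also have "\<dots> = Sc (w * w') * (Sc (\<gamma> * (x * (a * b' + b * a') + y * (a * b' - b * a'))) * KP
      + Sc (\<gamma> * (\<gamma> * ?\<tau> * (c * c')
          - (x * (a * c' + c * a' - \<zeta> * (b * c' + c * b') + of_nat (card I) * (c * c'))
            + y * (c * a' - a * c' + \<zeta> * (b * c' - c * b'))))) * KQ)"
    unfolding e1 e2 e3 rmat_commute[of a b c]
    by (simp add: algebra_simps Sc_add Sc_diff Sc_minus Sc_Sc flip: Sc_mult)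
  also have "\<dots> = 0"
    unfolding condP condQ by (simp add: Sc_zero)
  finally show ?thesis by simp
qed

end

section \<open>Partial homomorphisms\<close>

definition fps_set :: "'a set \<Rightarrow> 'a fps set"
  where "fps_set D = {F. \<forall>n. F $ n \<in> D}"

text \<open>A homomorphism defined on a carrier inside a type: the free ring on given letters, or
  the part of it on which a representation is meaningful. Identities between polynomials in
  generators travel along such maps. Unit preservation is left out because \<open>to_yang\<close>
  sends 1 to an element supported in a single factor of a product.\<close>

locale partial_hom =
  fixes D :: "'a::ring set" and h :: "'a \<Rightarrow> 'b::ring" and \<phi> :: "'k \<Rightarrow> 'a" and \<psi> :: "'k \<Rightarrow> 'b"
  assumes zero_in: "0 \<in> D"
    and add_in: "x \<in> D \<Longrightarrow> y \<in> D \<Longrightarrow> x + y \<in> D"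
    and diff_in: "x \<in> D \<Longrightarrow> y \<in> D \<Longrightarrow> x - y \<in> D"
    and mult_in: "x \<in> D \<Longrightarrow> y \<in> D \<Longrightarrow> x * y \<in> D"
    and scalar_in: "x \<in> D \<Longrightarrow> \<phi> p * x \<in> D"
    and map_add: "x \<in> D \<Longrightarrow> y \<in> D \<Longrightarrow> h (x + y) = h x + h y"
    and map_mult: "x \<in> D \<Longrightarrow> y \<in> D \<Longrightarrow> h (x * y) = h x * h y"
    and map_scalar: "x \<in> D \<Longrightarrow> h (\<phi> p * x) = \<psi> p * h x"
begin

lemma map_zero: "h 0 = 0"
  using map_add[OF zero_in zero_in] by simp

lemma map_diff: "x \<in> D \<Longrightarrow> y \<in> D \<Longrightarrow> h (x - y) = h x - h y"
  using map_add[OF diff_in[of x y], of y] by (simp add: algebra_simps)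

lemma sum_in: "(\<And>a. a \<in> A \<Longrightarrow> f a \<in> D) \<Longrightarrow> sum f A \<in> D"
  by (induct A rule: infinite_finite_induct) (auto simp: zero_in add_in)

lemma map_sum: "(\<And>a. a \<in> A \<Longrightarrow> f a \<in> D) \<Longrightarrow> h (sum f A) = (\<Sum>a\<in>A. h (f a))"
  by (induct A rule: infinite_finite_induct) (auto simp: map_zero map_add sum_in)

lemma if_in: "(b \<Longrightarrow> x \<in> D) \<Longrightarrow> (if b then x else 0) \<in> D"
  by (simp add: zero_in)

lemma map_if: "h (if b then x else 0) = (if b then h x else 0)"
  by (simp add: map_zero)

end

lemma partial_hom_fps_map:
  fixes \<phi> :: "'k::comm_ring_1 \<Rightarrow> 'a::ring" and \<psi> :: "'k \<Rightarrow> 'b::ring"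
  assumes "partial_hom D h \<phi> \<psi>"
  shows "partial_hom (fps_set D) (fps_map h) (fps_map \<phi>) (fps_map \<psi>)"
proof -
  interpret partial_hom D h \<phi> \<psi> by fact
  show ?thesis
    by standard
       (auto simp: fps_set_def fps_eq_iff fps_mult_nth zero_in add_in diff_in mult_in scalar_in
          map_add map_mult map_scalar intro!: sum_in trans[OF map_sum] sum.cong)
qed

context partial_hom
begin

context
  fixes I :: "int set" and \<theta> :: "int \<Rightarrow> int \<Rightarrow> 'k" and U V :: "int \<Rightarrow> int \<Rightarrow> 'a"
  assumes neg: "\<And>i. - i \<in> I \<longleftrightarrow> i \<in> I"
    and U: "\<And>i j. i \<in> I \<Longrightarrow> j \<in> I \<Longrightarrow> U i j \<in> D"
    and V: "\<And>i j. i \<in> I \<Longrightarrow> j \<in> I \<Longrightarrow> V i j \<in> D"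
begin

lemma map_mid_left:
  assumes "i \<in> I" "j \<in> I" "k \<in> I" "l \<in> I"
  shows "mid_left \<phi> I \<theta> a b c U V i j k l \<in> D"
    and "h (mid_left \<phi> I \<theta> a b c U V i j k l)
      = mid_left \<psi> I \<theta> a b c (\<lambda>i j. h (U i j)) (\<lambda>i j. h (V i j)) i j k l"
  using assms unfolding mid_left_def
  by (simp_all add: neg U V zero_in add_in diff_in mult_in scalar_in sum_in map_zero map_add map_diff
      map_mult map_scalar map_sum if_in map_if)

lemma map_mid_right:
  assumes "i \<in> I" "j \<in> I" "k \<in> I" "l \<in> I"
  shows "mid_right \<phi> I \<theta> a b c U V i j k l \<in> D"
    and "h (mid_right \<phi> I \<theta> a b c U V i j k l)
      = mid_right \<psi> I \<theta> a b c (\<lambda>i j. h (U i j)) (\<lambda>i j. h (V i j)) i j k l"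
  using assms unfolding mid_right_def
  by (simp_all add: neg U V zero_in add_in diff_in mult_in scalar_in sum_in map_zero map_add map_diff
      map_mult map_scalar map_sum if_in map_if)

lemma map_refl_left:
  assumes "i \<in> I" "j \<in> I" "k \<in> I" "l \<in> I"
  shows "refl_left \<phi> I \<theta> a b c (mid_left \<phi> I \<theta> a' b' c' U V) i j k l \<in> D"
    and "h (refl_left \<phi> I \<theta> a b c (mid_left \<phi> I \<theta> a' b' c' U V) i j k l)
      = refl_left \<psi> I \<theta> a b c
          (mid_left \<psi> I \<theta> a' b' c' (\<lambda>i j. h (U i j)) (\<lambda>i j. h (V i j))) i j k l"
  using assms unfolding refl_left_def
  by (simp_all add: neg map_mid_left zero_in add_in diff_in mult_in scalar_in sum_in map_zero map_add
      map_diff map_mult map_scalar map_sum if_in map_if)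

lemma map_refl_right:
  assumes "i \<in> I" "j \<in> I" "k \<in> I" "l \<in> I"
  shows "refl_right \<phi> I \<theta> a b c (mid_right \<phi> I \<theta> a' b' c' U V) i j k l \<in> D"
    and "h (refl_right \<phi> I \<theta> a b c (mid_right \<phi> I \<theta> a' b' c' U V) i j k l)
      = refl_right \<psi> I \<theta> a b c
          (mid_right \<psi> I \<theta> a' b' c' (\<lambda>i j. h (U i j)) (\<lambda>i j. h (V i j))) i j k l"
  using assms unfolding refl_right_def
  by (simp_all add: neg map_mid_right zero_in add_in diff_in mult_in scalar_in sum_in map_zero map_add
      map_diff map_mult map_scalar map_sum if_in map_if)

end

end

section \<open>The free algebra and the extended Yangian\<close>

lemma scalar_mult: "scalar (a * b) = scalar a * scalar b"
  by (simp add: scalar_def mult_single)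

lemma scalar_central: "scalar c * p = p * scalar c"
proof (induct p rule: update_induct)
  case (update f a b)
  have "Poly_Mapping.update a b f = Poly_Mapping.single a b + f"
    using update(1) by (intro poly_mapping_eqI)
      (auto simp: lookup_update lookup_add lookup_single in_keys_iff)
  with update(3) show ?case
    by (simp add: distrib_left distrib_right)
       (simp add: scalar_def mult_single mult.commute)
qed simp

lemma scalar_0 [simp]: "scalar 0 = 0" and scalar_1 [simp]: "scalar 1 = 1"
  by (simp_all add: scalar_def)

lemma central_scalars_scalar: "central_scalars scalar"
proof
  fix a b :: complex and x :: "'a free_alg"
  show "scalar (a + b) = (scalar a + scalar b :: 'a free_alg)" by (simp add: scalar_def single_add)
  show "scalar (a * b) = (scalar a * scalar b :: 'a free_alg)" by (rule scalar_mult)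
  show "scalar a * x = x * scalar a" by (rule scalar_central)
qed simp

lemma free_ring_simps [simp]:
  "mult (free_ring G) = (*)" "one (free_ring G) = 1" "zero (free_ring G) = 0" "add (free_ring G) = (+)"
  by (simp_all add: free_ring_def)

lemma in_free_ring: "p \<in> carrier (free_ring G) \<longleftrightarrow> (\<forall>w\<in>Poly_Mapping.keys p. set (letters w) \<subseteq> G)"
  by (simp add: free_ring_def)

lemma free_ring_0: "0 \<in> carrier (free_ring G)" and free_ring_1: "1 \<in> carrier (free_ring G)"
  by (simp_all add: in_free_ring zero_word_def)

lemma free_ring_add: "p \<in> carrier (free_ring G) \<Longrightarrow> q \<in> carrier (free_ring G) \<Longrightarrow> p + q \<in> carrier (free_ring G)"
  unfolding in_free_ring using keys_add[of p q] by blast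

lemma free_ring_uminus: "p \<in> carrier (free_ring G) \<Longrightarrow> - p \<in> carrier (free_ring G)"
  by (simp add: in_free_ring)

lemma free_ring_mult: "p \<in> carrier (free_ring G) \<Longrightarrow> q \<in> carrier (free_ring G) \<Longrightarrow> p * q \<in> carrier (free_ring G)"
  unfolding in_free_ring using keys_mult[of p q] by (fastforce simp: plus_word_def)

lemma free_ring_scalar: "scalar c \<in> carrier (free_ring G)"
  by (simp add: in_free_ring scalar_def zero_word_def)

lemma free_ring_ring: "ring (free_ring G)"
proof (rule ringI)
  show "abelian_group (free_ring G)"
  proof (rule abelian_groupI)
    fix x assume "x \<in> carrier (free_ring G)"
    then show "\<exists>y\<in>carrier (free_ring G). y \<oplus>\<^bsub>free_ring G\<^esub> x = \<zero>\<^bsub>free_ring G\<^esub>"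
      by (intro bexI[of _ "- x"]) (auto simp: free_ring_uminus)
  qed (auto simp: free_ring_0 free_ring_add algebra_simps)
  show "monoid (free_ring G)"
    by (rule monoidI) (auto simp: free_ring_1 free_ring_mult algebra_simps)
qed (auto simp: algebra_simps)

lemma free_ring_minus:
  assumes "p \<in> carrier (free_ring G)" "q \<in> carrier (free_ring G)"
  shows "p - q \<in> carrier (free_ring G)"
  using free_ring_add[OF assms(1) free_ring_uminus[OF assms(2)]] by simp

lemma partial_hom_free_ring: "partial_hom (carrier (free_ring G)) (\<lambda>x. x) scalar scalar"
  by standard (simp_all add: free_ring_0 free_ring_add free_ring_minus free_ring_mult free_ring_scalar)

lemma t_coeff_in: "i \<in> idx N \<Longrightarrow> j \<in> idx N \<Longrightarrow> t_coeff i j r \<in> carrier (free_ring (gens N))"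
  by (cases "r = 0") (auto simp: t_coeff_def in_free_ring gens_def zero_word_def)

lemma finite_idx: "finite (idx N)"
  by (rule finite_subset[of _ "{- int (N div 2)..int (N div 2)}"]) (auto simp: idx_def)

lemma neg_idx [simp]: "- i \<in> idx N \<longleftrightarrow> i \<in> idx N"
  by (auto simp: idx_def)

definition k2 :: "complex \<Rightarrow> complex fps fps"
  where "k2 c = fps_const (fps_const c)"

text \<open>\<open>x y (u - v)\<close>, \<open>x y (u + v)\<close>, \<open>x y (u - v - \<kappa>)\<close> and \<open>x y (u + v - \<kappa>)\<close>, where
  \<open>x = u\<^sup>-\<^sup>1\<close> and \<open>y = v\<^sup>-\<^sup>1\<close>.\<close>

definition hp :: "complex fps fps" where "hp = fps_X * fps_const fps_X"
definition zm :: "complex fps fps" where "zm = fps_const fps_X - fps_X"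
definition zp :: "complex fps fps" where "zp = fps_X + fps_const fps_X"
definition zmk :: "complex \<Rightarrow> complex fps fps" where "zmk \<kappa> = zm - k2 \<kappa> * hp"
definition zpk :: "complex \<Rightarrow> complex fps fps" where "zpk \<kappa> = zp - k2 \<kappa> * hp"

abbreviation "lift2 \<phi> \<equiv> fps_map (fps_map \<phi>)"

abbreviation "reflection_lhs \<phi> I \<theta> \<kappa> U V \<equiv>
  refl_left \<phi> I \<theta> (zm * zmk \<kappa>) (hp * zmk \<kappa>) (hp * zm)
    (mid_left \<phi> I \<theta> (zp * zpk \<kappa>) (hp * zpk \<kappa>) (hp * zp) U V)"

abbreviation "reflection_rhs \<phi> I \<theta> \<kappa> U V \<equiv>
  refl_right \<phi> I \<theta> (zm * zmk \<kappa>) (hp * zmk \<kappa>) (hp * zm)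
    (mid_right \<phi> I \<theta> (zp * zpk \<kappa>) (hp * zpk \<kappa>) (hp * zp) U V)"

lemma central_scalars_lift2: "central_scalars \<phi> \<Longrightarrow> central_scalars (lift2 \<phi>)"
  by (intro central_scalars_fps_map)

lemma k2_simps [simp]: "k2 0 = 0" "k2 1 = 1"
  by (simp_all add: k2_def)

abbreviation "L \<equiv> lift2 (scalar :: complex \<Rightarrow> gen free_alg)"

interpretation L: central_scalars L
  by (intro central_scalars_lift2 central_scalars_scalar)

lemma R_cleared_eq: "R_cleared ty N i j k l =
  L (zm * zmk (kappa ty N) * k2 (I_entry i j k l) - hp * zmk (kappa ty N) * k2 (P_entry i j k l)
     + hp * zm * k2 (Q_entry ty i j k l))"
proof -
  have X: "L fps_X = fps_X" "L (fps_const fps_X) = fps_const fps_X"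
    by (auto simp: fps_eq_iff fps_X_def)
  have S: "L (k2 c) = scalar2 c" for c
    by (auto simp: fps_eq_iff k2_def scalar2_def)
  show ?thesis
    by (simp add: R_cleared_def Let_def zm_def hp_def zmk_def L.hom_add L.hom_diff L.hom_mult X S)
qed

lemma sum_delta2:
  assumes "finite I" "a0 \<in> I" "b0 \<in> I"
  shows "(\<Sum>a\<in>I. \<Sum>b\<in>I. if a = a0 \<and> b = b0 then f a b else 0) = f a0 b0"
proof -
  have "(\<Sum>a\<in>I. \<Sum>b\<in>I. if a = a0 \<and> b = b0 then f a b else 0)
      = (\<Sum>a\<in>I. if a = a0 then \<Sum>b\<in>I. if b = b0 then f a0 b else 0 else 0)"
    by (intro sum.cong refl) auto
  then show ?thesis using assms by simp
qed

text \<open>I, P and Q have so few nonzero entries that the double sums collapse; what remains has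
  the shape of \<open>rtt\<close>.\<close>

lemma RTT_defect_sparse:
  assumes "i \<in> idx N" "j \<in> idx N" "k \<in> idx N" "l \<in> idx N"
  shows "RTT_defect ty N i j k l =
    (L (zm * zmk (kappa ty N)) * (t_in_u i j * t_in_v k l)
      - L (hp * zmk (kappa ty N)) * (t_in_u k j * t_in_v i l)
      + (if k = - i then L (hp * zm) * (\<Sum>m\<in>idx N. L (k2 (theta ty i m)) * (t_in_u m j * t_in_v (- m) l)) else 0))
    - (L (zm * zmk (kappa ty N)) * (t_in_v k l * t_in_u i j)
      - L (hp * zmk (kappa ty N)) * (t_in_v k j * t_in_u i l)
      + (if l = - j then L (hp * zm) * (\<Sum>m\<in>idx N. L (k2 (theta ty m j)) * (t_in_v k (- m) * t_in_u i m)) else 0))"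
proof -
  let ?A = "zm * zmk (kappa ty N)" and ?B = "hp * zmk (kappa ty N)" and ?C = "hp * zm"
  note fin = finite_idx[of N]
  have L1: "L (p * k2 (if b then 1 else 0)) * F = (if b then L p * F else 0)" for p b F
    by (simp add: L.hom_zero)
  have L2: "L (p * k2 (if b then c else 0)) * F = (if b then L p * (L (k2 c) * F) else 0)" for p b c F
    by (simp add: L.hom_zero L.hom_mult_assoc)
  have left: "(\<Sum>a\<in>idx N. \<Sum>b\<in>idx N. R_cleared ty N i a k b * t_in_u a j * t_in_v b l)
      = L ?A * (t_in_u i j * t_in_v k l) - L ?B * (t_in_u k j * t_in_v i l)
      + (if k = - i then L ?C * (\<Sum>m\<in>idx N. L (k2 (theta ty i m)) * (t_in_u m j * t_in_v (- m) l)) else 0)"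
  proof -
    have "(\<Sum>a\<in>idx N. \<Sum>b\<in>idx N. R_cleared ty N i a k b * t_in_u a j * t_in_v b l)
        = (\<Sum>a\<in>idx N. \<Sum>b\<in>idx N.
            (if a = i \<and> b = k then L ?A * (t_in_u a j * t_in_v b l) else 0)
            - (if a = k \<and> b = i then L ?B * (t_in_u a j * t_in_v b l) else 0)
            + (if k = - i then if b = - a then L ?C * (L (k2 (theta ty i a)) * (t_in_u a j * t_in_v b l)) else 0 else 0))"
      unfolding mult.assoc[of "R_cleared ty N i _ k _"]
      unfolding R_cleared_eq I_entry_def P_entry_def Q_entry_def
        L.hom_add L.hom_diff left_diff_distrib distrib_right L1 L2
      by (intro sum.cong refl arg_cong2[where f="(+)"] arg_cong2[where f="(-)"]) (auto simp: L.hom_one)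
    also have "\<dots> = L ?A * (t_in_u i j * t_in_v k l) - L ?B * (t_in_u k j * t_in_v i l)
      + (if k = - i then \<Sum>m\<in>idx N. L ?C * (L (k2 (theta ty i m)) * (t_in_u m j * t_in_v (- m) l)) else 0)"
      unfolding sum.distrib sum_subtractf sum_delta2[OF fin assms(1,3)] sum_delta2[OF fin assms(3,1)]
      by (cases "k = - i") (simp_all add: fin)
    finally show ?thesis by (simp add: sum_distrib_left)
  qed
  have right: "(\<Sum>a\<in>idx N. \<Sum>b\<in>idx N. t_in_v k b * t_in_u i a * R_cleared ty N a j b l)
      = L ?A * (t_in_v k l * t_in_u i j) - L ?B * (t_in_v k j * t_in_u i l)
      + (if l = - j then L ?C * (\<Sum>m\<in>idx N. L (k2 (theta ty m j)) * (t_in_v k (- m) * t_in_u i m)) else 0)"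
  proof -
    have "(\<Sum>a\<in>idx N. \<Sum>b\<in>idx N. t_in_v k b * t_in_u i a * R_cleared ty N a j b l)
        = (\<Sum>a\<in>idx N. \<Sum>b\<in>idx N. R_cleared ty N a j b l * (t_in_v k b * t_in_u i a))"
      unfolding R_cleared_eq by (intro sum.cong refl) (rule L.central[symmetric])
    also have "\<dots> = (\<Sum>a\<in>idx N. \<Sum>b\<in>idx N.
            (if a = j \<and> b = l then L ?A * (t_in_v k b * t_in_u i a) else 0)
            - (if a = l \<and> b = j then L ?B * (t_in_v k b * t_in_u i a) else 0)
            + (if l = - j then if b = - a then L ?C * (L (k2 (theta ty a j)) * (t_in_v k b * t_in_u i a)) else 0 else 0))"
      unfolding R_cleared_eq I_entry_def P_entry_def Q_entry_def
        L.hom_add L.hom_diff left_diff_distrib distrib_right L1 L2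
      by (intro sum.cong refl arg_cong2[where f="(+)"] arg_cong2[where f="(-)"]) (auto simp: L.hom_one)
    also have "\<dots> = L ?A * (t_in_v k l * t_in_u i j) - L ?B * (t_in_v k j * t_in_u i l)
      + (if l = - j then \<Sum>m\<in>idx N. L ?C * (L (k2 (theta ty m j)) * (t_in_v k (- m) * t_in_u i m)) else 0)"
      unfolding sum.distrib sum_subtractf sum_delta2[OF fin assms(2,4)] sum_delta2[OF fin assms(4,2)]
      by (cases "l = - j") (simp_all add: fin)
    finally show ?thesis by (simp add: sum_distrib_left)
  qed
  show ?thesis unfolding RTT_defect_def left right ..
qed

lemma t_in_u_outer: "t_in_u i j = outer (t_series i j)"
  by (simp add: fps_eq_iff t_in_u_def t_series_def)

lemma outer_in: "f \<in> fps_set D \<Longrightarrow> 0 \<in> D \<Longrightarrow> outer f \<in> fps_set (fps_set D)"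
  by (auto simp: fps_set_def)

lemma fps_const_in: "c \<in> D \<Longrightarrow> 0 \<in> D \<Longrightarrow> fps_const c \<in> fps_set D"
  by (auto simp: fps_set_def)

lemma zero_fps_set: "0 \<in> D \<Longrightarrow> 0 \<in> fps_set D"
  by (auto simp: fps_set_def)

context
  fixes ty :: pair_type and N :: nat
begin

abbreviation (input) "FR \<equiv> free_ring (gens N)"

lemma t_series_in: "i \<in> idx N \<Longrightarrow> j \<in> idx N \<Longrightarrow> t_series i j \<in> fps_set (carrier FR)"
  by (simp add: fps_set_def t_series_def t_coeff_in)

lemma t_in_uv_in: assumes "i \<in> idx N" "j \<in> idx N"
  shows "t_in_u i j \<in> fps_set (fps_set (carrier FR))" "t_in_v i j \<in> fps_set (fps_set (carrier FR))"
  unfolding t_in_u_outer t_in_v_def using assms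
  by (auto intro!: outer_in fps_const_in t_series_in zero_fps_set free_ring_0)

interpretation FF: partial_hom "fps_set (fps_set (carrier FR))" "fps_map (fps_map (\<lambda>x. x))" L L
  by (intro partial_hom_fps_map partial_hom_free_ring)

lemma RTT_relations_in: "RTT_relations ty N \<subseteq> carrier FR"
proof -
  have "RTT_defect ty N i j k l \<in> fps_set (fps_set (carrier FR))"
    if "i \<in> idx N" "j \<in> idx N" "k \<in> idx N" "l \<in> idx N" for i j k l
    unfolding RTT_defect_sparse[OF that] using that
    by (intro FF.diff_in FF.add_in FF.scalar_in FF.mult_in FF.if_in FF.sum_in t_in_uv_in) auto
  then show ?thesis by (auto simp: RTT_relations_def fps_set_def)
qed

lemma RTT_ideal: "ideal (RTT_ideal ty N) FR"
  unfolding RTT_ideal_def by (rule ring.genideal_ideal[OF free_ring_ring RTT_relations_in])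

lemma ext_yangian_ring: "ring (ext_yangian ty N)"
  unfolding ext_yangian_def by (rule ideal.quotient_is_ring[OF RTT_ideal])

lemma yangian_class_hom: "yangian_class ty N \<in> ring_hom FR (ext_yangian ty N)"
proof -
  have "yangian_class ty N = (+>\<^bsub>FR\<^esub>) (RTT_ideal ty N)" by (simp add: fun_eq_iff yangian_class_def)
  then show ?thesis
    unfolding ext_yangian_def using ideal.rcos_ring_hom[OF RTT_ideal] by simp
qed

lemma yangian_class_in: "p \<in> carrier FR \<Longrightarrow> yangian_class ty N p \<in> carrier (ext_yangian ty N)"
  by (rule ring_hom_closed[OF yangian_class_hom])

lemma yangian_class_add: "p \<in> carrier FR \<Longrightarrow> q \<in> carrier FR \<Longrightarrow>
    yangian_class ty N (p + q) = yangian_class ty N p \<oplus>\<^bsub>ext_yangian ty N\<^esub> yangian_class ty N q"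
  using ring_hom_add[OF yangian_class_hom] by simp

lemma yangian_class_mult: "p \<in> carrier FR \<Longrightarrow> q \<in> carrier FR \<Longrightarrow>
    yangian_class ty N (p * q) = yangian_class ty N p \<otimes>\<^bsub>ext_yangian ty N\<^esub> yangian_class ty N q"
  using ring_hom_mult[OF yangian_class_hom] by simp

lemma yangian_class_one: "yangian_class ty N 1 = \<one>\<^bsub>ext_yangian ty N\<^esub>"
  using ring_hom_one[OF yangian_class_hom] by simp

lemma yangian_class_zero: "p \<in> RTT_ideal ty N \<Longrightarrow> yangian_class ty N p = \<zero>\<^bsub>ext_yangian ty N\<^esub>"
  using ring.a_rcos_zero[OF free_ring_ring RTT_ideal]
  by (simp add: yangian_class_def ext_yangian_def FactRing_def)

lemma yangian_class_zero': "yangian_class ty N 0 = \<zero>\<^bsub>ext_yangian ty N\<^esub>"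
  by (rule yangian_class_zero) (metis RTT_ideal additive_subgroup.zero_closed free_ring_simps(3) ideal.axioms(1))

lemma yangian_class_surj: "x \<in> carrier (ext_yangian ty N) \<Longrightarrow> \<exists>p\<in>carrier FR. x = yangian_class ty N p"
  by (auto simp: ext_yangian_def FactRing_def A_RCOSETS_def' yangian_class_def)

end

section \<open>All extended Yangians in one ring\<close>

text \<open>The product of the extended Yangians over all types and ranks is a type, unlike the single
  factors, so that series and matrices over it are available as instances of type classes.\<close>

typedef yang = "{F :: pair_type \<times> nat \<Rightarrow> gen free_alg set. \<forall>k. F k \<in> carrier (ext_yangian (fst k) (snd k))}"
  by (rule exI[of _ "\<lambda>k. \<zero>\<^bsub>ext_yangian (fst k) (snd k)\<^esub>"])
     (auto intro: ring.ring_simprules(2) ext_yangian_ring)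

setup_lifting type_definition_yang

instantiation yang :: ring
begin
lift_definition zero_yang :: yang is "\<lambda>k. \<zero>\<^bsub>ext_yangian (fst k) (snd k)\<^esub>"
  by (simp add: ring.ring_simprules(2) ext_yangian_ring)
lift_definition plus_yang :: "yang \<Rightarrow> yang \<Rightarrow> yang" is "\<lambda>F G k. F k \<oplus>\<^bsub>ext_yangian (fst k) (snd k)\<^esub> G k"
  by (simp add: ring.ring_simprules(1) ext_yangian_ring)
lift_definition minus_yang :: "yang \<Rightarrow> yang \<Rightarrow> yang" is "\<lambda>F G k. F k \<ominus>\<^bsub>ext_yangian (fst k) (snd k)\<^esub> G k"
  by (simp add: ring.ring_simprules ext_yangian_ring)
lift_definition uminus_yang :: "yang \<Rightarrow> yang" is "\<lambda>F k. \<ominus>\<^bsub>ext_yangian (fst k) (snd k)\<^esub> F k"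
  by (simp add: ring.ring_simprules ext_yangian_ring)
lift_definition times_yang :: "yang \<Rightarrow> yang \<Rightarrow> yang" is "\<lambda>F G k. F k \<otimes>\<^bsub>ext_yangian (fst k) (snd k)\<^esub> G k"
  by (simp add: ring.ring_simprules ext_yangian_ring)
instance
  by standard (transfer; simp add: fun_eq_iff ring.ring_simprules[OF ext_yangian_ring])+
end

lift_definition yang_scalar :: "complex \<Rightarrow> yang" is "\<lambda>c k. yangian_scalar (fst k) (snd k) c"
  by (simp add: yangian_scalar_def yangian_class_in free_ring_scalar)

lemma central_scalars_yang: "central_scalars yang_scalar"
proof
  fix a b :: complex and x :: yang
  show "yang_scalar (a + b) = yang_scalar a + yang_scalar b"
    by transfer (simp add: fun_eq_iff yangian_scalar_def free_ring_scalar central_scalars.hom_add[OF central_scalars_scalar]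
        flip: yangian_class_add)
  show "yang_scalar (a * b) = yang_scalar a * yang_scalar b"
    by transfer (simp add: fun_eq_iff yangian_scalar_def free_ring_scalar scalar_mult flip: yangian_class_mult)
  show "yang_scalar 1 * x = x"
    by transfer (simp add: fun_eq_iff yangian_scalar_def yangian_class_one ring.ring_simprules[OF ext_yangian_ring])
  show "yang_scalar a * x = x * yang_scalar a"
  proof transfer
    fix a :: complex and F :: "pair_type \<times> nat \<Rightarrow> gen free_alg set"
    assume F: "\<forall>k. F k \<in> carrier (ext_yangian (fst k) (snd k))"
    have "yangian_scalar ty N a \<otimes>\<^bsub>ext_yangian ty N\<^esub> F (ty, N) = F (ty, N) \<otimes>\<^bsub>ext_yangian ty N\<^esub> yangian_scalar ty N a" for ty N
    proof -
      obtain p where "p \<in> carrier (free_ring (gens N))" "F (ty, N) = yangian_class ty N p"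
        using F yangian_class_surj[of "F (ty, N)" ty N] by (metis fst_conv snd_conv)
      then show ?thesis
        by (simp add: yangian_scalar_def free_ring_scalar flip: yangian_class_mult) (metis scalar_central)
    qed
    then show "(\<lambda>k. yangian_scalar (fst k) (snd k) a \<otimes>\<^bsub>ext_yangian (fst k) (snd k)\<^esub> F k)
        = (\<lambda>k. F k \<otimes>\<^bsub>ext_yangian (fst k) (snd k)\<^esub> yangian_scalar (fst k) (snd k) a)"
      by (simp add: fun_eq_iff)
  qed
qed

text \<open>The class is placed in one factor of the product and every other factor is filled with
  zero; the value off the carrier is zero by convention.\<close>

lift_definition to_yang :: "pair_type \<Rightarrow> nat \<Rightarrow> gen free_alg \<Rightarrow> yang" is
  "\<lambda>ty N p k. if k = (ty, N) \<and> p \<in> carrier (free_ring (gens N)) then yangian_class ty N p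
     else \<zero>\<^bsub>ext_yangian (fst k) (snd k)\<^esub>"
  by (auto simp: yangian_class_in ring.ring_simprules[OF ext_yangian_ring])

lemma to_yang_eq_0:
  assumes "to_yang ty N p = 0" "p \<in> carrier (free_ring (gens N))"
  shows "yangian_class ty N p = \<zero>\<^bsub>ext_yangian ty N\<^esub>"
  using assms by transfer (drule_tac x = "(ty, N)" in fun_cong, simp)

lemma to_yang_ideal: "p \<in> RTT_ideal ty N \<Longrightarrow> to_yang ty N p = 0"
  by transfer (auto simp: fun_eq_iff yangian_class_zero)

lemma partial_hom_to_yang:
  "partial_hom (carrier (free_ring (gens N))) (to_yang ty N) scalar yang_scalar"
proof
  fix x y :: "gen free_alg" and p :: complex
  assume x: "x \<in> carrier (free_ring (gens N))"
  show "to_yang ty N (scalar p * x) = yang_scalar p * to_yang ty N x"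
    using x by transfer
      (auto simp: fun_eq_iff yangian_class_mult free_ring_scalar free_ring_mult yangian_scalar_def
        yangian_class_in ring.ring_simprules[OF ext_yangian_ring])
  assume y: "y \<in> carrier (free_ring (gens N))"
  show "to_yang ty N (x + y) = to_yang ty N x + to_yang ty N y"
    using x y by transfer
      (auto simp: fun_eq_iff yangian_class_add free_ring_add ring.ring_simprules[OF ext_yangian_ring])
  show "to_yang ty N (x * y) = to_yang ty N x * to_yang ty N y"
    using x y by transfer
      (auto simp: fun_eq_iff yangian_class_mult free_ring_mult ring.ring_simprules[OF ext_yangian_ring])
qed (simp_all add: free_ring_0 free_ring_add free_ring_minus free_ring_mult free_ring_scalar)

section \<open>The reflection equation in the extended Yangian\<close>

lemma card_idx: "card (idx N) = N"
proof (cases "even N")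
  case True
  then have "idx N = {- int (N div 2)..int (N div 2)} - {0}" by (auto simp: idx_def)
  moreover have "nat (2 * int (N div 2) + 1) - 1 = N" using True by (elim evenE) (simp add: nat_add_distrib nat_mult_distrib)
  ultimately show ?thesis by (simp add: card_Diff_singleton)
next
  case False
  then have "idx N = {- int (N div 2)..int (N div 2)}" by (auto simp: idx_def)
  moreover have "nat (2 * int (N div 2) + 1) = N" using False by (elim oddE) (simp add: nat_add_distrib nat_mult_distrib)
  ultimately show ?thesis by simp
qed

definition zeta :: "pair_type \<Rightarrow> complex"
  where "zeta ty = (if symplectic ty then -1 else 1)"

lemma symplectic_even: "type_for ty N \<Longrightarrow> symplectic ty \<Longrightarrow> even N"
  by (cases ty) auto

text \<open>The index 0 occurs for odd N only, and symplectic types have even N. Without this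
  \<open>sgn a * sgn a = 1\<close> and hence the axioms on \<open>\<theta>\<close> would
  fail.\<close>

lemma idx_sgn: "type_for ty N \<Longrightarrow> symplectic ty \<Longrightarrow> i \<in> idx N \<Longrightarrow> i \<noteq> 0"
  using symplectic_even by (auto simp: idx_def)

lemma rmatrix_idx:
  fixes \<phi> :: "complex fps fps \<Rightarrow> 'a::ring"
  assumes "central_scalars \<phi>" "type_for ty N"
  shows "rmatrix \<phi> (idx N) (\<lambda>i j. k2 (theta ty i j)) (k2 (zeta ty))"
proof -
  interpret central_scalars \<phi> by fact
  have k2_mult: "k2 a * k2 b = k2 (a * b)" for a b
    by (simp add: k2_def)
  have [simp]: "sgn i * sgn i = 1" if "i \<noteq> 0" for i :: int
    using that by (cases i rule: linorder_cases[of _ 0]) auto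
  show ?thesis
  proof
    show "- i \<in> idx N" if "i \<in> idx N" for i using that by simp
    show "k2 (theta ty i j) = k2 (theta ty j i)" for i j
      by (simp add: theta_def mult.commute)
    show "k2 (theta ty (- i) j) = k2 (zeta ty) * k2 (theta ty i j)" for i j
      by (simp add: k2_mult theta_def zeta_def)
    show "k2 (theta ty i a) * k2 (theta ty a j) = k2 (theta ty i j)" if "a \<in> idx N" for i a j
    proof -
      have "theta ty i a * theta ty a j = theta ty i j"
      proof (cases "symplectic ty")
        case True
        then have "sgn a * sgn a = 1" using idx_sgn[OF assms(2) True that] by simp
        then have "sgn i * sgn a * (sgn a * sgn j) = sgn i * sgn j"
          by (metis mult.assoc mult.right_neutral)
        with True show ?thesis by (simp add: theta_def flip: of_int_mult)
      qed (simp add: theta_def)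
      then show ?thesis by (simp add: k2_mult)
    qed
    show "k2 (theta ty i i) = 1" if "i \<in> idx N" for i
      using idx_sgn[OF assms(2) _ that] by (cases "symplectic ty") (simp_all add: theta_def flip: of_int_mult)
    show "k2 (zeta ty) * k2 (zeta ty) = 1"
      by (simp add: k2_mult zeta_def)
  qed (rule finite_idx)
qed

context rmatrix
begin

text \<open>Meant for substitutions in u and v: ring endomorphisms that act on scalar series by
  \<open>H'\<close> and fix constants such as \<open>\<theta>\<close>.\<close>

lemma rtt_hom:
  assumes "rtt a b c U V"
    and add: "\<And>F G. H (F + G) = H F + (H G :: 'a)" and mult: "\<And>F G. H (F * G) = H F * H G"
    and lift: "\<And>p. H (\<phi> p) = \<phi> (H' p)" and \<theta>: "\<And>i j. H' (\<theta> i j) = \<theta> i j"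
  shows "rtt (H' a) (H' b) (H' c) (\<lambda>i j. H (U i j)) (\<lambda>i j. H (V i j))"
proof -
  have add': "additive H" by (simp add: additive_def add)
  have d: "H (F - G) = H F - H G" for F G by (rule additive.diff[OF add'])
  have z: "H (if b then F else 0) = (if b then H F else 0)" for b F
    using additive.zero[OF add'] by simp
  have s: "H (sum f A) = (\<Sum>a\<in>A. H (f a))" for f :: "int \<Rightarrow> 'a" and A by (rule additive.sum[OF add'])
  show ?thesis
    unfolding rtt_def
  proof (intro ballI)
    fix i j k l assume "i \<in> I" "j \<in> I" "k \<in> I" "l \<in> I"
    from arg_cong[OF rttD[OF assms(1) this], of H]
    show "\<phi> (H' a) * (H (U i j) * H (V k l)) - \<phi> (H' b) * (H (U k j) * H (V i l))
      + (if k = - i then \<phi> (H' c) * (\<Sum>m\<in>I. \<phi> (\<theta> i m) * (H (U m j) * H (V (- m) l))) else 0)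
    = \<phi> (H' a) * (H (V k l) * H (U i j)) - \<phi> (H' b) * (H (V k j) * H (U i l))
      + (if l = - j then \<phi> (H' c) * (\<Sum>m\<in>I. \<phi> (\<theta> m j) * (H (V k (- m)) * H (U i m))) else 0)"
      unfolding add d z mult s lift \<theta> .
  qed
qed

text \<open>Clears the denominators that a substitution introduces.\<close>

lemma rtt_scale:
  assumes "rtt a b c U V"
  shows "rtt (d * a) (d * b) (d * c) U V"
  unfolding rtt_def
proof (intro ballI)
  fix i j k l assume "i \<in> I" "j \<in> I" "k \<in> I" "l \<in> I"
  from arg_cong[OF rttD[OF assms(1) this], of "\<lambda>Z. \<phi> d * Z"]
  show "\<phi> (d * a) * (U i j * V k l) - \<phi> (d * b) * (U k j * V i l)
      + (if k = - i then \<phi> (d * c) * (\<Sum>m\<in>I. \<phi> (\<theta> i m) * (U m j * V (- m) l)) else 0)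
    = \<phi> (d * a) * (V k l * U i j) - \<phi> (d * b) * (V k j * U i l)
      + (if l = - j then \<phi> (d * c) * (\<Sum>m\<in>I. \<phi> (\<theta> m j) * (V k (- m) * U i m)) else 0)"
    by (simp add: algebra_simps hom_mult_assoc if_distrib[of "(*) _"] split: if_splits)
qed

end

section \<open>The matrix G(u)\<close>

lemma kappa_zeta: "2 * kappa ty N = of_nat N - 2 * zeta ty"
  by (simp add: kappa_def zeta_def)

lemma condition_P: "fps_X * (zm * zmk \<kappa> * (hp * zpk \<kappa>) + hp * zmk \<kappa> * (zp * zpk \<kappa>))
    + fps_const fps_X * (zm * zmk \<kappa> * (hp * zpk \<kappa>) - hp * zmk \<kappa> * (zp * zpk \<kappa>)) = 0"
  unfolding zm_def zp_def by (simp add: algebra_simps)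

text \<open>The identity \<open>condQ\<close> of \<open>reflection_frac\<close> for the actual
  coefficients. Here the value of \<kappa> matters, through N = 2 \<kappa> + 2 \<zeta>, and the 4 on
  the right is what c tr G has to be, which explains c = 4/(p - q).\<close>

lemma condition_Q:
  assumes "n = 2 * k2 \<kappa> + 2 * z"
  shows "fps_X * (zm * zmk \<kappa> * (hp * zp) + hp * zm * (zp * zpk \<kappa>)
      - z * (hp * zmk \<kappa> * (hp * zp) + hp * zm * (hp * zpk \<kappa>)) + n * (hp * zm * (hp * zp)))
    + fps_const fps_X * (hp * zm * (zp * zpk \<kappa>) - zm * zmk \<kappa> * (hp * zp)
      + z * (hp * zmk \<kappa> * (hp * zp) - hp * zm * (hp * zpk \<kappa>))) = 4 * (hp * zm * (hp * zp))"
proof -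
  have "x * (m * (m - k * h) * (h * s) + h * m * (s * (s - k * h))
      - z * (h * (m - k * h) * (h * s) + h * m * (h * (s - k * h))) + (2 * k + 2 * z) * (h * m * (h * s)))
    + y * (h * m * (s * (s - k * h)) - m * (m - k * h) * (h * s)
      + z * (h * (m - k * h) * (h * s) - h * m * (h * (s - k * h)))) = 4 * (h * m * (h * s))"
    (is "?lhs = _") if ms: "m = y - x" "s = x + y" "h = x * y" for x y h m s k :: "complex fps fps"
  proof -
    have "x * (A + B - z * (C + D) + (2 * k + 2 * z) * E) + y * (B - A + z * (C - D))
        = (x + y) * B - (y - x) * A + z * ((y - x) * C - (x + y) * D) + 2 * x * (k + z) * E"
      for A B C D E :: "complex fps fps"
      by (simp add: algebra_simps)
    then have "?lhs = s * (h * m * (s * (s - k * h))) - m * (m * (m - k * h) * (h * s))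
        + z * (m * (h * (m - k * h) * (h * s)) - s * (h * m * (h * (s - k * h)))) + 2 * x * (k + z) * (h * m * (h * s))"
      by (simp only: ms)
    \<comment> \<open>With the common factor removed, \<open>s * s - m * m\<close> is 4 h and the
      other terms cancel because \<open>m - s\<close> is -2 x.\<close>
    also have "\<dots> = h * m * s * (s * s - m * m + k * h * (m - s) + z * h * (m - s) + 2 * x * (k + z) * h)"
      by (simp add: algebra_simps)
    also have "s * s - m * m + k * h * (m - s) + z * h * (m - s) + 2 * x * (k + z) * h = 4 * h"
      by (simp add: ms algebra_simps)
    finally show ?thesis by (simp add: mult_ac)
  qed
  then show ?thesis
    unfolding assms zmk_def zpk_def by (simp only: zm_def zp_def hp_def)
qed

lemma gmat_sq: "gmat ty i * gmat ty i = 1"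
  by (cases ty) auto

definition frac_type :: "pair_type \<Rightarrow> nat \<Rightarrow> nat \<Rightarrow> bool"
  where "frac_type ty p q \<longleftrightarrow> ty = BIa p q \<or> ty = BIb p q \<or> (ty = CII p q \<or> ty = DIa p q) \<and> p \<noteq> q"

lemma gmat_series_frac:
  "frac_type ty p q \<Longrightarrow> gmat_series ty = (\<lambda>i. g_frac p q (gmat ty i))"
  by (auto simp: frac_type_def fun_eq_iff)

lemma gmat_series_const:
  assumes "\<nexists>p q. frac_type ty p q"
  shows "gmat_series ty = (\<lambda>i. fps_const (gmat ty i))"
    and "ty \<in> {B0, C0, D0, CI, DIII} \<or> (\<exists>p. ty = CII p p \<or> ty = DIa p p)"
  using assms by (cases ty; auto simp: frac_type_def fun_eq_iff)+

lemma sum_pm: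
  assumes "J \<subseteq> I" "finite I"
  shows "(\<Sum>i\<in>I. if i \<in> J then (1::complex) else -1) = of_nat (card J) - of_nat (card I - card J)"
proof -
  have "(\<Sum>i\<in>I. if i \<in> J then (1::complex) else -1) = (\<Sum>i\<in>J. 1) + (\<Sum>i\<in>I - J. -1)"
    using assms by (subst sum.subset_diff[OF assms]) (auto simp: add.commute intro!: arg_cong2[where f="(+)"] sum.cong)
  then show ?thesis using assms by (simp add: card_Diff_subset finite_subset)
qed

text \<open>The central block is itself an index set: \<open>idx q\<close> carrying -1 in type
  BI(b), \<open>idx p\<close> carrying 1 in the other types.\<close>

lemma gmat_trace:
  assumes "type_for ty N" "ty = BIa p q \<or> ty = BIb p q \<or> ty = CII p q \<or> ty = DIa p q"
  shows "(\<Sum>i\<in>idx N. gmat ty i) = of_nat p - of_nat q"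
proof -
  have sub: "idx M \<subseteq> idx N" if "M \<le> N" "even M \<longleftrightarrow> even N" for M
    using that div_le_mono[OF that(1), of 2] by (auto simp: idx_def)
  have pq: "p + q = N" using assms by (auto simp: pq_split_def)
  show ?thesis
  proof (cases "ty = BIb p q")
    case True
    have sq: "idx q \<subseteq> idx N" using True assms(1) pq by (intro sub) auto
    have "(\<Sum>i\<in>idx N. gmat ty i) = (\<Sum>i\<in>idx N. - (if i \<in> idx q then 1 else -1))"
      using True assms(1) by (intro sum.cong refl) (auto simp: idx_def elim!: oddE)
    also have "\<dots> = - (of_nat q - of_nat (N - q))"
      unfolding sum_negf sum_pm[OF sq finite_idx] card_idx ..
    finally show ?thesis using pq by auto
  next
    case False
    have sp: "idx p \<subseteq> idx N" using False assms pq by (intro sub) auto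
    have "(\<Sum>i\<in>idx N. gmat ty i) = (\<Sum>i\<in>idx N. (if i \<in> idx p then 1 else -1))"
      using False assms by (intro sum.cong refl) (auto simp: idx_def elim!: oddE evenE)
    also have "\<dots> = of_nat p - of_nat (N - p)"
      unfolding sum_pm[OF sp finite_idx] card_idx ..
    finally show ?thesis using pq by auto
  qed
qed

lemma k2_mult: "k2 a * k2 b = k2 (a * b)"
  by (simp add: k2_def)

lemma k2_add: "k2 a + k2 b = k2 (a + b)"
  by (simp add: k2_def)

lemma k2_of_nat: "k2 (of_nat n) = of_nat n"
  by (simp add: k2_def fps_of_nat)

lemma k2_sum: "(\<Sum>i\<in>A. k2 (f i)) = k2 (sum f A)"
  by (induct A rule: infinite_finite_induct) (simp_all add: k2_add)

lemma outer_fps_const [simp]: "outer (fps_const c) = k2 c"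
  by (auto simp: fps_eq_iff k2_def)

lemma outer_fps_X [simp]: "outer (fps_X :: 'a::ring_1 fps) = fps_X"
  by (auto simp: fps_eq_iff fps_X_def)

lemma outer_diff: "outer (f - g) = outer f - outer (g :: 'a::ring fps)"
  by (simp add: fps_eq_iff)

text \<open>In the BI types p and q have opposite parity.\<close>

lemma frac_type_neq: "type_for ty N \<Longrightarrow> frac_type ty p q \<Longrightarrow> p \<noteq> q"
  by (auto simp: frac_type_def)

text \<open>Either \<open>\<G>(u)\<close> is constant, or \<open>c tr \<G> = 4\<close>; both make it a solution of the reflection
  equation.\<close>

lemma G_reflection:
  fixes \<phi> :: "complex fps fps \<Rightarrow> 'a::ring"
  assumes cs: "central_scalars \<phi>" and ty: "type_for ty N" and \<kappa>: "\<kappa> = kappa ty N"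
  shows "rmatrix.rmat \<phi> (idx N) (\<lambda>i j. k2 (theta ty i j)) (zm * zmk \<kappa>) (hp * zmk \<kappa>) (hp * zm)
      * (rmatrix.D1 \<phi> (\<lambda>i. outer (gmat_series ty i))
      * (rmatrix.rmat \<phi> (idx N) (\<lambda>i j. k2 (theta ty i j)) (zp * zpk \<kappa>) (hp * zpk \<kappa>) (hp * zp)
      * rmatrix.D2 \<phi> (\<lambda>i. fps_const (gmat_series ty i))))
    = rmatrix.D2 \<phi> (\<lambda>i. fps_const (gmat_series ty i))
      * (rmatrix.rmat \<phi> (idx N) (\<lambda>i j. k2 (theta ty i j)) (zp * zpk \<kappa>) (hp * zpk \<kappa>) (hp * zp)
      * (rmatrix.D1 \<phi> (\<lambda>i. outer (gmat_series ty i))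
      * rmatrix.rmat \<phi> (idx N) (\<lambda>i j. k2 (theta ty i j)) (zm * zmk \<kappa>) (hp * zmk \<kappa>) (hp * zm)))"
proof -
  interpret rmatrix \<phi> "idx N" "\<lambda>i j. k2 (theta ty i j)" "k2 (zeta ty)"
    by (rule rmatrix_idx[OF cs ty])
  let ?g = "\<lambda>i. k2 (gmat ty i)"
  have sq: "?g i * ?g i = 1" for i by (simp add: k2_mult gmat_sq)
  consider (const) "\<nexists>p q. frac_type ty p q"
    | (frac) p q where "frac_type ty p q" "gmat_series ty = (\<lambda>i. g_frac p q (gmat ty i))"
    using gmat_series_frac[of ty] by blast
  then show ?thesis
  proof cases
    case const
    have g: "(\<lambda>i. outer (gmat_series ty i)) = ?g" "(\<lambda>i. fps_const (gmat_series ty i)) = ?g"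
      by (simp_all add: gmat_series_const(1)[OF const]) (simp add: k2_def)
    show ?thesis
    proof (cases "ty = CI \<or> ty = DIII")
      case True
      \<comment> \<open>An odd g: \<eta> = -1, and the trace vanishes by pairing i with -i.\<close>
      then have neg: "gmat ty (- i) = - gmat ty i" if "i \<in> idx N" for i
        using ty that by (auto simp: idx_def)
      have "(\<Sum>i\<in>idx N. gmat ty i) = - (\<Sum>i\<in>idx N. gmat ty i)"
      proof -
        have "(\<Sum>i\<in>idx N. gmat ty i) = (\<Sum>i\<in>idx N. gmat ty (- i))" by (rule sum_neg_I[symmetric])
        then show ?thesis by (simp add: neg sum_negf)
      qed
      then have "(\<Sum>i\<in>idx N. ?g i) = 0" by (simp add: k2_sum)
      moreover have "?g (- i) = k2 (- 1) * ?g i" if "i \<in> idx N" for i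
        using neg[OF that] by (simp add: k2_mult)
      ultimately show ?thesis
        unfolding g by (intro reflection_const[where \<eta> = "k2 (-1)"]) (auto simp: k2_mult gmat_sq)
    next
      case False
      have neg: "gmat ty (- i) = gmat ty i" for i using False by (cases ty) auto
      \<comment> \<open>What is left is G = I, or CII and DI(a) with p = q, where the trace p - q is
        zero.\<close>
      have "(\<forall>i. gmat ty i = 1) \<or> (\<Sum>i\<in>idx N. gmat ty i) = 0"
        using gmat_series_const(2)[OF const] False gmat_trace[OF ty] by fastforce
      then show ?thesis
        unfolding g by (intro reflection_const[where \<eta> = 1]) (auto simp: sq neg k2_sum)
    qed
  next
    case frac
    let ?c = "4 / (of_nat p - of_nat q) :: complex"
    have pq: "(of_nat p - of_nat q :: complex) \<noteq> 0"
      using frac_type_neq[OF ty frac(1)] by simp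
    have neg: "?g (- i) = ?g i" for i using frac(1) by (auto simp: frac_type_def)
    have tr: "(\<Sum>i\<in>idx N. gmat ty i) = of_nat p - of_nat q"
      using frac(1) by (intro gmat_trace[OF ty]) (auto simp: frac_type_def)
    have gt: "k2 ?c * (\<Sum>i\<in>idx N. ?g i) = 4"
    proof -
      have "?c * (of_nat p - of_nat q) = 4" unfolding times_divide_eq_left by (rule nonzero_mult_div_cancel_right[OF pq])
      then show ?thesis unfolding k2_sum tr k2_mult using k2_of_nat[of 4] by simp
    qed
    have n: "of_nat (card (idx N)) = 2 * k2 \<kappa> + 2 * k2 (zeta ty)"
    proof -
      have "of_nat N = k2 (2 * \<kappa> + 2 * zeta ty)"
        unfolding \<kappa> kappa_zeta by (simp add: k2_of_nat)
      also have "\<dots> = k2 2 * k2 \<kappa> + k2 2 * k2 (zeta ty)" by (simp add: k2_mult k2_add)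
      finally show ?thesis by (simp add: card_idx k2_of_nat[of 2, simplified])
    qed
    show ?thesis
    proof (rule reflection_frac[where g = ?g and x = fps_X and y = "fps_const fps_X" and \<gamma> = "k2 ?c"])
      show "(\<lambda>i. outer (gmat_series ty i)) = (\<lambda>i. outer (inverse (fps_X - fps_const ?c)) * (fps_X - k2 ?c * ?g i))"
        by (simp add: frac(2) g_frac_def Let_def outer_mult outer_diff k2_mult mult.commute fun_eq_iff)
      show "(\<lambda>i. fps_const (gmat_series ty i)) = (\<lambda>i. fps_const (inverse (fps_X - fps_const ?c)) * (fps_const fps_X - k2 ?c * ?g i))"
        by (simp add: frac(2) g_frac_def Let_def k2_def mult.commute fun_eq_iff)
    qed (simp_all only: sq neg condition_P condition_Q[OF n] gt)
  qed
qed

lemma lift_series_eq: "lift_series = fps_map scalar"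
  by (simp add: lift_series_def fps_map_def fun_eq_iff)

interpretation scalar: central_scalars "scalar :: complex \<Rightarrow> gen free_alg"
  by (rule central_scalars_scalar)

interpretation fscalar: central_scalars "fps_map (scalar :: complex \<Rightarrow> gen free_alg)"
  by (rule central_scalars_fps_map[OF central_scalars_scalar])

lemma compose_lift: "f oo lift_series \<alpha> = fps_subst scalar \<alpha> f"
proof -
  have "fps_map scalar \<alpha> ^ i = fps_map (scalar :: complex \<Rightarrow> gen free_alg) (\<alpha> ^ i)" for i
  proof (induct i)
    case 0
    show ?case by (simp add: fps_eq_iff)
  qed (simp add: fscalar.hom_mult)
  then show ?thesis by (simp add: lift_series_eq fps_subst_def fps_eq_iff fps_compose_nth)
qed

section \<open>T(u) and S(u) over the product ring\<close>

definition t_sub :: "pair_type \<Rightarrow> nat \<Rightarrow> complex fps \<Rightarrow> int \<Rightarrow> int \<Rightarrow> yang fps"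
  where "t_sub ty N \<alpha> i j = fps_subst yang_scalar \<alpha> (fps_map (to_yang ty N) (t_series i j))"

definition s_yang :: "pair_type \<Rightarrow> nat \<Rightarrow> int \<Rightarrow> int \<Rightarrow> yang fps"
  where "s_yang ty N i j = fps_map (to_yang ty N) (s_series ty N i j)"

context
  fixes ty :: pair_type and N :: nat
  assumes ty: "type_for ty N"
begin

abbreviation (input) "\<Phi> \<equiv> lift2 yang_scalar"

lemma cs2: "central_scalars \<Phi>"
  by (intro central_scalars_lift2 central_scalars_yang)

interpretation Y: central_scalars yang_scalar by (rule central_scalars_yang)
interpretation FY: central_scalars "fps_map yang_scalar"
  by (rule central_scalars_fps_map[OF central_scalars_yang])
interpretation rm: rmatrix \<Phi> "idx N" "\<lambda>i j. k2 (theta ty i j)" "k2 (zeta ty)"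
  by (rule rmatrix_idx[OF cs2 ty])
interpretation \<pi>: partial_hom "carrier (free_ring (gens N))" "to_yang ty N" scalar yang_scalar
  by (rule partial_hom_to_yang)
interpretation \<pi>1: partial_hom "fps_set (carrier (free_ring (gens N)))" "fps_map (to_yang ty N)"
    "fps_map scalar" "fps_map yang_scalar"
  by (rule partial_hom_fps_map[OF partial_hom_to_yang])
interpretation \<pi>2: partial_hom "fps_set (fps_set (carrier (free_ring (gens N))))"
    "fps_map (fps_map (to_yang ty N))" L \<Phi>
  by (rule partial_hom_fps_map[OF partial_hom_fps_map[OF partial_hom_to_yang]])

abbreviation (input) "Ty \<equiv> \<lambda>i j. fps_map (to_yang ty N) (t_series i j)"

lemma map_outer: "fps_map (fps_map (to_yang ty N)) (outer f) = outer (fps_map (to_yang ty N) f)"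
  by (auto simp: fps_eq_iff \<pi>.map_zero)

lemma map_const2: "fps_map (fps_map (to_yang ty N)) (fps_const c) = fps_const (fps_map (to_yang ty N) c)"
  by (auto simp: fps_eq_iff \<pi>.map_zero)

lemma rtt_yang: "rm.rtt (zm * zmk (kappa ty N)) (hp * zmk (kappa ty N)) (hp * zm)
    (\<lambda>i j. outer (Ty i j)) (\<lambda>i j. fps_const (Ty i j))"
  unfolding rm.rtt_def
proof (intro ballI)
  fix i j k l assume ij: "i \<in> idx N" "j \<in> idx N" "k \<in> idx N" "l \<in> idx N"
  have "RTT_defect ty N i j k l $ r $ s \<in> RTT_ideal ty N" for r s
    unfolding RTT_ideal_def using ij
    by (intro ring.genideal_self[OF free_ring_ring RTT_relations_in, THEN subsetD])
       (unfold RTT_relations_def, blast)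
  then have "fps_map (fps_map (to_yang ty N)) (RTT_defect ty N i j k l) = 0"
    by (simp add: fps_eq_iff to_yang_ideal)
  note this[unfolded RTT_defect_sparse[OF ij]]
  moreover have "t_in_u a b \<in> fps_set (fps_set (carrier (free_ring (gens N))))"
    "t_in_v a b \<in> fps_set (fps_set (carrier (free_ring (gens N))))" if "a \<in> idx N" "b \<in> idx N" for a b
    using t_in_uv_in[OF that] .
  moreover have "fps_map (fps_map (to_yang ty N)) (t_in_u a b) = outer (Ty a b)"
    "fps_map (fps_map (to_yang ty N)) (t_in_v a b) = fps_const (Ty a b)" for a b
    by (simp_all add: t_in_u_outer t_in_v_def map_outer map_const2)
  ultimately show "\<Phi> (zm * zmk (kappa ty N)) * (outer (Ty i j) * fps_const (Ty k l))
      - \<Phi> (hp * zmk (kappa ty N)) * (outer (Ty k j) * fps_const (Ty i l))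
      + (if k = - i then \<Phi> (hp * zm) * (\<Sum>m\<in>idx N. \<Phi> (k2 (theta ty i m)) * (outer (Ty m j) * fps_const (Ty (- m) l))) else 0)
    = \<Phi> (zm * zmk (kappa ty N)) * (fps_const (Ty k l) * outer (Ty i j))
      - \<Phi> (hp * zmk (kappa ty N)) * (fps_const (Ty k j) * outer (Ty i l))
      + (if l = - j then \<Phi> (hp * zm) * (\<Sum>m\<in>idx N. \<Phi> (k2 (theta ty m j)) * (fps_const (Ty k (- m)) * outer (Ty i m))) else 0)"
    using ij by (cases "k = - i"; cases "l = - j") (simp_all add: \<pi>2.map_diff \<pi>2.map_add \<pi>2.map_scalar \<pi>2.map_mult \<pi>2.map_sum \<pi>2.diff_in \<pi>2.add_in
        \<pi>2.scalar_in \<pi>2.mult_in \<pi>2.sum_in \<pi>2.if_in \<pi>2.map_if \<pi>2.map_zero \<pi>2.zero_in)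
qed

end

section \<open>Shifting the spectral parameters\<close>

context
  fixes ty :: pair_type and N :: nat
  assumes ty: "type_for ty N"
begin

interpretation Y: central_scalars yang_scalar by (rule central_scalars_yang)
interpretation FY: central_scalars "fps_map yang_scalar"
  by (rule central_scalars_fps_map[OF central_scalars_yang])
interpretation rm: rmatrix "lift2 yang_scalar" "idx N" "\<lambda>i j. k2 (theta ty i j)" "k2 (zeta ty)"
  by (rule rmatrix_idx[OF central_scalars_lift2[OF central_scalars_yang] ty])
interpretation \<pi>: partial_hom "carrier (free_ring (gens N))" "to_yang ty N" scalar yang_scalar
  by (rule partial_hom_to_yang)
interpretation \<pi>1: partial_hom "fps_set (carrier (free_ring (gens N)))" "fps_map (to_yang ty N)"
    "fps_map scalar" "fps_map yang_scalar"
  by (rule partial_hom_fps_map[OF partial_hom_to_yang])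

abbreviation (input) "\<kappa>\<^sub>X \<equiv> kappa ty N"
abbreviation (input) "\<sigma>\<^sub>X \<equiv> shifted_inv (kappa ty N / 2)"
abbreviation (input) "Tp \<equiv> t_sub ty N \<sigma>\<^sub>X"
abbreviation (input) "Tm \<equiv> t_sub ty N (- \<sigma>\<^sub>X)"

lemma shifted_inv_0 [simp]: "shifted_inv c $ 0 = 0"
  by (simp add: shifted_inv_def)

lemma subst2_k2: "subst2 (\<lambda>x. x) \<alpha> \<beta> (k2 c) = k2 c"
proof -
  interpret central_scalars "\<lambda>x::complex. x" by (rule central_scalars_id)
  show ?thesis
    unfolding k2_def subst2_const[OF central_scalars_id] by (simp add: fps_subst_const)
qed

lemma fps_swap_k2: "fps_swap (k2 c) = k2 c"
  by (auto simp: fps_eq_iff k2_def)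

lemma subst2_X:
  assumes "\<alpha> $ 0 = (0 :: complex)"
  shows "subst2 (\<lambda>x. x) \<alpha> \<beta> fps_X = outer \<alpha>" "subst2 (\<lambda>x. x) \<beta> \<alpha> (fps_const fps_X) = fps_const \<alpha>"
proof -
  have X: "fps_subst (\<lambda>x. x) \<alpha> fps_X = \<alpha>"
    using assms by (simp add: fps_subst_id)
  show "subst2 (\<lambda>x. x) \<alpha> \<beta> fps_X = outer \<alpha>"
    using subst2_outer[OF central_scalars_id, of \<alpha> \<beta> fps_X] X by simp
  show "subst2 (\<lambda>x. x) \<beta> \<alpha> (fps_const fps_X) = fps_const \<alpha>"
    by (simp add: subst2_const[OF central_scalars_id] X)
qed

text \<open>Common denominator of the shifted variables: replacing u by u - \<kappa>/2 turns x into
  x / (1 - \<kappa> x / 2), and likewise for y.\<close>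

definition den :: "complex fps fps"
  where "den = outer (1 - fps_const (\<kappa>\<^sub>X / 2) * fps_X) * fps_const (1 - fps_const (\<kappa>\<^sub>X / 2) * fps_X)"

lemma den_mult: "den * (outer \<sigma>\<^sub>X * fps_const \<sigma>\<^sub>X) = hp"
  "den * outer \<sigma>\<^sub>X = fps_X * fps_const (1 - fps_const (\<kappa>\<^sub>X / 2) * fps_X)"
  "den * fps_const \<sigma>\<^sub>X = fps_const fps_X * outer (1 - fps_const (\<kappa>\<^sub>X / 2) * fps_X)"
proof -
  let ?d = "1 - fps_const (\<kappa>\<^sub>X / 2) * fps_X"
  have "?d * \<sigma>\<^sub>X = fps_X"
    unfolding shifted_inv_def by (simp add: mult.left_commute[of ?d] inverse_mult_eq_1')
  then have o: "outer ?d * outer \<sigma>\<^sub>X = fps_X" and c: "fps_const ?d * fps_const \<sigma>\<^sub>X = fps_const fps_X"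
    by (simp_all flip: outer_mult)
  show "den * (outer \<sigma>\<^sub>X * fps_const \<sigma>\<^sub>X) = hp"
  proof -
    have "den * (outer \<sigma>\<^sub>X * fps_const \<sigma>\<^sub>X) = (outer ?d * outer \<sigma>\<^sub>X) * (fps_const ?d * fps_const \<sigma>\<^sub>X)"
      by (simp only: den_def mult_ac)
    then show ?thesis unfolding o c hp_def .
  qed
  have "den * outer \<sigma>\<^sub>X = (outer ?d * outer \<sigma>\<^sub>X) * fps_const ?d" by (simp only: den_def mult_ac)
  then show "den * outer \<sigma>\<^sub>X = fps_X * fps_const ?d" unfolding o .
  have "den * fps_const \<sigma>\<^sub>X = (fps_const ?d * fps_const \<sigma>\<^sub>X) * outer ?d" by (simp only: den_def mult_ac)
  then show "den * fps_const \<sigma>\<^sub>X = fps_const fps_X * outer ?d" unfolding c .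
qed

lemma den_diff: "den * (fps_const \<sigma>\<^sub>X - outer \<sigma>\<^sub>X) = zm"
proof -
  have "outer (1 - fps_const (\<kappa>\<^sub>X / 2) * fps_X) = 1 - k2 (\<kappa>\<^sub>X / 2) * fps_X"
    by (simp add: outer_diff outer_mult flip: outer_fps_X) (simp add: fps_eq_iff)
  then show ?thesis
    by (simp add: right_diff_distrib den_mult zm_def k2_def)
       (simp add: algebra_simps flip: fps_const_mult fps_const_sub)
qed

text \<open>Two shifts by \<kappa>/2 add up: u + v becomes u + v - \<kappa>, whereas u - v is
  unchanged by \<open>den_diff\<close>.\<close>

lemma den_sum: "den * (outer \<sigma>\<^sub>X + fps_const \<sigma>\<^sub>X) = zpk \<kappa>\<^sub>X"
proof -
  have o: "outer (1 - fps_const (\<kappa>\<^sub>X / 2) * fps_X) = 1 - k2 (\<kappa>\<^sub>X / 2) * fps_X"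
    by (simp add: outer_diff outer_mult flip: outer_fps_X) (simp add: fps_eq_iff)
  have c: "fps_const (1 - fps_const (\<kappa>\<^sub>X / 2) * fps_X) = 1 - k2 (\<kappa>\<^sub>X / 2) * fps_const fps_X"
    by (simp add: k2_def flip: fps_const_mult fps_const_sub)
  have k: "k2 (\<kappa>\<^sub>X / 2) + k2 (\<kappa>\<^sub>X / 2) = k2 \<kappa>\<^sub>X" by (simp add: k2_add)
  have "den * (outer \<sigma>\<^sub>X + fps_const \<sigma>\<^sub>X) = zp - (k2 (\<kappa>\<^sub>X / 2) + k2 (\<kappa>\<^sub>X / 2)) * hp"
    unfolding distrib_left den_mult o c zp_def hp_def by (simp add: algebra_simps)
  then show ?thesis unfolding k zpk_def .
qed

text \<open>Each coefficient of \<open>rtt\<close> is a product of two of \<open>zm\<close>,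
  \<open>zmk \<kappa>\<close> and \<open>hp\<close>, so one factor \<open>den\<close> goes to each
  of them; \<open>z\<close> and \<open>h\<close> are the images of \<open>zm\<close> and
  \<open>hp\<close> once cleared.\<close>

lemma rtt_subst:
  assumes add: "\<And>F G. H (F + G) = H F + (H G :: yang fps fps)" and mult: "\<And>F G. H (F * G) = H F * H G"
    and lift: "\<And>p. H (lift2 yang_scalar p) = lift2 yang_scalar (H' p)"
    and addC: "\<And>F G. H' (F + G) = H' F + H' G" and multC: "\<And>F G. H' (F * G) = H' F * H' G"
    and k: "\<And>c. H' (k2 c) = k2 c"
    and h: "den * H' hp = h" and z: "den * H' zm = z"
  shows "rm.rtt (z * (z - k2 \<kappa>\<^sub>X * h)) (h * (z - k2 \<kappa>\<^sub>X * h)) (h * z)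
      (\<lambda>i j. H (outer (fps_map (to_yang ty N) (t_series i j))))
      (\<lambda>i j. H (fps_const (fps_map (to_yang ty N) (t_series i j))))"
proof -
  have "additive H'" by (simp add: additive_def addC)
  then have d: "H' (F - G) = H' F - H' G" for F G by (rule additive.diff)
  have zk: "den * H' (zmk \<kappa>\<^sub>X) = z - k2 \<kappa>\<^sub>X * h"
    unfolding zmk_def d multC k h[symmetric] z[symmetric] by (simp add: algebra_simps)
  have m: "den * den * H' (F * G) = (den * H' F) * (den * H' G)" for F G
    by (simp add: multC mult_ac)
  show ?thesis
    using rm.rtt_scale[OF rm.rtt_hom[OF rtt_yang[OF ty] add mult lift k], of "den * den"]
    unfolding m zk h z .
qed

text \<open>The substitutions \<open>(u, v) \<mapsto> (u - \<kappa>/2, v - \<kappa>/2)\<close>, \<open>(\<kappa>/2 - v, \<kappa>/2 - u)\<close>,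
  \<open>(\<kappa>/2 - u, v - \<kappa>/2)\<close> and \<open>(\<kappa>/2 - v, u - \<kappa>/2)\<close> in the defining relation.\<close>

lemma rtt_pp: "rm.rtt (zm * zmk \<kappa>\<^sub>X) (hp * zmk \<kappa>\<^sub>X) (hp * zm) (\<lambda>i j. outer (Tp i j)) (\<lambda>i j. fps_const (Tp i j))"
proof -
  note cs = central_scalars_yang and ci = central_scalars_id[where 'k = complex]
  have "rm.rtt (zm * (zm - k2 \<kappa>\<^sub>X * hp)) (hp * (zm - k2 \<kappa>\<^sub>X * hp)) (hp * zm)
      (\<lambda>i j. subst2 yang_scalar \<sigma>\<^sub>X \<sigma>\<^sub>X (outer (fps_map (to_yang ty N) (t_series i j))))
      (\<lambda>i j. subst2 yang_scalar \<sigma>\<^sub>X \<sigma>\<^sub>X (fps_const (fps_map (to_yang ty N) (t_series i j))))"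
  proof (rule rtt_subst[where H' = "subst2 (\<lambda>x. x) \<sigma>\<^sub>X \<sigma>\<^sub>X"])
    have "additive (subst2 (\<lambda>x::complex. x) \<sigma>\<^sub>X \<sigma>\<^sub>X)" by (simp add: additive_def subst2_add[OF ci])
    then have d: "subst2 (\<lambda>x. x) \<sigma>\<^sub>X \<sigma>\<^sub>X (F - G) = subst2 (\<lambda>x. x) \<sigma>\<^sub>X \<sigma>\<^sub>X F - subst2 (\<lambda>x. x) \<sigma>\<^sub>X \<sigma>\<^sub>X G"
      for F G :: "complex fps fps" by (rule additive.diff)
    show "den * subst2 (\<lambda>x. x) \<sigma>\<^sub>X \<sigma>\<^sub>X hp = hp"
      unfolding hp_def subst2_mult[OF ci shifted_inv_0 shifted_inv_0] by (simp add: subst2_X den_mult) (simp add: hp_def)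
    show "den * subst2 (\<lambda>x. x) \<sigma>\<^sub>X \<sigma>\<^sub>X zm = zm"
      unfolding zm_def d by (simp add: subst2_X den_diff) (simp add: zm_def)
  qed (simp_all add: subst2_add[OF cs] subst2_add[OF ci] subst2_mult[OF cs] subst2_mult[OF ci] subst2_map[OF cs] subst2_k2)
  then show ?thesis
    by (simp add: subst2_outer[OF cs] subst2_const[OF cs] t_sub_def zmk_def)
qed

text \<open>Negating both variables would reverse the sign of u - v; the additional
  \<open>fps_swap\<close> restores it. It also exchanges the places of U and V, as
  \<open>rtt_transpose_both'\<close> expects.\<close>

lemma rtt_mm: "rm.rtt (zm * zmk \<kappa>\<^sub>X) (hp * zmk \<kappa>\<^sub>X) (hp * zm) (\<lambda>i j. fps_const (Tm i j)) (\<lambda>i j. outer (Tm i j))"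
proof -
  note cs = central_scalars_yang and ci = central_scalars_id[where 'k = complex]
  let ?H = "\<lambda>F. fps_swap (subst2 yang_scalar (- \<sigma>\<^sub>X) (- \<sigma>\<^sub>X) F)"
  let ?H' = "\<lambda>F :: complex fps fps. fps_swap (subst2 (\<lambda>x. x) (- \<sigma>\<^sub>X) (- \<sigma>\<^sub>X) F)"
  have "rm.rtt (zm * (zm - k2 \<kappa>\<^sub>X * hp)) (hp * (zm - k2 \<kappa>\<^sub>X * hp)) (hp * zm)
      (\<lambda>i j. ?H (outer (fps_map (to_yang ty N) (t_series i j))))
      (\<lambda>i j. ?H (fps_const (fps_map (to_yang ty N) (t_series i j))))"
  proof (rule rtt_subst[where H' = ?H'])
    have "additive ?H'" by (simp add: additive_def subst2_add[OF ci] fps_swap_add)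
    then have d: "?H' (F - G) = ?H' F - ?H' G" for F G by (rule additive.diff)
    have m: "?H' (F * G) = ?H' F * ?H' G" for F G by (simp add: subst2_mult[OF ci] fps_swap_mult)
    have X: "?H' fps_X = - fps_const \<sigma>\<^sub>X" "?H' (fps_const fps_X) = - outer \<sigma>\<^sub>X"
      by (simp_all add: subst2_X) (simp add: fps_eq_iff)
    have "- fps_const \<sigma>\<^sub>X * - outer \<sigma>\<^sub>X = outer \<sigma>\<^sub>X * fps_const \<sigma>\<^sub>X"
      by (simp only: minus_mult_minus mult.commute)
    then show "den * ?H' hp = hp"
      unfolding hp_def m X by (simp only: den_mult hp_def)
    have e: "- outer \<sigma>\<^sub>X - - fps_const \<sigma>\<^sub>X = fps_const \<sigma>\<^sub>X - outer \<sigma>\<^sub>X" by simp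
    show "den * ?H' zm = zm"
      unfolding zm_def d X e den_diff by (simp add: zm_def)
  qed (simp_all add: subst2_add[OF cs] subst2_add[OF ci] subst2_mult[OF cs] subst2_mult[OF ci] subst2_map[OF cs]
      subst2_k2 fps_swap_add fps_swap_mult fps_swap_map fps_swap_k2)
  then show ?thesis
    by (simp add: subst2_outer[OF cs] subst2_const[OF cs] t_sub_def zmk_def)
qed

text \<open>Crossing: u - v becomes -(u + v - \<kappa>) and u - v - \<kappa> becomes -(u + v), so P
  and Q trade their poles with opposite sign. The transposition in
  \<open>rtt_transpose_first\<close> trades P and Q back, and the result is R(u + v).\<close>

lemma rtt_mp: "rm.rtt (zp * zpk \<kappa>\<^sub>X) (- (hp * zp)) (- (hp * zpk \<kappa>\<^sub>X)) (\<lambda>i j. outer (Tm i j)) (\<lambda>i j. fps_const (Tp i j))"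
proof -
  note cs = central_scalars_yang and ci = central_scalars_id[where 'k = complex]
  have "rm.rtt (zpk \<kappa>\<^sub>X * (zpk \<kappa>\<^sub>X - k2 \<kappa>\<^sub>X * (- hp))) (- hp * (zpk \<kappa>\<^sub>X - k2 \<kappa>\<^sub>X * (- hp))) (- hp * zpk \<kappa>\<^sub>X)
      (\<lambda>i j. subst2 yang_scalar (- \<sigma>\<^sub>X) \<sigma>\<^sub>X (outer (fps_map (to_yang ty N) (t_series i j))))
      (\<lambda>i j. subst2 yang_scalar (- \<sigma>\<^sub>X) \<sigma>\<^sub>X (fps_const (fps_map (to_yang ty N) (t_series i j))))"
  proof (rule rtt_subst[where H' = "subst2 (\<lambda>x. x) (- \<sigma>\<^sub>X) \<sigma>\<^sub>X"])
    let ?H' = "subst2 (\<lambda>x::complex. x) (- \<sigma>\<^sub>X) \<sigma>\<^sub>X"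
    have "additive ?H'" by (simp add: additive_def subst2_add[OF ci])
    then have d: "?H' (F - G) = ?H' F - ?H' G" for F G by (rule additive.diff)
    have m: "?H' (F * G) = ?H' F * ?H' G" for F G by (simp add: subst2_mult[OF ci])
    have X: "?H' fps_X = - outer \<sigma>\<^sub>X" "?H' (fps_const fps_X) = fps_const \<sigma>\<^sub>X"
      by (simp_all add: subst2_X) (simp add: fps_eq_iff)
    show "den * ?H' hp = - hp"
      unfolding hp_def m X by (simp add: den_mult) (simp add: hp_def)
    have e: "fps_const \<sigma>\<^sub>X - - outer \<sigma>\<^sub>X = outer \<sigma>\<^sub>X + fps_const \<sigma>\<^sub>X" by simp
    show "den * ?H' zm = zpk \<kappa>\<^sub>X"
      unfolding zm_def d X e den_sum ..
  qed (simp_all add: subst2_add[OF cs] subst2_add[OF ci] subst2_mult[OF cs] subst2_mult[OF ci] subst2_map[OF cs] subst2_k2)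
  then show ?thesis
    by (simp add: subst2_outer[OF cs] subst2_const[OF cs] t_sub_def zpk_def mult.commute)
qed

lemma rtt_pm: "rm.rtt (zp * zpk \<kappa>\<^sub>X) (- (hp * zp)) (- (hp * zpk \<kappa>\<^sub>X)) (\<lambda>i j. fps_const (Tm i j)) (\<lambda>i j. outer (Tp i j))"
proof -
  note cs = central_scalars_yang and ci = central_scalars_id[where 'k = complex]
  let ?H = "\<lambda>F. fps_swap (subst2 yang_scalar (- \<sigma>\<^sub>X) \<sigma>\<^sub>X F)"
  let ?H' = "\<lambda>F :: complex fps fps. fps_swap (subst2 (\<lambda>x. x) (- \<sigma>\<^sub>X) \<sigma>\<^sub>X F)"
  have "rm.rtt (zpk \<kappa>\<^sub>X * (zpk \<kappa>\<^sub>X - k2 \<kappa>\<^sub>X * (- hp))) (- hp * (zpk \<kappa>\<^sub>X - k2 \<kappa>\<^sub>X * (- hp))) (- hp * zpk \<kappa>\<^sub>X)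
      (\<lambda>i j. ?H (outer (fps_map (to_yang ty N) (t_series i j))))
      (\<lambda>i j. ?H (fps_const (fps_map (to_yang ty N) (t_series i j))))"
  proof (rule rtt_subst[where H' = ?H'])
    have "additive ?H'" by (simp add: additive_def subst2_add[OF ci] fps_swap_add)
    then have d: "?H' (F - G) = ?H' F - ?H' G" for F G by (rule additive.diff)
    have m: "?H' (F * G) = ?H' F * ?H' G" for F G by (simp add: subst2_mult[OF ci] fps_swap_mult)
    have X: "?H' fps_X = - fps_const \<sigma>\<^sub>X" "?H' (fps_const fps_X) = outer \<sigma>\<^sub>X"
      by (simp_all add: subst2_X)
    have "- fps_const \<sigma>\<^sub>X * outer \<sigma>\<^sub>X = - (outer \<sigma>\<^sub>X * fps_const \<sigma>\<^sub>X)"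
      by (simp only: mult_minus_left mult_minus_right mult.commute)
    then show "den * ?H' hp = - hp"
      unfolding hp_def m X by (simp only: mult_minus_right den_mult hp_def)
    have e: "outer \<sigma>\<^sub>X - - fps_const \<sigma>\<^sub>X = outer \<sigma>\<^sub>X + fps_const \<sigma>\<^sub>X" by simp
    show "den * ?H' zm = zpk \<kappa>\<^sub>X"
      unfolding zm_def d X e den_sum ..
  qed (simp_all add: subst2_add[OF cs] subst2_add[OF ci] subst2_mult[OF cs] subst2_mult[OF ci] subst2_map[OF cs]
      subst2_k2 fps_swap_add fps_swap_mult fps_swap_map fps_swap_k2)
  then show ?thesis
    by (simp add: subst2_outer[OF cs] subst2_const[OF cs] t_sub_def zpk_def mult.commute)
qed

lemma fps_map_subst:
  assumes "f \<in> fps_set (carrier (free_ring (gens N)))"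
  shows "fps_subst scalar \<alpha> f \<in> fps_set (carrier (free_ring (gens N)))"
    and "fps_map (to_yang ty N) (fps_subst scalar \<alpha> f) = fps_subst yang_scalar \<alpha> (fps_map (to_yang ty N) f)"
proof -
  have f: "f $ i \<in> carrier (free_ring (gens N))" for i using assms by (simp add: fps_set_def)
  have e: "fps_subst scalar \<alpha> f $ n = (\<Sum>i=0..n. scalar (\<alpha> ^ i $ n) * f $ i)" for n
    unfolding fps_subst_def fps_nth_Abs_fps by (intro sum.cong refl) (rule scalar_central[symmetric])
  have e': "fps_subst yang_scalar \<alpha> g $ n = (\<Sum>i=0..n. yang_scalar (\<alpha> ^ i $ n) * g $ i)" for g n
    unfolding fps_subst_def fps_nth_Abs_fps by (intro sum.cong refl) (rule Y.central[symmetric])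
  show "fps_subst scalar \<alpha> f \<in> fps_set (carrier (free_ring (gens N)))"
    by (auto simp: fps_set_def e f intro!: \<pi>.sum_in \<pi>.scalar_in)
  show "fps_map (to_yang ty N) (fps_subst scalar \<alpha> f) = fps_subst yang_scalar \<alpha> (fps_map (to_yang ty N) f)"
    by (simp add: fps_eq_iff e e' f \<pi>.map_sum \<pi>.scalar_in \<pi>.map_scalar)
qed

lemma s_series_eq:
  assumes "i \<in> idx N" "j \<in> idx N"
  shows "s_series ty N i j = (\<Sum>a\<in>idx N. fps_subst scalar \<sigma>\<^sub>X (t_series i a) *
    (fps_map scalar (gmat_series ty a) * (fps_map scalar (fps_const (theta ty a j)) *
      fps_subst scalar (- \<sigma>\<^sub>X) (t_series (- j) (- a)))))"
  unfolding s_series_def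
proof (rule sum.cong[OF refl])
  fix a assume a: "a \<in> idx N"
  have th: "theta ty (- j) (- a) = theta ty a j" by (simp add: theta_def)
  have "lift_series (- \<sigma>\<^sub>X) = - lift_series \<sigma>\<^sub>X"
    by (simp add: fps_eq_iff lift_series_eq scalar.hom_minus)
  then have "tt_series ty a j oo - lift_series \<sigma>\<^sub>X = fps_subst scalar (- \<sigma>\<^sub>X) (fps_const (scalar (theta ty a j)) * t_series (- j) (- a))"
    by (simp add: tt_series_def th flip: compose_lift)
  also have "\<dots> = fps_const (scalar (theta ty a j)) * fps_subst scalar (- \<sigma>\<^sub>X) (t_series (- j) (- a))"
    by (subst scalar.fps_subst_mult) (simp_all add: scalar.fps_subst_const)
  also have "fps_const (scalar (theta ty a j)) = (fps_map scalar (fps_const (theta ty a j)) :: gen free_alg fps)"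
    by (auto simp: fps_eq_iff)
  finally show "(t_series i a oo lift_series \<sigma>\<^sub>X) * lift_series (gmat_series ty a) * (tt_series ty a j oo lift_series (- \<sigma>\<^sub>X))
    = fps_subst scalar \<sigma>\<^sub>X (t_series i a) * (fps_map scalar (gmat_series ty a) *
        (fps_map scalar (fps_const (theta ty a j)) * fps_subst scalar (- \<sigma>\<^sub>X) (t_series (- j) (- a))))"
    unfolding \<open>lift_series (- \<sigma>\<^sub>X) = - lift_series \<sigma>\<^sub>X\<close> compose_lift by (simp add: lift_series_eq mult.assoc)
qed

lemma s_series_in:
  assumes "i \<in> idx N" "j \<in> idx N"
  shows "s_series ty N i j \<in> fps_set (carrier (free_ring (gens N)))"
  unfolding s_series_eq[OF assms] using assms
  by (intro \<pi>1.sum_in \<pi>1.mult_in \<pi>1.scalar_in fps_map_subst t_series_in) auto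

lemma s_yang_eq:
  assumes "i \<in> idx N" "j \<in> idx N"
  shows "s_yang ty N i j = (\<Sum>a\<in>idx N. Tp i a *
    (fps_map yang_scalar (gmat_series ty a) * (fps_map yang_scalar (fps_const (theta ty a j)) * Tm (- j) (- a))))"
  unfolding s_yang_def s_series_eq[OF assms] t_sub_def using assms
  by (simp add: \<pi>1.map_sum \<pi>1.mult_in \<pi>1.scalar_in \<pi>1.map_mult \<pi>1.map_scalar fps_map_subst t_series_in)

lemma lift2_outer: "lift2 yang_scalar (outer f) = outer (fps_map yang_scalar f)"
  by (auto simp: fps_eq_iff Y.hom_zero)

lemma lift2_const: "lift2 yang_scalar (fps_const f) = fps_const (fps_map yang_scalar f)"
  by (auto simp: fps_eq_iff Y.hom_zero)

theorem reflection_equation_yang: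
  assumes ij: "i \<in> idx N" "j \<in> idx N" "k \<in> idx N" "l \<in> idx N"
  shows "reflection_lhs (lift2 yang_scalar) (idx N) (\<lambda>i j. k2 (theta ty i j)) \<kappa>\<^sub>X (\<lambda>i j. outer (s_yang ty N i j)) (\<lambda>i j. fps_const (s_yang ty N i j)) i j k l
    = reflection_rhs (lift2 yang_scalar) (idx N) (\<lambda>i j. k2 (theta ty i j)) \<kappa>\<^sub>X (\<lambda>i j. outer (s_yang ty N i j)) (\<lambda>i j. fps_const (s_yang ty N i j)) i j k l"
proof -
  let ?X = "\<lambda>i j. outer (Tp i j)" and ?Y = "\<lambda>i j. fps_const (Tp i j)"
  let ?X' = "rm.mt (\<lambda>i j. outer (Tm i j))" and ?Y' = "rm.mt (\<lambda>i j. fps_const (Tm i j))"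
  let ?g = "\<lambda>i. outer (gmat_series ty i)" and ?h = "\<lambda>i. fps_const (gmat_series ty i)"
  let ?U = "\<lambda>i j. \<Sum>m\<in>idx N. ?X i m * (lift2 yang_scalar (?g m) * ?X' m j)"
  let ?V = "\<lambda>i j. \<Sum>m\<in>idx N. ?Y i m * (lift2 yang_scalar (?h m) * ?Y' m j)"
  have U: "?U i j = outer (s_yang ty N i j)" and V: "?V i j = fps_const (s_yang ty N i j)"
    if "i \<in> idx N" "j \<in> idx N" for i j
  proof -
    have k: "lift2 yang_scalar (k2 c) = outer (fps_map yang_scalar (fps_const c))"
      "lift2 yang_scalar (k2 c) = fps_const (fps_map yang_scalar (fps_const c))" for c
      unfolding lift2_outer[symmetric] lift2_const[symmetric] by (simp_all add: k2_def[symmetric])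
    show "?U i j = outer (s_yang ty N i j)"
      unfolding s_yang_eq[OF that] outer_sum outer_mult rm.mt_def lift2_outer k(1) ..
    have "fps_const (sum f A) = (\<Sum>a\<in>A. fps_const (f a))" for f :: "int \<Rightarrow> yang fps" and A
      by (induct A rule: infinite_finite_induct) (simp_all flip: fps_const_add)
    then show "?V i j = fps_const (s_yang ty N i j)"
      unfolding s_yang_eq[OF that] rm.mt_def lift2_const k(2) by simp
  qed
  have "reflection_lhs (lift2 yang_scalar) (idx N) (\<lambda>i j. k2 (theta ty i j)) \<kappa>\<^sub>X ?U ?V i j k l
    = reflection_rhs (lift2 yang_scalar) (idx N) (\<lambda>i j. k2 (theta ty i j)) \<kappa>\<^sub>X ?U ?V i j k l"
  proof (rule rm.reflection_equation[OF _ _ _ _ _ refl refl ij])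
    show "rm.rmat (zm * zmk \<kappa>\<^sub>X) (hp * zmk \<kappa>\<^sub>X) (hp * zm) * (rm.M1 ?X * rm.M2 ?Y)
        = rm.M2 ?Y * (rm.M1 ?X * rm.rmat (zm * zmk \<kappa>\<^sub>X) (hp * zmk \<kappa>\<^sub>X) (hp * zm))"
      by (rule rm.rtt_matrix[OF rtt_pp])
    show "rm.rmat (zm * zmk \<kappa>\<^sub>X) (hp * zmk \<kappa>\<^sub>X) (hp * zm) * (rm.M1 ?X' * rm.M2 ?Y')
        = rm.M2 ?Y' * (rm.M1 ?X' * rm.rmat (zm * zmk \<kappa>\<^sub>X) (hp * zmk \<kappa>\<^sub>X) (hp * zm))"
      by (rule rm.rtt_transpose_both'[OF rtt_mm])
    show "rm.M1 ?X' * (rm.rmat (zp * zpk \<kappa>\<^sub>X) (hp * zpk \<kappa>\<^sub>X) (hp * zp) * rm.M2 ?Y)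
        = rm.M2 ?Y * (rm.rmat (zp * zpk \<kappa>\<^sub>X) (hp * zpk \<kappa>\<^sub>X) (hp * zp) * rm.M1 ?X')"
      using rm.rtt_transpose_first[OF rtt_mp] by simp
    show "rm.M1 ?X * (rm.rmat (zp * zpk \<kappa>\<^sub>X) (hp * zpk \<kappa>\<^sub>X) (hp * zp) * rm.M2 ?Y')
        = rm.M2 ?Y' * (rm.rmat (zp * zpk \<kappa>\<^sub>X) (hp * zpk \<kappa>\<^sub>X) (hp * zp) * rm.M1 ?X)"
      using rm.rtt_transpose_first'[OF rtt_pm] by simp
  qed (rule G_reflection[OF central_scalars_lift2[OF central_scalars_yang] ty refl])
  \<comment> \<open>The dressed products agree with S(u) and S(v) on indices of \<open>idx N\<close>
    only, so the passage to S is made entrywise.\<close>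
  then show ?thesis
    using ij by (simp add: refl_left_def refl_right_def mid_left_def mid_right_def U V cong: sum.cong if_cong)
qed

end

section \<open>Algebras satisfying the reflection equation\<close>

lemma lift2_mult_nth:
  fixes F :: "'a::ring fps fps"
  shows "(lift2 sc P * F) $ r $ q = (\<Sum>m=0..r. \<Sum>n=0..q. sc (P $ m $ n) * F $ (r - m) $ (q - n))"
  by (simp add: fps_mult_nth fps_sum_nth)

lemma outer_const_nth: "(outer f * fps_const g) $ p $ q = f $ p * (g :: 'a::ring fps) $ q"
  "(fps_const g * outer f) $ p $ q = g $ q * (f :: 'a::ring fps) $ p"
  by simp_all

definition ord_ge :: "nat \<Rightarrow> complex fps fps \<Rightarrow> bool"
  where "ord_ge d P \<longleftrightarrow> (\<forall>m n. m + n < d \<longrightarrow> P $ m $ n = 0)"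

lemma ord_ge_mult: "ord_ge d P \<Longrightarrow> ord_ge e Q \<Longrightarrow> ord_ge (d + e) (P * Q)"
  unfolding ord_ge_def fps_mult_nth fps_sum_nth
proof (intro allI impI)
  fix m n
  assume P: "\<forall>m n. m + n < d \<longrightarrow> P $ m $ n = 0" and Q: "\<forall>m n. m + n < e \<longrightarrow> Q $ m $ n = 0"
    and mn: "m + n < d + e"
  have "P $ i $ j * Q $ (m - i) $ (n - j) = 0" if "i \<in> {0..m}" "j \<in> {0..n}" for i j
  proof (cases "i + j < d")
    case False
    with that mn have "(m - i) + (n - j) < e" by auto
    with Q show ?thesis by simp
  qed (use P in simp)
  then show "(\<Sum>i=0..m. \<Sum>j=0..n. P $ i $ j * Q $ (m - i) $ (n - j)) = 0"
    by (intro sum.neutral ballI)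
qed

lemma ord_ge_diff: "ord_ge d P \<Longrightarrow> ord_ge d Q \<Longrightarrow> ord_ge d (P - Q)"
  by (simp add: ord_ge_def)

lemma ord_ge_mono: "ord_ge d P \<Longrightarrow> e \<le> d \<Longrightarrow> ord_ge e P"
  by (simp add: ord_ge_def)

lemma ord_ge_k2: "ord_ge 0 (k2 c)"
  by (simp add: ord_ge_def)

lemma ord_ge_basic: "ord_ge 1 zm" "ord_ge 1 zp" "ord_ge 2 hp"
proof -
  have x: "ord_ge 1 fps_X" "ord_ge 1 (fps_const fps_X)"
    by (auto simp: ord_ge_def)
  show "ord_ge 1 zm" "ord_ge 1 zp" using x by (auto simp: zm_def zp_def ord_ge_def)
  show "ord_ge 2 hp" unfolding hp_def using ord_ge_mult[OF x] by (simp add: eval_nat_numeral)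
qed

lemma ord_ge_shift: "ord_ge 1 (zmk \<kappa>)" "ord_ge 1 (zpk \<kappa>)"
  unfolding zmk_def zpk_def using ord_ge_mult[OF ord_ge_k2[of \<kappa>] ord_ge_basic(3)]
  by (auto intro!: ord_ge_diff ord_ge_basic intro: ord_ge_mono)

definition lead :: "complex \<Rightarrow> complex fps fps"
  where "lead \<kappa> = zm * zmk \<kappa> * (zp * zpk \<kappa>)"

lemma ord_ge_lead: "ord_ge 4 (lead \<kappa>)"
  using ord_ge_mult[OF ord_ge_mult[OF ord_ge_basic(1) ord_ge_shift(1)] ord_ge_mult[OF ord_ge_basic(2) ord_ge_shift(2)]]
  by (simp add: lead_def eval_nat_numeral)

text \<open>Since the u-free part of \<open>lead \<kappa>\<close> is a single fourth power,
  multiplying by it shifts the exponent of 1/v by 4; all corrections lower the exponent of 1/u. This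
  permits an induction on that exponent.\<close>

lemma lead_0: "lead \<kappa> $ 0 $ n = (if n = 4 then 1 else 0)"
proof -
  have "lead \<kappa> $ 0 = fps_X ^ 4"
    by (simp add: lead_def zm_def zp_def zmk_def zpk_def hp_def power4_eq_xxxx mult.assoc)
  then show ?thesis by simp
qed

text \<open>Instantiated twice: by the operators of a representation and by pairs of such operators.
  Scalars commute with the generators only, since the ambient ring of endomorphisms also contains
  maps that are merely additive.\<close>

locale refl_alg =
  fixes sc :: "complex \<Rightarrow> 'a::{ring,monoid_mult}" and I :: "int set"
    and \<theta> :: "int \<Rightarrow> int \<Rightarrow> complex fps fps" and \<kappa> :: complex and s :: "int \<Rightarrow> int \<Rightarrow> 'a fps"
  assumes sc_add: "sc (a + b) = sc a + sc b"
    and sc_mult: "sc (a * b) = sc a * sc b"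
    and sc_one: "sc 1 = 1"
    and sc_comm: "i \<in> I \<Longrightarrow> j \<in> I \<Longrightarrow> sc a * s i j $ r = s i j $ r * sc a"
    and neg_I: "- i \<in> I \<longleftrightarrow> i \<in> I"
    and reflection: "i \<in> I \<Longrightarrow> j \<in> I \<Longrightarrow> k \<in> I \<Longrightarrow> l \<in> I \<Longrightarrow>
      reflection_lhs (lift2 sc) I \<theta> \<kappa> (\<lambda>i j. outer (s i j)) (\<lambda>i j. fps_const (s i j)) i j k l
      = reflection_rhs (lift2 sc) I \<theta> \<kappa> (\<lambda>i j. outer (s i j)) (\<lambda>i j. fps_const (s i j)) i j k l"
begin

sublocale vs: vector_space "\<lambda>c x. sc c * x"
  by standard (simp_all add: sc_add sc_mult sc_one distrib_left distrib_right mult.assoc)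

definition low :: "nat \<Rightarrow> 'a set"
  where "low d = vs.span {s i j $ p * s k l $ q | i j k l p q. i \<in> I \<and> j \<in> I \<and> k \<in> I \<and> l \<in> I \<and> p + q < d}"

lemma low_mono: "d \<le> e \<Longrightarrow> low d \<subseteq> low e"
  unfolding low_def by (intro vs.span_mono) (blast intro: less_le_trans)

lemma low_base:
  "i \<in> I \<Longrightarrow> j \<in> I \<Longrightarrow> k \<in> I \<Longrightarrow> l \<in> I \<Longrightarrow> p + q < d \<Longrightarrow> s i j $ p * s k l $ q \<in> low d"
  unfolding low_def by (intro vs.span_base) blast

text \<open>The bound \<open>Suc (p + q) - d\<close> expresses degree at most p + q - d; for p + q <
  d the truncated difference is 0 and \<open>low 0\<close> is the zero space. A scalar series of
  order e thus improves \<open>d\<close> by e, which is \<open>bil_mult\<close>.\<close>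

definition bil :: "nat \<Rightarrow> 'a fps fps set"
  where "bil d = {F. \<forall>p q. F $ p $ q \<in> low (Suc (p + q) - d)}"

lemma bil_add: "F \<in> bil d \<Longrightarrow> G \<in> bil d \<Longrightarrow> F + G \<in> bil d"
  by (simp add: bil_def low_def vs.span_add)

lemma bil_diff: "F \<in> bil d \<Longrightarrow> G \<in> bil d \<Longrightarrow> F - G \<in> bil d"
  by (simp add: bil_def low_def vs.span_diff)

lemma bil_zero: "0 \<in> bil d"
  by (simp add: bil_def low_def vs.span_zero)

lemma bil_if: "(b \<Longrightarrow> F \<in> bil d) \<Longrightarrow> (if b then F else 0) \<in> bil d"
  by (simp add: bil_zero)

lemma bil_sum: "(\<And>a. a \<in> A \<Longrightarrow> f a \<in> bil d) \<Longrightarrow> sum f A \<in> bil d"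
  by (induct A rule: infinite_finite_induct) (auto simp: bil_zero bil_add)

lemma bil_mult:
  assumes "ord_ge e P" "F \<in> bil d" "d' \<le> d + e"
  shows "lift2 sc P * F \<in> bil d'"
  unfolding bil_def
proof (intro CollectI allI)
  fix p q
  have "sc (P $ m $ n) * F $ (p - m) $ (q - n) \<in> low (Suc (p + q) - d')" if "m \<in> {0..p}" "n \<in> {0..q}" for m n
  proof (cases "m + n < e")
    case True
    then have "P $ m $ n = 0" using assms(1) by (simp add: ord_ge_def)
    then show ?thesis by (simp add: low_def vs.span_zero)
  next
    case False
    then have "Suc ((p - m) + (q - n)) - d \<le> Suc (p + q) - d'" using that assms(3) by auto
    moreover have "F $ (p - m) $ (q - n) \<in> low (Suc ((p - m) + (q - n)) - d)"
      using assms(2) by (simp add: bil_def)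
    ultimately have "F $ (p - m) $ (q - n) \<in> low (Suc (p + q) - d')" using low_mono by blast
    then show ?thesis unfolding low_def by (rule vs.span_scale)
  qed
  then show "(lift2 sc P * F) $ p $ q \<in> low (Suc (p + q) - d')"
    unfolding lift2_mult_nth low_def by (intro vs.span_sum)
qed

lemma bil_basic:
  assumes "i \<in> I" "j \<in> I" "k \<in> I" "l \<in> I"
  shows "outer (s i j) * fps_const (s k l) \<in> bil 0" "fps_const (s k l) * outer (s i j) \<in> bil 0"
  unfolding bil_def using assms by (auto simp: outer_const_nth intro!: low_base)

lemma ord_ge_R:
  "ord_ge 2 (zm * zmk \<kappa>)" "ord_ge 3 (hp * zmk \<kappa>)" "ord_ge 3 (hp * zm)"
  "ord_ge 2 (zp * zpk \<kappa>)" "ord_ge 3 (hp * zpk \<kappa>)" "ord_ge 3 (hp * zp)"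
  using ord_ge_mult[OF ord_ge_basic(1) ord_ge_shift(1)] ord_ge_mult[OF ord_ge_basic(3) ord_ge_shift(1)]
    ord_ge_mult[OF ord_ge_basic(3) ord_ge_basic(1)] ord_ge_mult[OF ord_ge_basic(2) ord_ge_shift(2)]
    ord_ge_mult[OF ord_ge_basic(3) ord_ge_shift(2)] ord_ge_mult[OF ord_ge_basic(3) ord_ge_basic(2)]
  by (simp_all add: numeral_2_eq_2 numeral_3_eq_3)

lemma ord_ge_0: "ord_ge 0 P"
  by (simp add: ord_ge_def)

lemma lift2_lead: "lift2 sc (lead \<kappa>) * F = lift2 sc (zm * zmk \<kappa>) * (lift2 sc (zp * zpk \<kappa>) * F)"
proof -
  have "additive sc" by (simp add: additive_def sc_add)
  then have "sc (sum f A) = (\<Sum>a\<in>A. sc (f a))" for f :: "nat \<Rightarrow> complex" and A by (rule additive.sum)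
  then have "lift2 sc (P * Q) = lift2 sc P * lift2 sc Q" for P Q
    by (simp add: fps_eq_iff fps_mult_nth fps_sum_nth sc_mult)
  then show ?thesis by (simp add: lead_def mult.assoc)
qed

text \<open>In each cleared R-matrix the coefficient of I has order 2 and those of P and Q have
  order 3. Up to order 5 only the product of the two coefficients of I survives, on the left with U
  V and on the right with V U.\<close>

lemma reflection_lead:
  assumes ij: "i \<in> I" "j \<in> I" "k \<in> I" "l \<in> I"
  shows "lift2 sc (lead \<kappa>) * (outer (s i j) * fps_const (s k l) - fps_const (s k l) * outer (s i j)) \<in> bil 5"
proof -
  let ?A = "lift2 sc (zm * zmk \<kappa>)" and ?A' = "lift2 sc (zp * zpk \<kappa>)"
  let ?U = "\<lambda>i j. outer (s i j)" and ?V = "\<lambda>i j. fps_const (s i j)"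
  define ml where "ml = mid_left (lift2 sc) I \<theta> (zp * zpk \<kappa>) (hp * zpk \<kappa>) (hp * zp) ?U ?V"
  define mr where "mr = mid_right (lift2 sc) I \<theta> (zp * zpk \<kappa>) (hp * zpk \<kappa>) (hp * zp) ?U ?V"
  have ml3: "ml i j k l - ?A' * (?U i j * ?V k l) \<in> bil 3" "ml i j k l \<in> bil 2"
    and mr3: "mr i j k l - ?A' * (?V k l * ?U i j) \<in> bil 3" "mr i j k l \<in> bil 2"
    if "i \<in> I" "j \<in> I" "k \<in> I" "l \<in> I" for i j k l
  proof -
    have l: "lift2 sc (hp * zpk \<kappa>) * (if k = j then \<Sum>m\<in>I. ?U i m * ?V m l else 0) \<in> bil d"
      "lift2 sc (hp * zp) * (lift2 sc (\<theta> (- k) j) * (?U i (- k) * ?V (- j) l)) \<in> bil d"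
      "lift2 sc (hp * zpk \<kappa>) * (if i = l then \<Sum>m\<in>I. ?V k m * ?U m j else 0) \<in> bil d"
      "lift2 sc (hp * zp) * (lift2 sc (\<theta> i (- l)) * (?V k (- i) * ?U (- l) j)) \<in> bil d" if "d \<le> 3" for d
      using \<open>i \<in> I\<close> \<open>j \<in> I\<close> \<open>k \<in> I\<close> \<open>l \<in> I\<close> that
      by (intro bil_mult[OF ord_ge_R(5), of _ 0] bil_mult[OF ord_ge_R(6), of _ 0]
            bil_mult[OF ord_ge_0, of _ 0] bil_if bil_sum bil_basic; simp add: neg_I)+
    have b: "?A' * (?U i j * ?V k l) \<in> bil 2" "?A' * (?V k l * ?U i j) \<in> bil 2"
      using that by (intro bil_mult[OF ord_ge_R(4), of _ 0] bil_basic; simp)+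
    show "ml i j k l - ?A' * (?U i j * ?V k l) \<in> bil 3"
      using bil_diff[OF l(2,1), of 3] by (simp add: ml_def mid_left_def)
    show "mr i j k l - ?A' * (?V k l * ?U i j) \<in> bil 3"
      using bil_diff[OF l(4,3), of 3] by (simp add: mr_def mid_right_def)
    show "ml i j k l \<in> bil 2" "mr i j k l \<in> bil 2"
      unfolding ml_def mr_def mid_left_def mid_right_def using b l[of 2] by (intro bil_add bil_diff; simp)+
  qed
  have L: "refl_left (lift2 sc) I \<theta> (zm * zmk \<kappa>) (hp * zmk \<kappa>) (hp * zm) ml i j k l - ?A * ml i j k l \<in> bil 5"
  proof -
    have "lift2 sc (hp * zmk \<kappa>) * ml k j i l \<in> bil 5"
      "(if k = - i then lift2 sc (hp * zm) * (\<Sum>m\<in>I. lift2 sc (\<theta> i m) * ml m j (- m) l) else 0) \<in> bil 5"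
      using ij by (intro bil_mult[OF ord_ge_R(2), of _ 2] bil_mult[OF ord_ge_R(3), of _ 2]
            bil_mult[OF ord_ge_0, of _ 2] bil_if bil_sum ml3; simp add: neg_I)+
    from bil_diff[OF this(2,1)] show ?thesis by (simp add: refl_left_def)
  qed
  have R: "refl_right (lift2 sc) I \<theta> (zm * zmk \<kappa>) (hp * zmk \<kappa>) (hp * zm) mr i j k l - ?A * mr i j k l \<in> bil 5"
  proof -
    have "lift2 sc (hp * zmk \<kappa>) * mr i l k j \<in> bil 5"
      "(if l = - j then lift2 sc (hp * zm) * (\<Sum>m\<in>I. lift2 sc (\<theta> m j) * mr i m k (- m)) else 0) \<in> bil 5"
      using ij by (intro bil_mult[OF ord_ge_R(2), of _ 2] bil_mult[OF ord_ge_R(3), of _ 2]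
            bil_mult[OF ord_ge_0, of _ 2] bil_if bil_sum mr3; simp add: neg_I)+
    from bil_diff[OF this(2,1)] show ?thesis by (simp add: refl_right_def)
  qed
  have L': "?A * (ml i j k l - ?A' * (?U i j * ?V k l)) \<in> bil 5"
    and R': "?A * (mr i j k l - ?A' * (?V k l * ?U i j)) \<in> bil 5"
    using ij by (intro bil_mult[OF ord_ge_R(1), of _ 3] ml3 mr3; simp)+
  have "refl_left (lift2 sc) I \<theta> (zm * zmk \<kappa>) (hp * zmk \<kappa>) (hp * zm) ml i j k l
      = refl_right (lift2 sc) I \<theta> (zm * zmk \<kappa>) (hp * zmk \<kappa>) (hp * zm) mr i j k l"
    unfolding ml_def mr_def using ij by (rule reflection)
  then have "lift2 sc (lead \<kappa>) * (?U i j * ?V k l - ?V k l * ?U i j)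
     = (refl_right (lift2 sc) I \<theta> (zm * zmk \<kappa>) (hp * zmk \<kappa>) (hp * zm) mr i j k l - ?A * mr i j k l)
     + ?A * (mr i j k l - ?A' * (?V k l * ?U i j))
     - (refl_left (lift2 sc) I \<theta> (zm * zmk \<kappa>) (hp * zmk \<kappa>) (hp * zm) ml i j k l - ?A * ml i j k l)
     - ?A * (ml i j k l - ?A' * (?U i j * ?V k l))"
    unfolding lift2_lead by (simp add: right_diff_distrib)
  also have "\<dots> \<in> bil 5"
    by (intro bil_add bil_diff L R L' R')
  finally show ?thesis .
qed

text \<open>Induction on r: in \<open>lead \<kappa>\<close> times the commutator, the coefficient at
  (r, q + 4) is the commutator for (r, q) plus commutators with smaller r whose total degree is at
  most r + q.\<close>

lemma commutator_low:
  assumes "i \<in> I" "j \<in> I" "k \<in> I" "l \<in> I"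
  shows "s i j $ r * s k l $ q - s k l $ q * s i j $ r \<in> low (r + q)"
proof (induction r arbitrary: q rule: less_induct)
  case (less r)
  define C where "C = outer (s i j) * fps_const (s k l) - fps_const (s k l) * outer (s i j)"
  have C: "C $ p $ q = s i j $ p * s k l $ q - s k l $ q * s i j $ p" for p q
    by (simp add: C_def outer_const_nth)
  have "sc 0 = 0" using sc_add[of 0 0] by simp
  \<comment> \<open>The 4 compensates the order of \<open>lead \<kappa>\<close>;
    \<open>bil 5\<close> then gives the bound Suc (r + q + 4) - 5 = r + q, one better than the
    trivial degree.\<close>
  have "(lift2 sc (lead \<kappa>) * C) $ r $ (q + 4) \<in> low (Suc (r + (q + 4)) - 5)"
    using reflection_lead[OF assms] unfolding bil_def C_def by blast
  then have "(lift2 sc (lead \<kappa>) * C) $ r $ (q + 4) \<in> low (r + q)" by simp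
  moreover have "(lift2 sc (lead \<kappa>) * C) $ r $ (q + 4) - C $ r $ q \<in> low (r + q)"
  proof -
    have "(\<Sum>n=0..q + 4. sc (lead \<kappa> $ 0 $ n) * C $ r $ (q + 4 - n)) = (\<Sum>n=0..q + 4. if n = 4 then C $ r $ q else 0)"
      by (intro sum.cong refl) (simp add: lead_0 sc_one \<open>sc 0 = 0\<close>)
    then have "(lift2 sc (lead \<kappa>) * C) $ r $ (q + 4) - C $ r $ q
        = (\<Sum>m\<in>{Suc 0..r}. \<Sum>n=0..q + 4. sc (lead \<kappa> $ m $ n) * C $ (r - m) $ (q + 4 - n))"
      unfolding lift2_mult_nth by (subst sum.atLeast_Suc_atMost) simp_all
    also have "\<dots> \<in> low (r + q)"
      unfolding low_def
    proof (intro vs.span_sum, fold low_def)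
      fix m n assume mn: "m \<in> {Suc 0..r}" "n \<in> {0..q + 4}"
      show "sc (lead \<kappa> $ m $ n) * C $ (r - m) $ (q + 4 - n) \<in> low (r + q)"
      proof (cases "m + n < 4")
        case True
        then have "lead \<kappa> $ m $ n = 0" using ord_ge_lead by (simp add: ord_ge_def)
        then show ?thesis by (simp add: \<open>sc 0 = 0\<close> low_def vs.span_zero)
      next
        case False
        then have "(r - m) + (q + 4 - n) \<le> r + q" using mn by auto
        moreover have "C $ (r - m) $ (q + 4 - n) \<in> low ((r - m) + (q + 4 - n))"
          unfolding C using mn by (intro less.IH) auto
        ultimately have "C $ (r - m) $ (q + 4 - n) \<in> low (r + q)" using low_mono by blast
        then show ?thesis unfolding low_def by (rule vs.span_scale)
      qed
    qed
    finally show ?thesis .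
  qed
  ultimately have "C $ r $ q \<in> low (r + q)"
    unfolding low_def using vs.span_diff by fastforce
  then show ?case by (simp add: C)
qed

end

section \<open>Reordering of words\<close>

type_synonym letter = "int \<times> int \<times> nat"

definition wdeg :: "letter list \<Rightarrow> nat"
  where "wdeg w = sum_list (map (\<lambda>(i, j, r). r) w)"

lemma wdeg_simps [simp]: "wdeg [] = 0" "wdeg ((i, j, r) # w) = r + wdeg w" "wdeg (v @ w) = wdeg v + wdeg w"
  by (simp_all add: wdeg_def)

context refl_alg
begin

definition letter_set :: "letter set"
  where "letter_set = {(i, j, r). i \<in> I \<and> j \<in> I}"

definition sl :: "letter \<Rightarrow> 'a"
  where "sl = (\<lambda>(i, j, r). s i j $ r)"

definition ev :: "letter list \<Rightarrow> 'a"
  where "ev w = prod_list (map sl w)"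

definition wspan :: "nat \<Rightarrow> 'a set"
  where "wspan d = vs.span {ev w | w. w \<in> lists letter_set \<and> wdeg w < d}"

lemma ev_simps [simp]: "ev [] = 1" "ev (a # w) = sl a * ev w" "ev (v @ w) = ev v * ev w"
  by (simp_all add: ev_def)

lemma sc_comm_sl: "a \<in> letter_set \<Longrightarrow> sc c * sl a = sl a * sc c"
  by (auto simp: letter_set_def sl_def sc_comm)

lemma sc_comm_ev: "w \<in> lists letter_set \<Longrightarrow> sc c * ev w = ev w * sc c"
proof (induct w)
  case Nil
  show ?case by simp
next
  case (Cons a w)
  then have a: "a \<in> letter_set" and w: "sc c * ev w = ev w * sc c" by auto
  have "sc c * (sl a * ev w) = sl a * (sc c * ev w)"
    using sc_comm_sl[OF a, of c] by (simp flip: mult.assoc)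
  then show ?case using w by (simp add: mult.assoc)
qed

lemma wspan_base: "w \<in> lists letter_set \<Longrightarrow> wdeg w < d \<Longrightarrow> ev w \<in> wspan d"
  unfolding wspan_def by (rule vs.span_base) auto

lemma sandwich_low:
  assumes "x \<in> low e" "u \<in> lists letter_set" "v \<in> lists letter_set" "wdeg u + e + wdeg v \<le> d"
  shows "ev u * x * ev v \<in> wspan d"
  using assms(1) unfolding low_def
proof (induct rule: vs.span_induct_alt)
  case base
  show ?case by (simp add: wspan_def vs.span_zero)
next
  case (step c x y)
  then obtain i j k l p q where x: "x = s i j $ p * s k l $ q" and ij: "i \<in> I" "j \<in> I" "k \<in> I" "l \<in> I" "p + q < e"
    by blast
  let ?w = "u @ [(i, j, p), (k, l, q)] @ v"
  have "ev ?w \<in> wspan d"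
    using assms ij by (intro wspan_base) (auto simp: letter_set_def)
  moreover have "ev ?w = ev u * x * ev v"
    by (simp add: x sl_def mult.assoc)
  ultimately have "sc c * (ev u * x * ev v) \<in> wspan d"
    unfolding wspan_def by (simp add: vs.span_scale)
  moreover have "ev u * (sc c * x) * ev v = sc c * (ev u * x * ev v)"
    using sc_comm_ev[OF assms(2), of c] by (simp flip: mult.assoc)
  ultimately show ?case
    using step(2) unfolding wspan_def by (simp add: distrib_left distrib_right vs.span_add)
qed

lemma swap_letters:
  assumes "u \<in> lists letter_set" "v \<in> lists letter_set" "a \<in> letter_set" "b \<in> letter_set"
    and "wdeg (u @ [a, b] @ v) \<le> d"
  shows "ev (u @ [a, b] @ v) - ev (u @ [b, a] @ v) \<in> wspan d"
proof -
  obtain i j r k l q where ab: "a = (i, j, r)" "b = (k, l, q)" by (metis prod_cases3)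
  have "ev u * (sl a * sl b - sl b * sl a) * ev v \<in> wspan d"
    using assms ab commutator_low[of i j k l r q]
    by (intro sandwich_low[where e = "r + q"]) (auto simp: sl_def letter_set_def)
  then show ?thesis by (simp add: algebra_simps)
qed

lemma move_to_front:
  assumes "u \<in> lists letter_set" "v \<in> lists letter_set" "a \<in> letter_set" "wdeg (u @ a # v) \<le> d"
  shows "ev (u @ a # v) - ev (a # u @ v) \<in> wspan d"
  using assms
proof (induct u arbitrary: v rule: rev_induct)
  case Nil
  show ?case by (simp add: wspan_def vs.span_zero)
next
  case (snoc b u)
  obtain k l q where b: "b = (k, l, q)" by (metis prod_cases3)
  have "ev (u @ [b, a] @ v) - ev (u @ [a, b] @ v) \<in> wspan d"
    using snoc(2-) by (intro swap_letters) auto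
  moreover have "ev (u @ a # (b # v)) - ev (a # u @ (b # v)) \<in> wspan d"
    using snoc(2-) by (intro snoc(1)) (auto simp: b, cases a, auto)
  ultimately have "(ev (u @ [b, a] @ v) - ev (u @ [a, b] @ v)) + (ev (u @ a # (b # v)) - ev (a # u @ (b # v))) \<in> wspan d"
    unfolding wspan_def by (rule vs.span_add)
  then show ?case by (simp add: mult.assoc)
qed

lemma mult_wspan:
  assumes "x \<in> wspan d" "a \<in> letter_set" "wdeg [a] + d \<le> e"
  shows "sl a * x \<in> wspan e"
  using assms(1) unfolding wspan_def
proof (induct rule: vs.span_induct_alt)
  case base
  show ?case by (simp add: vs.span_zero)
next
  case (step c x y)
  then obtain w where w: "x = ev w" "w \<in> lists letter_set" "wdeg w < d" by blast
  obtain i j r where a: "a = (i, j, r)" by (metis prod_cases3)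
  have "ev (a # w) \<in> wspan e" using w assms(2,3) a by (intro wspan_base) auto
  then have "sc c * (sl a * x) \<in> wspan e" unfolding wspan_def w by (simp add: vs.span_scale)
  moreover have "sl a * (sc c * x) = sc c * (sl a * x)"
    using sc_comm_sl[OF assms(2), of c] by (simp flip: mult.assoc)
  ultimately show ?case using step(2) unfolding wspan_def by (simp add: distrib_left vs.span_add)
qed

text \<open>The first letter of v is moved to the front of w by adjacent swaps, each costing terms
  of lower degree, and the remaining letters are treated recursively.\<close>

lemma reorder:
  assumes "mset v = mset w" "w \<in> lists letter_set"
  shows "ev w - ev v \<in> wspan (wdeg w)"
  using assms
proof (induct v arbitrary: w)
  case Nil
  then show ?case by (simp add: wspan_def vs.span_zero)
next
  case (Cons a v)
  then obtain w1 w2 where w: "w = w1 @ a # w2"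
    by (metis list.set_intros(1) mset_eq_setD split_list)
  obtain i j r where a: "a = (i, j, r)" by (metis prod_cases3)
  have L: "w1 \<in> lists letter_set" "w2 \<in> lists letter_set" "a \<in> letter_set" using Cons(3) w by auto
  have "ev (w1 @ w2) - ev v \<in> wspan (wdeg (w1 @ w2))"
    using Cons(2,3) w by (intro Cons(1)) auto
  then have "sl a * (ev (w1 @ w2) - ev v) \<in> wspan (wdeg w)"
    by (rule mult_wspan) (use w a L in auto)
  moreover have "ev w - ev (a # w1 @ w2) \<in> wspan (wdeg w)"
    unfolding w using L by (intro move_to_front) auto
  ultimately have "(ev w - ev (a # w1 @ w2)) + sl a * (ev (w1 @ w2) - ev v) \<in> wspan (wdeg w)"
    unfolding wspan_def by (intro vs.span_add)
  then show ?case by (simp add: algebra_simps)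
qed

definition diag :: "letter set" where "diag = {(i, j, r). i \<in> I \<and> j = i}"
definition lowering :: "letter set" where "lowering = {(i, j, r). i \<in> I \<and> j \<in> I \<and> j < i}"
definition raising :: "letter set" where "raising = {(i, j, r). i \<in> I \<and> j \<in> I \<and> i < j}"

text \<open>Reversing words while exchanging s_ij with s_ji fixes each element of the first family
  and interchanges the other two; \<open>diag_commute\<close> relies on this.\<close>

definition pieces :: "'a set"
  where "pieces = {ev w + ev (rev w) | w. w \<in> lists diag}
    \<union> {sl a * ev w | a w. a \<in> lowering \<and> w \<in> lists letter_set}
    \<union> {ev w * sl a | a w. a \<in> raising \<and> w \<in> lists letter_set}"

lemma piecesI:
  "w \<in> lists diag \<Longrightarrow> ev w + ev (rev w) \<in> pieces"
  "a \<in> lowering \<Longrightarrow> w \<in> lists letter_set \<Longrightarrow> sl a * ev w \<in> pieces"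
  "a \<in> raising \<Longrightarrow> w \<in> lists letter_set \<Longrightarrow> ev w * sl a \<in> pieces"
  unfolding pieces_def by blast+

lemma letter_cases: "a \<in> letter_set \<Longrightarrow> a \<in> diag \<or> a \<in> lowering \<or> a \<in> raising"
  by (cases a) (auto simp: letter_set_def diag_def lowering_def raising_def)

theorem triangular_span: "w \<in> lists letter_set \<Longrightarrow> ev w \<in> vs.span pieces"
proof (induction "wdeg w" arbitrary: w rule: less_induct)
  case less
  have sub: "wspan (wdeg w) \<subseteq> vs.span pieces"
    unfolding wspan_def using less.hyps by (intro vs.span_minimal) auto
  consider (l) a where "a \<in> set w" "a \<in> lowering" | (r) a where "a \<in> set w" "a \<in> raising" | (d) "w \<in> lists diag"
    using less.prems letter_cases unfolding lists_eq_set mem_Collect_eq subset_iff by blast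
  then show ?case
  proof cases
    case l
    then obtain u v where w: "w = u @ a # v" by (meson split_list)
    have "ev w - ev (a # u @ v) \<in> vs.span pieces"
      using reorder[of "a # u @ v" w] less.prems w sub by auto
    moreover have "ev (a # u @ v) \<in> vs.span pieces"
      using l less.prems w piecesI(2)[of a "u @ v"] by (intro vs.span_base) auto
    ultimately show ?thesis using vs.span_add by fastforce
  next
    case r
    then obtain u v where w: "w = u @ a # v" by (meson split_list)
    have "ev w - ev ((u @ v) @ [a]) \<in> vs.span pieces"
      using reorder[of "(u @ v) @ [a]" w] less.prems w sub by auto
    moreover have "ev ((u @ v) @ [a]) \<in> vs.span pieces"
      using r less.prems w piecesI(3)[of a "u @ v"] by (intro vs.span_base) (auto simp: mult.assoc)
    ultimately show ?thesis using vs.span_add by fastforce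
  next
    case d
    have "ev w - ev (rev w) \<in> vs.span pieces"
      using reorder[of "rev w" w] less.prems sub by auto
    moreover have "ev w + ev (rev w) \<in> vs.span pieces"
      using d by (intro vs.span_base piecesI)
    \<comment> \<open>A diagonal word is half the sum of its antisymmetric part, which has lower
      degree, and its symmetric part, which is a piece.\<close>
    ultimately have "sc (1 / 2) * ((ev w - ev (rev w)) + (ev w + ev (rev w))) \<in> vs.span pieces"
      by (rule vs.span_scale[OF vs.span_add])
    also have "(ev w - ev (rev w)) + (ev w + ev (rev w)) = sc 2 * ev w"
      using sc_add[of 1 1] by (simp add: sc_one distrib_right)
    finally show ?thesis by (simp add: sc_one flip: mult.assoc sc_mult)
  qed
qed

end

section \<open>The transposition trick\<close>

text \<open>Pairs of ring elements, multiplied in opposite orders. The pairs of \<open>s\<^sub>i\<^sub>j(u)\<close> and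
  \<open>s\<^sub>j\<^sub>i(u)\<close> again satisfy the reflection equation, which is the shadow of an anti-automorphism.\<close>

datatype 'a dbl = Dbl (dfst: 'a) (dsnd: 'a)

instantiation dbl :: ("{ring,monoid_mult}") "{ring,monoid_mult}"
begin
definition zero_dbl :: "'a dbl" where "0 = Dbl 0 0"
definition one_dbl :: "'a dbl" where "1 = Dbl 1 1"
definition plus_dbl :: "'a dbl \<Rightarrow> 'a dbl \<Rightarrow> 'a dbl" where "x + y = Dbl (dfst x + dfst y) (dsnd x + dsnd y)"
definition minus_dbl :: "'a dbl \<Rightarrow> 'a dbl \<Rightarrow> 'a dbl" where "x - y = Dbl (dfst x - dfst y) (dsnd x - dsnd y)"
definition uminus_dbl :: "'a dbl \<Rightarrow> 'a dbl" where "- x = Dbl (- dfst x) (- dsnd x)"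
definition times_dbl :: "'a dbl \<Rightarrow> 'a dbl \<Rightarrow> 'a dbl" where "x * y = Dbl (dfst x * dfst y) (dsnd y * dsnd x)"
instance
  by standard
     (simp_all add: zero_dbl_def one_dbl_def plus_dbl_def minus_dbl_def uminus_dbl_def times_dbl_def algebra_simps)
end

lemma dbl_simps [simp]:
  "dfst 0 = 0" "dsnd 0 = 0" "dfst 1 = 1" "dsnd 1 = 1"
  "dfst (x + y) = dfst x + dfst y" "dsnd (x + y) = dsnd x + dsnd y"
  "dfst (x - y) = dfst x - dfst y" "dsnd (x - y) = dsnd x - dsnd y"
  "dfst (x * y) = dfst x * dfst y" "dsnd (x * y) = dsnd y * dsnd x"
  by (simp_all add: zero_dbl_def one_dbl_def plus_dbl_def minus_dbl_def times_dbl_def)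

text \<open>The order-reversing counterpart of \<open>partial_hom\<close>. Scalars still multiply
  from the left after the map, so they have to be central on \<open>D\<close> in effect.\<close>

locale partial_antihom =
  fixes D :: "'a::ring set" and h :: "'a \<Rightarrow> 'b::ring" and \<phi> :: "'k \<Rightarrow> 'a" and \<psi> :: "'k \<Rightarrow> 'b"
  assumes zero_in: "0 \<in> D"
    and add_in: "x \<in> D \<Longrightarrow> y \<in> D \<Longrightarrow> x + y \<in> D"
    and diff_in: "x \<in> D \<Longrightarrow> y \<in> D \<Longrightarrow> x - y \<in> D"
    and mult_in: "x \<in> D \<Longrightarrow> y \<in> D \<Longrightarrow> x * y \<in> D"
    and scalar_in: "x \<in> D \<Longrightarrow> \<phi> p * x \<in> D"
    and map_add: "x \<in> D \<Longrightarrow> y \<in> D \<Longrightarrow> h (x + y) = h x + h y"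
    and map_mult: "x \<in> D \<Longrightarrow> y \<in> D \<Longrightarrow> h (x * y) = h y * h x"
    and map_scalar: "x \<in> D \<Longrightarrow> h (\<phi> p * x) = \<psi> p * h x"
begin

lemma map_zero: "h 0 = 0"
  using map_add[OF zero_in zero_in] by simp

lemma map_diff: "x \<in> D \<Longrightarrow> y \<in> D \<Longrightarrow> h (x - y) = h x - h y"
  using map_add[OF diff_in[of x y], of y] by (simp add: algebra_simps)

lemma sum_in: "(\<And>a. a \<in> A \<Longrightarrow> f a \<in> D) \<Longrightarrow> sum f A \<in> D"
  by (induct A rule: infinite_finite_induct) (auto simp: zero_in add_in)

lemma map_sum: "(\<And>a. a \<in> A \<Longrightarrow> f a \<in> D) \<Longrightarrow> h (sum f A) = (\<Sum>a\<in>A. h (f a))"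
  by (induct A rule: infinite_finite_induct) (auto simp: map_zero map_add sum_in)

lemma if_in: "(b \<Longrightarrow> x \<in> D) \<Longrightarrow> (if b then x else 0) \<in> D"
  by (simp add: zero_in)

lemma map_if: "h (if b then x else 0) = (if b then h x else 0)"
  by (simp add: map_zero)

context
  fixes I :: "int set" and \<theta> :: "int \<Rightarrow> int \<Rightarrow> 'k" and U V :: "int \<Rightarrow> int \<Rightarrow> 'a"
  assumes neg: "\<And>i. - i \<in> I \<longleftrightarrow> i \<in> I" and sym: "\<And>i j. \<theta> i j = \<theta> j i"
    and U: "\<And>i j. i \<in> I \<Longrightarrow> j \<in> I \<Longrightarrow> U i j \<in> D"
    and V: "\<And>i j. i \<in> I \<Longrightarrow> j \<in> I \<Longrightarrow> V i j \<in> D"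
begin

text \<open>P and, by the symmetry of \<open>\<theta>\<close>, also Q are symmetric matrices. An
  antihomomorphism followed by transposing indices therefore turns U_1 R V_2 into V_2 R U_1, read at
  (j, i, l, k); the lemmas below extend this to the whole reflection equation, whose sides change
  places.\<close>

lemma anti_mid_left:
  assumes "i \<in> I" "j \<in> I" "k \<in> I" "l \<in> I"
  shows "mid_left \<phi> I \<theta> a b c U V i j k l \<in> D"
    and "h (mid_left \<phi> I \<theta> a b c U V i j k l)
      = mid_right \<psi> I \<theta> a b c (\<lambda>i j. h (U j i)) (\<lambda>i j. h (V j i)) j i l k"
  using assms sym[of "- k" j] unfolding mid_left_def mid_right_def
  by (simp_all add: neg U V zero_in add_in diff_in mult_in scalar_in sum_in map_zero map_add map_diff
      map_mult map_scalar map_sum if_in map_if)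

lemma anti_mid_right:
  assumes "i \<in> I" "j \<in> I" "k \<in> I" "l \<in> I"
  shows "mid_right \<phi> I \<theta> a b c U V i j k l \<in> D"
    and "h (mid_right \<phi> I \<theta> a b c U V i j k l)
      = mid_left \<psi> I \<theta> a b c (\<lambda>i j. h (U j i)) (\<lambda>i j. h (V j i)) j i l k"
  using assms sym[of i "- l"] unfolding mid_left_def mid_right_def
  by (simp_all add: neg U V zero_in add_in diff_in mult_in scalar_in sum_in map_zero map_add map_diff
      map_mult map_scalar map_sum if_in map_if)

lemma anti_refl_left:
  assumes "i \<in> I" "j \<in> I" "k \<in> I" "l \<in> I"
  shows "h (refl_left \<phi> I \<theta> a b c (mid_left \<phi> I \<theta> a' b' c' U V) i j k l)
      = refl_right \<psi> I \<theta> a b c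
          (mid_right \<psi> I \<theta> a' b' c' (\<lambda>i j. h (U j i)) (\<lambda>i j. h (V j i))) j i l k"
  using assms unfolding refl_left_def refl_right_def
  by (simp add: neg anti_mid_left zero_in add_in diff_in mult_in scalar_in sum_in map_zero map_add
      map_diff map_mult map_scalar map_sum if_in map_if sym[of i])

lemma anti_refl_right:
  assumes "i \<in> I" "j \<in> I" "k \<in> I" "l \<in> I"
  shows "h (refl_right \<phi> I \<theta> a b c (mid_right \<phi> I \<theta> a' b' c' U V) i j k l)
      = refl_left \<psi> I \<theta> a b c
          (mid_left \<psi> I \<theta> a' b' c' (\<lambda>i j. h (U j i)) (\<lambda>i j. h (V j i))) j i l k"
  using assms unfolding refl_left_def refl_right_def
  by (simp add: neg anti_mid_right zero_in add_in diff_in mult_in scalar_in sum_in map_zero map_add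
      map_diff map_mult map_scalar map_sum if_in map_if sym[of j])

end

end

lemma partial_antihom_fps_map:
  fixes \<phi> :: "'k::comm_ring_1 \<Rightarrow> 'a::ring" and \<psi> :: "'k \<Rightarrow> 'b::ring"
  assumes "partial_antihom D h \<phi> \<psi>"
  shows "partial_antihom (fps_set D) (fps_map h) (fps_map \<phi>) (fps_map \<psi>)"
proof -
  interpret partial_antihom D h \<phi> \<psi> by fact
  have rev: "(\<Sum>i=0..n. f i (n - i)) = (\<Sum>i=0..n. f (n - i) i)" for f :: "nat \<Rightarrow> nat \<Rightarrow> 'b" and n
    by (rule sum.reindex_bij_witness[of _ "\<lambda>i. n - i" "\<lambda>i. n - i"]) auto
  show ?thesis
  proof
    fix x y :: "'a fps" assume xy: "x \<in> fps_set D" "y \<in> fps_set D"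
    have "h (\<Sum>i=0..n. x $ i * y $ (n - i)) = (\<Sum>i=0..n. h (y $ (n - i)) * h (x $ i))" for n
      using xy by (subst map_sum) (auto simp: fps_set_def mult_in map_mult)
    then show "fps_map h (x * y) = fps_map h y * fps_map h x"
      by (simp add: fps_eq_iff fps_mult_nth rev[of "\<lambda>i j. h (y $ j) * h (x $ i)"])
  qed (auto simp: fps_set_def fps_eq_iff fps_mult_nth zero_in add_in diff_in mult_in scalar_in
          map_add map_scalar intro!: sum_in trans[OF map_sum] sum.cong)
qed

text \<open>Equality of pairs is checked componentwise. The first component is a homomorphism; the
  second is an antihomomorphism exchanging the two sides, so there the given equation is used at (j,
  i, l, k).\<close>

lemma refl_alg_dbl:
  fixes sc :: "complex \<Rightarrow> 'a::{ring,monoid_mult}"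
  assumes "refl_alg sc I \<theta> \<kappa> s" and sym: "\<And>i j. \<theta> i j = \<theta> j i"
  shows "refl_alg (\<lambda>c. Dbl (sc c) (sc c)) I \<theta> \<kappa> (\<lambda>i j. Abs_fps (\<lambda>r. Dbl (s i j $ r) (s j i $ r)))"
proof -
  interpret refl_alg sc I \<theta> \<kappa> s by fact
  let ?sc = "\<lambda>c. Dbl (sc c) (sc c)" and ?s = "\<lambda>i j. Abs_fps (\<lambda>r. Dbl (s i j $ r) (s j i $ r))"
  \<comment> \<open>In the second component a scalar factor ends up on the right, so
    \<open>dsnd\<close> respects scalars only where it commutes with them.\<close>
  let ?C = "{x. \<forall>c. sc c * dsnd x = dsnd x * sc c}"
  have scc: "sc a * sc b = sc b * sc a" for a b by (metis sc_mult mult.commute)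
  interpret f: partial_hom UNIV dfst ?sc sc
    by standard simp_all
  interpret g: partial_antihom ?C dsnd ?sc sc
  proof
    fix x y :: "'a dbl" and p
    assume x: "x \<in> ?C"
    then show "dsnd (?sc p * x) = sc p * dsnd x" by simp
    show "?sc p * x \<in> ?C"
    proof (intro CollectI allI)
      fix c
      have x': "sc b * dsnd x = dsnd x * sc b" for b using x by simp
      have "sc c * (dsnd x * sc p) = dsnd x * (sc c * sc p)"
        using x'[of c] by (simp flip: mult.assoc)
      then show "sc c * dsnd (?sc p * x) = dsnd (?sc p * x) * sc c" by (simp add: scc[of c] mult.assoc)
    qed
    assume y: "y \<in> ?C"
    show "x * y \<in> ?C"
    proof (intro CollectI allI)
      fix c
      have x': "sc c * dsnd x = dsnd x * sc c" "sc c * dsnd y = dsnd y * sc c" using x y by simp_all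
      have "sc c * (dsnd y * dsnd x) = dsnd y * (sc c * dsnd x)"
        using x'(2) by (simp flip: mult.assoc)
      then show "sc c * dsnd (x * y) = dsnd (x * y) * sc c" by (simp add: x' mult.assoc)
    qed
  qed (auto simp: distrib_left distrib_right left_diff_distrib right_diff_distrib)
  interpret f2: partial_hom "fps_set (fps_set UNIV)" "fps_map (fps_map dfst)" "lift2 ?sc" "lift2 sc"
    by (intro partial_hom_fps_map f.partial_hom_axioms)
  interpret g2: partial_antihom "fps_set (fps_set ?C)" "fps_map (fps_map dsnd)" "lift2 ?sc" "lift2 sc"
    by (intro partial_antihom_fps_map g.partial_antihom_axioms)
  let ?U = "\<lambda>i j. outer (?s i j)" and ?V = "\<lambda>i j. fps_const (?s i j)"
  have fU: "fps_map (fps_map dfst) (?U i j) = outer (s i j)" "fps_map (fps_map dfst) (?V i j) = fps_const (s i j)"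
    "fps_map (fps_map dsnd) (?U i j) = outer (s j i)" "fps_map (fps_map dsnd) (?V i j) = fps_const (s j i)" for i j
    by (auto simp: fps_eq_iff)
  have in_f: "?U i j \<in> fps_set (fps_set UNIV)" "?V i j \<in> fps_set (fps_set UNIV)" for i j
    by (simp_all add: fps_set_def)
  have in_g: "?U i j \<in> fps_set (fps_set ?C)" "?V i j \<in> fps_set (fps_set ?C)" if "i \<in> I" "j \<in> I" for i j
    using that by (auto simp: fps_set_def sc_comm)
  have dbl_eqI: "X = Y" if "fps_map (fps_map dfst) X = fps_map (fps_map dfst) Y"
    "fps_map (fps_map dsnd) X = fps_map (fps_map dsnd) Y" for X Y :: "'a dbl fps fps"
    using that by (simp add: fps_eq_iff dbl.expand)
  show ?thesis
  proof
    fix a b :: complex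
    show "?sc (a + b) = ?sc a + ?sc b" by (simp add: plus_dbl_def sc_add)
    show "?sc (a * b) = ?sc a * ?sc b" by (simp add: times_dbl_def sc_mult) (simp add: scc flip: sc_mult)
    show "?sc 1 = 1" by (simp add: one_dbl_def sc_one)
    fix i j k l r assume ij: "i \<in> I" "j \<in> I"
    show "?sc a * ?s i j $ r = ?s i j $ r * ?sc a" using ij by (simp add: times_dbl_def sc_comm)
    assume kl: "k \<in> I" "l \<in> I"
    show "reflection_lhs (lift2 ?sc) I \<theta> \<kappa> ?U ?V i j k l
      = reflection_rhs (lift2 ?sc) I \<theta> \<kappa> ?U ?V i j k l"
    proof (rule dbl_eqI)
      note f2.map_refl_left(2)[OF neg_I in_f ij kl] f2.map_refl_right(2)[OF neg_I in_f ij kl]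
      then show "fps_map (fps_map dfst) (reflection_lhs (lift2 ?sc) I \<theta> \<kappa> ?U ?V i j k l)
        = fps_map (fps_map dfst) (reflection_rhs (lift2 ?sc) I \<theta> \<kappa> ?U ?V i j k l)"
        unfolding fU using reflection[OF ij kl] by simp
      note g2.anti_refl_left[OF neg_I sym in_g ij kl] g2.anti_refl_right[OF neg_I sym in_g ij kl]
      then show "fps_map (fps_map dsnd) (reflection_lhs (lift2 ?sc) I \<theta> \<kappa> ?U ?V i j k l)
        = fps_map (fps_map dsnd) (reflection_rhs (lift2 ?sc) I \<theta> \<kappa> ?U ?V i j k l)"
        unfolding fU using reflection[OF ij(2,1) kl(2,1)] by simp
    qed
  qed (rule neg_I)
qed

section \<open>Operators of a representation\<close>

locale tw_rep =
  fixes ty :: pair_type and N :: nat and scale :: "complex \<Rightarrow> 'v::ab_group_add \<Rightarrow> 'v"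
    and \<rho> :: "gen free_alg set \<Rightarrow> 'v \<Rightarrow> 'v"
  assumes type: "type_for ty N" and rep: "representation ty N scale \<rho>"
begin

abbreviation "TY \<equiv> twisted_yangian ty N"
abbreviation "EY \<equiv> ext_yangian ty N"
abbreviation "FA \<equiv> free_ring (gens N)"
abbreviation "cls \<equiv> yangian_class ty N"

sublocale V: vector_space scale
  using rep by (simp add: representation_def)

lemma rho_linear: "x \<in> TY \<Longrightarrow> Vector_Spaces.linear scale scale (\<rho> x)"
  using rep by (simp add: representation_def)

lemma rho_add: "x \<in> TY \<Longrightarrow> \<rho> x (v + w) = \<rho> x v + \<rho> x w"
  and rho_scale: "x \<in> TY \<Longrightarrow> \<rho> x (scale c v) = scale c (\<rho> x v)"
  using Vector_Spaces.linear.axioms(3)[OF rho_linear[of x]]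
  by (simp_all add: module_hom.add module_hom.scale)

lemma rho_plus: "x \<in> TY \<Longrightarrow> y \<in> TY \<Longrightarrow> \<rho> (x \<oplus>\<^bsub>EY\<^esub> y) = (\<lambda>v. \<rho> x v + \<rho> y v)"
  and rho_mult: "x \<in> TY \<Longrightarrow> y \<in> TY \<Longrightarrow> \<rho> (x \<otimes>\<^bsub>EY\<^esub> y) = \<rho> x \<circ> \<rho> y"
  and rho_scalar: "\<rho> (yangian_scalar ty N c) = scale c"
  using rep by (simp_all add: representation_def)

sublocale EY: ring EY
  by (rule ext_yangian_ring)

lemma s_coeff_eq: "s_coeff ty N i j r = cls (s_series ty N i j $ r)"
  by (simp add: s_coeff_def)

lemma s_series_nth_in: "i \<in> idx N \<Longrightarrow> j \<in> idx N \<Longrightarrow> s_series ty N i j $ r \<in> carrier FA"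
  using s_series_in[OF type, of i j] by (simp add: fps_set_def)

lemma scalar_in_TY: "yangian_scalar ty N c \<in> TY"
  unfolding twisted_yangian_def by (rule generate_ring.incl) simp

lemma s_coeff_in_TY: "i \<in> idx N \<Longrightarrow> j \<in> idx N \<Longrightarrow> s_coeff ty N i j r \<in> TY"
  unfolding twisted_yangian_def by (rule generate_ring.incl) blast

lemma TY_carrier: "x \<in> TY \<Longrightarrow> x \<in> carrier EY"
  unfolding twisted_yangian_def
  by (erule EY.generate_ring_in_carrier[rotated])
     (auto simp: yangian_scalar_def s_coeff_eq intro!: yangian_class_in free_ring_scalar s_series_nth_in)

lemma TY_add: "x \<in> TY \<Longrightarrow> y \<in> TY \<Longrightarrow> x \<oplus>\<^bsub>EY\<^esub> y \<in> TY"
  and TY_mult: "x \<in> TY \<Longrightarrow> y \<in> TY \<Longrightarrow> x \<otimes>\<^bsub>EY\<^esub> y \<in> TY"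
  unfolding twisted_yangian_def by (auto intro: generate_ring.intros)

lemma cls_scalar_mult: "p \<in> carrier FA \<Longrightarrow> cls (scalar c * p) = yangian_scalar ty N c \<otimes>\<^bsub>EY\<^esub> cls p"
  by (simp add: yangian_class_mult free_ring_scalar yangian_scalar_def)

text \<open>The preimage of the twisted Yangian: elsewhere \<open>\<rho>\<close> is arbitrary, and
  \<open>op\<close> may be the \<open>Endo\<close> of a map that is not additive.\<close>

definition D :: "gen free_alg set"
  where "D = {p \<in> carrier FA. cls p \<in> TY}"

definition op :: "gen free_alg \<Rightarrow> 'v endo"
  where "op p = Endo (\<rho> (cls p))"

definition sc :: "complex \<Rightarrow> 'v endo"
  where "sc c = Endo (scale c)"

lemma app_sc [simp]: "app (sc c) v = scale c v"
  by (simp add: sc_def V.scale_right_distrib)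

lemma app_op: "p \<in> D \<Longrightarrow> app (op p) v = \<rho> (cls p) v"
  by (simp add: op_def D_def rho_add)

sublocale pD: partial_hom D op scalar sc
proof
  have z: "0 \<in> D"
    unfolding D_def twisted_yangian_def
    by (simp add: free_ring_0 yangian_class_zero' EY.zero_in_generate)
  show "0 \<in> D" by (rule z)
  have DI: "x \<in> carrier FA" "cls x \<in> TY" if "x \<in> D" for x
    using that by (simp_all add: D_def)
  have s: "scalar p * x \<in> D" if "x \<in> D" for p x
    using DI[OF that] scalar_in_TY[of p] by (simp add: D_def free_ring_mult free_ring_scalar cls_scalar_mult TY_mult)
  have a: "x + y \<in> D" if "x \<in> D" "y \<in> D" for x y
    using DI[OF that(1)] DI[OF that(2)] by (simp add: D_def free_ring_add yangian_class_add TY_add)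
  have m: "x * y \<in> D" if "x \<in> D" "y \<in> D" for x y
    using DI[OF that(1)] DI[OF that(2)] by (simp add: D_def free_ring_mult yangian_class_mult TY_mult)
  fix x y p assume x: "x \<in> D"
  show "scalar p * x \<in> D" by (rule s[OF x])
  show "op (scalar p * x) = sc p * op x"
    by (rule endo_eqI) (simp add: app_op x s[OF x] DI[OF x] cls_scalar_mult rho_mult scalar_in_TY rho_scalar)
  assume y: "y \<in> D"
  show "x + y \<in> D" by (rule a[OF x y])
  have "scalar (- 1) = (- 1 :: gen free_alg)"
    using central_scalars.hom_minus[OF central_scalars_scalar, of 1] by simp
  then have "scalar (- 1) * y = - y" by simp
  then show "x - y \<in> D" using a[OF x s[OF y, of "- 1"]] by simp
  show "x * y \<in> D" by (rule m[OF x y])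
  show "op (x + y) = op x + op y"
    by (rule endo_eqI) (simp add: app_op x y a DI[OF x] DI[OF y] yangian_class_add rho_plus)
  show "op (x * y) = op x * op y"
    by (rule endo_eqI) (simp add: app_op x y m DI[OF x] DI[OF y] yangian_class_mult rho_mult)
qed

definition \<sigma> :: "int \<Rightarrow> int \<Rightarrow> 'v endo fps"
  where "\<sigma> i j = fps_map op (s_series ty N i j)"

lemma s_series_D: "i \<in> idx N \<Longrightarrow> j \<in> idx N \<Longrightarrow> s_series ty N i j $ r \<in> D"
  using s_coeff_in_TY[of i j r] by (simp add: D_def s_series_nth_in s_coeff_eq)

lemma app_sigma: "i \<in> idx N \<Longrightarrow> j \<in> idx N \<Longrightarrow> app (\<sigma> i j $ r) v = \<rho> (s_coeff ty N i j r) v"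
  by (simp add: \<sigma>_def app_op s_series_D s_coeff_eq)

lemma op_eq_0: "p \<in> carrier FA \<Longrightarrow> to_yang ty N p = 0 \<Longrightarrow> op p = 0"
  using to_yang_eq_0[of ty N p] pD.map_zero yangian_class_zero' by (simp add: op_def)

text \<open>The reflection equation is known in the extended Yangian, on which \<open>\<rho>\<close>
  is not specified. The difference X of its sides is formed in the free algebra, where its
  coefficients belong both to the carrier and to \<open>D\<close>: \<open>to_yang\<close> kills
  them, hence so does \<open>op\<close>.\<close>

sublocale S: refl_alg sc "idx N" "\<lambda>i j. k2 (theta ty i j)" "kappa ty N" \<sigma>
proof
  fix a b :: complex
  show "sc (a + b) = sc a + sc b" by (rule endo_eqI) (simp add: V.scale_left_distrib)
  show "sc (a * b) = sc a * sc b" by (rule endo_eqI) simp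
  show "sc 1 = 1" by (rule endo_eqI) simp
  fix i j k l r assume ij: "i \<in> idx N" "j \<in> idx N"
  show "sc a * \<sigma> i j $ r = \<sigma> i j $ r * sc a"
    by (rule endo_eqI) (simp add: app_sigma ij rho_scale s_coeff_in_TY)
  assume kl: "k \<in> idx N" "l \<in> idx N"
  let ?I = "idx N" and ?th = "\<lambda>i j. k2 (theta ty i j)" and ?k = "kappa ty N"
  let ?l = "\<lambda>\<phi> U V. reflection_lhs (lift2 \<phi>) ?I ?th ?k U V i j k l"
  let ?r = "\<lambda>\<phi> U V. reflection_rhs (lift2 \<phi>) ?I ?th ?k U V i j k l"
  let ?U = "\<lambda>i j. outer (s_series ty N i j)" and ?V = "\<lambda>i j. fps_const (s_series ty N i j)"
  interpret p: partial_hom "fps_set (fps_set D)" "fps_map (fps_map op)" "lift2 scalar" "lift2 sc"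
    by (intro partial_hom_fps_map pD.partial_hom_axioms)
  interpret y: partial_hom "fps_set (fps_set (carrier FA))" "fps_map (fps_map (to_yang ty N))" "lift2 scalar" "lift2 yang_scalar"
    by (intro partial_hom_fps_map partial_hom_to_yang)
  have inD: "?U i j \<in> fps_set (fps_set D)" "?V i j \<in> fps_set (fps_set D)" if "i \<in> ?I" "j \<in> ?I" for i j
    using that by (auto simp: fps_set_def s_series_D pD.zero_in)
  have inC: "?U i j \<in> fps_set (fps_set (carrier FA))" "?V i j \<in> fps_set (fps_set (carrier FA))" if "i \<in> ?I" "j \<in> ?I" for i j
    using that by (auto simp: fps_set_def s_series_nth_in free_ring_0)
  have mU: "fps_map (fps_map op) (?U i j) = outer (\<sigma> i j)" "fps_map (fps_map op) (?V i j) = fps_const (\<sigma> i j)"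
    "fps_map (fps_map (to_yang ty N)) (?U i j) = outer (s_yang ty N i j)"
    "fps_map (fps_map (to_yang ty N)) (?V i j) = fps_const (s_yang ty N i j)" for i j
    by (auto simp: fps_eq_iff \<sigma>_def s_yang_def pD.map_zero to_yang_ideal[OF additive_subgroup.zero_closed[OF ideal.axioms(1)[OF RTT_ideal]], simplified])
  define X where "X = ?l scalar ?U ?V - ?r scalar ?U ?V"
  have "fps_map (fps_map (to_yang ty N)) X
      = ?l yang_scalar (\<lambda>i j. outer (s_yang ty N i j)) (\<lambda>i j. fps_const (s_yang ty N i j))
        - ?r yang_scalar (\<lambda>i j. outer (s_yang ty N i j)) (\<lambda>i j. fps_const (s_yang ty N i j))"
    unfolding X_def using ij kl
    by (simp add: y.map_diff y.map_refl_left[OF neg_idx inC] y.map_refl_right[OF neg_idx inC] mU)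
  also have "\<dots> = 0"
    using reflection_equation_yang[OF type ij kl] by simp
  finally have "to_yang ty N (X $ m $ n) = 0" for m n by (simp add: fps_eq_iff)
  moreover have "X $ m $ n \<in> carrier FA" for m n
  proof -
    have "X \<in> fps_set (fps_set (carrier FA))"
      unfolding X_def using ij kl
      by (intro y.diff_in y.map_refl_left[OF neg_idx inC] y.map_refl_right[OF neg_idx inC])
    then show ?thesis by (simp add: fps_set_def)
  qed
  ultimately have "fps_map (fps_map op) X = 0"
    by (simp add: fps_eq_iff op_eq_0)
  moreover have "fps_map (fps_map op) X = ?l sc (\<lambda>i j. outer (\<sigma> i j)) (\<lambda>i j. fps_const (\<sigma> i j))
      - ?r sc (\<lambda>i j. outer (\<sigma> i j)) (\<lambda>i j. fps_const (\<sigma> i j))"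
    unfolding X_def using ij kl
    by (simp add: p.map_diff p.map_refl_left[OF neg_idx inD] p.map_refl_right[OF neg_idx inD] mU)
  ultimately show "?l sc (\<lambda>i j. outer (\<sigma> i j)) (\<lambda>i j. fps_const (\<sigma> i j))
      = ?r sc (\<lambda>i j. outer (\<sigma> i j)) (\<lambda>i j. fps_const (\<sigma> i j))"
    by simp
qed simp

end

section \<open>Eigenvectors\<close>

context vector_space
begin

lemma linear_sum:
  assumes "\<And>v w. f (v + w) = f v + f w"
  shows "f (sum g A :: 'b) = (\<Sum>a\<in>A. f (g a) :: 'b)"
  using additive.sum[of f] assms by (simp add: additive_def)

lemma eigenvectors_independent:
  assumes add: "\<And>v w. f (v + w) = f v + f w" and hom: "\<And>c v. f (scale c v) = scale c (f v)"
    and T: "\<And>v. v \<in> T \<Longrightarrow> v \<noteq> 0 \<and> f v = scale (\<mu> v) v" and inj: "inj_on \<mu> T"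
  shows "independent T"
proof -
  have "\<forall>v\<in>U. u v = 0" if "finite U" "U \<subseteq> T" "(\<Sum>v\<in>U. scale (u v) v) = 0" for U u
    using that
  proof (induct U arbitrary: u rule: finite_induct)
    case (insert x U)
    \<comment> \<open>Applying f - \<mu>(x) to the relation removes x and leaves a relation on
      U.\<close>
    have "(\<Sum>v\<in>insert x U. scale (u v * (\<mu> v - \<mu> x)) v) = f (\<Sum>v\<in>insert x U. scale (u v) v) - scale (\<mu> x) (\<Sum>v\<in>insert x U. scale (u v) v)"
      unfolding linear_sum[of f, OF add] scale_sum_right sum_subtractf[symmetric]
    proof (rule sum.cong[OF refl])
      fix v assume "v \<in> insert x U"
      then have "f v = scale (\<mu> v) v" using T insert.prems by blast
      then show "scale (u v * (\<mu> v - \<mu> x)) v = f (scale (u v) v) - scale (\<mu> x) (scale (u v) v)"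
        by (simp add: hom right_diff_distrib scale_left_diff_distrib mult.commute)
    qed
    also have "\<dots> = 0"
      using insert.prems(2) additive.zero[of f] add by (simp add: additive_def)
    finally have "(\<Sum>v\<in>U. scale (u v * (\<mu> v - \<mu> x)) v) = 0"
      using insert.hyps by simp
    then have "\<forall>v\<in>U. u v * (\<mu> v - \<mu> x) = 0"
      using insert.hyps(3)[of "\<lambda>v. u v * (\<mu> v - \<mu> x)"] insert.prems by auto
    moreover have "\<mu> v \<noteq> \<mu> x" if "v \<in> U" for v
      using inj insert that by (auto simp: inj_on_def)
    ultimately have U: "\<forall>v\<in>U. u v = 0" by auto
    then have "scale (u x) x = 0" using insert by simp
    then have "u x = 0" using T insert.prems by auto
    with U show ?case by simp
  qed simp
  then show ?thesis unfolding independent_explicit_module by blast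
qed

end

context
  fixes scale :: "complex \<Rightarrow> 'v::ab_group_add \<Rightarrow> 'v" and B :: "'v set"
  assumes fd: "finite_dimensional_vector_space scale B"
begin

interpretation finite_dimensional_vector_space scale B by (rule fd)

text \<open>Let p be of least degree with p(f) w = 0 and let z be a root of p. With p = (X - z) q,
  the vector q(f) w is nonzero by minimality and is an eigenvector for z; it stays in W.\<close>

lemma eigenvector_exists:
  assumes add: "\<And>v w. f (v + w) = f v + f w" and hom: "\<And>c v. f (scale c v) = scale c (f v)"
    and W: "subspace W" "\<And>w. w \<in> W \<Longrightarrow> f w \<in> W" and w: "w \<in> W" "w \<noteq> 0"
  shows "\<exists>\<mu> v. v \<in> W \<and> v \<noteq> 0 \<and> f v = scale \<mu> v"
proof -
  have f0: "f 0 = 0" using add[of 0 0] by simp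
  \<comment> \<open>Horner evaluation: \<open>pa p\<close> is p(f) applied to w.\<close>
  define pa where "pa p = fold_coeffs (\<lambda>a v. scale a w + f v) p 0" for p :: "complex poly"
  have pa_0: "pa 0 = 0" by (simp add: pa_def)
  have pa_pCons: "pa (pCons a p) = scale a w + f (pa p)" for a p
    by (cases "p = 0 \<and> a = 0") (auto simp: pa_def f0 cCons_def)
  have pa_add: "pa (p + q) = pa p + pa q" for p q
    by (induct p q rule: poly_induct2) (simp_all add: pa_0 pa_pCons scale_left_distrib add)
  have pa_smult: "pa (smult c p) = scale c (pa p)" for c p
    by (induct p) (simp_all add: pa_0 pa_pCons scale_right_distrib hom)
  have pa_in: "pa p \<in> W" for p
    by (induct p) (simp_all add: pa_0 pa_pCons W w subspace_0 subspace_add subspace_scale)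
  have pa_sum: "pa (sum g A) = (\<Sum>a\<in>A. pa (g a))" for g and A :: "nat set"
    using additive.sum[of pa] pa_add by (simp add: additive_def)
  have "\<exists>p. p \<noteq> 0 \<and> pa p = 0"
  proof -
    define e where "e i = pa (monom 1 i)" for i
    show ?thesis
    proof (cases "inj e")
      case False
      then obtain i j where ij: "i \<noteq> j" "e i = e j" by (auto simp: inj_def)
      have "pa (monom 1 i + smult (- 1) (monom 1 j)) = 0"
        using ij(2) unfolding pa_add pa_smult by (simp add: e_def)
      moreover have "coeff (monom 1 i + smult (- 1) (monom 1 j)) i \<noteq> (0::complex)"
        using ij(1) by simp
      then have "monom 1 i + smult (- 1) (monom 1 j) \<noteq> (0 :: complex poly)" by (metis coeff_0)
      ultimately show ?thesis by blast
    next
      case True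
      then have "infinite (range e)" by (rule range_inj_infinite)
      then have "dependent (range e)" using finiteI_independent by blast
      then obtain U u where U: "finite U" "U \<subseteq> range e" "(\<Sum>v\<in>U. scale (u v) v) = 0" "\<exists>v\<in>U. u v \<noteq> 0"
        unfolding dependent_explicit by blast
      then obtain J where J: "U = e ` J" by (meson subset_imageE)
      have finJ: "finite J" using U(1) J True by (metis finite_imageD inj_on_subset subset_UNIV)
      define p where "p = (\<Sum>i\<in>J. smult (u (e i)) (monom 1 i))"
      have "pa p = (\<Sum>i\<in>J. scale (u (e i)) (e i))"
        by (simp add: p_def pa_sum pa_smult e_def)
      also have "\<dots> = 0"
        using U(3) unfolding J by (subst (asm) sum.reindex) (auto simp: inj_on_subset[OF True])
      finally have "pa p = 0" .
      moreover have "p \<noteq> 0"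
      proof -
        obtain i where i: "i \<in> J" "u (e i) \<noteq> 0" using U(4) J by auto
        have "coeff p i = (\<Sum>k\<in>J. if k = i then u (e k) else 0)"
          unfolding p_def coeff_sum by (rule sum.cong) auto
        then have "coeff p i = u (e i)" using i finJ by simp
        then show ?thesis using i(2) by auto
      qed
      ultimately show ?thesis by blast
    qed
  qed
  then obtain p where p: "p \<noteq> 0" "pa p = 0" and min: "\<And>q. degree q < degree p \<Longrightarrow> q \<noteq> 0 \<Longrightarrow> pa q \<noteq> 0"
    using exists_least_iff[of "\<lambda>n. \<exists>p. p \<noteq> 0 \<and> pa p = 0 \<and> degree p = n"] by blast
  have "degree p \<noteq> 0"
  proof
    assume "degree p = 0"
    then obtain a where "p = [:a:]" by (rule degree_eq_zeroE)
    then show False using p w(2) by (auto simp: pa_pCons pa_0 f0)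
  qed
  then obtain z where "poly p z = 0"
    using fundamental_theorem_of_algebra[of p] constant_degree[of p] by auto
  then obtain q where q: "p = [:- z, 1:] * q" by (auto simp: poly_eq_0_iff_dvd)
  then have "q \<noteq> 0" using p by auto
  then have "degree p = Suc (degree q)" unfolding q by (subst degree_mult_eq) auto
  then have "pa q \<noteq> 0" using min[of q] \<open>q \<noteq> 0\<close> by simp
  moreover have "pa p = f (pa q) - scale z (pa q)"
  proof -
    have "p = smult (- z) q + pCons 0 q" by (simp add: q)
    then have "pa p = scale (- z) (pa q) + (scale 0 w + f (pa q))" by (simp only: pa_add pa_smult pa_pCons)
    then show ?thesis by simp
  qed
  ultimately show ?thesis using p(2) pa_in[of q] by (intro exI[of _ z] exI[of _ "pa q"]) simp
qed

text \<open>In a nonzero invariant subspace of least dimension every member of the family is a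
  scalar, because its eigenspace there is invariant under all others and must fill the subspace. The
  argument covers infinite families, as needed for the diagonal letters of all degrees.\<close>

lemma common_eigenvector:
  assumes add: "\<And>f v w. f \<in> F \<Longrightarrow> f (v + w) = f v + f w"
    and hom: "\<And>f c v. f \<in> F \<Longrightarrow> f (scale c v) = scale c (f v)"
    and W: "subspace W" "\<And>f w. f \<in> F \<Longrightarrow> w \<in> W \<Longrightarrow> f w \<in> W" "W \<noteq> {0}"
    and comm: "\<And>f g w. f \<in> F \<Longrightarrow> g \<in> F \<Longrightarrow> w \<in> W \<Longrightarrow> f (g w) = g (f w)"
  shows "\<exists>v\<in>W. v \<noteq> 0 \<and> (\<forall>f\<in>F. \<exists>\<mu>. f v = scale \<mu> v)"
proof -
  define good where "good U \<longleftrightarrow> subspace U \<and> U \<subseteq> W \<and> U \<noteq> {0} \<and> (\<forall>f\<in>F. \<forall>u\<in>U. f u \<in> U)" for U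
  have "good W" using W by (simp add: good_def)
  then obtain U where U: "good U" and min: "\<And>U'. dim U' < dim U \<Longrightarrow> \<not> good U'"
    using exists_least_iff[of "\<lambda>n. \<exists>U. good U \<and> dim U = n"] by blast
  have sub: "subspace U" and UW: "U \<subseteq> W" and inv: "\<And>f u. f \<in> F \<Longrightarrow> u \<in> U \<Longrightarrow> f u \<in> U"
    using U by (auto simp: good_def)
  obtain v where v: "v \<in> U" "v \<noteq> 0"
    using U subspace_0[OF sub] by (auto simp: good_def)
  have "\<exists>\<mu>. f v = scale \<mu> v" if f: "f \<in> F" for f
  proof -
    obtain \<mu> x where x: "x \<in> U" "x \<noteq> 0" "f x = scale \<mu> x"
      using eigenvector_exists[of f U v] add[OF f] hom[OF f] sub inv[OF f] v by blast
    define E where "E = {u \<in> U. f u = scale \<mu> u}"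
    have f0: "f 0 = 0" using add[OF f, of 0 0] by simp
    have subE: "subspace E"
      unfolding subspace_def E_def using sub
      by (auto simp: subspace_0 subspace_add subspace_scale add[OF f] hom[OF f] f0 scale_right_distrib scale_left_commute)
    have "good E"
      unfolding good_def
    proof (intro conjI ballI)
      show "E \<noteq> {0}" using x by (auto simp: E_def)
      fix g u assume g: "g \<in> F" and u: "u \<in> E"
      have "f (g u) = scale \<mu> (g u)"
        using comm[OF f g, of u] u UW hom[OF g] by (auto simp: E_def)
      then show "g u \<in> E" using inv[OF g] u by (simp add: E_def)
    qed (use subE UW in \<open>auto simp: E_def\<close>)
    then have "dim E \<ge> dim U" using min by (meson not_le)
    moreover have "E \<subseteq> U" by (auto simp: E_def)
    ultimately have "E = U" using subspace_dim_equal[OF subE sub] by simp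
    then show ?thesis using v(1) by (auto simp: E_def)
  qed
  then show ?thesis using v UW by blast
qed

end

section \<open>The grading element\<close>

context refl_alg
begin

lemma sc_zero: "sc 0 = 0"
  using sc_add[of 0 0] by simp

text \<open>This and the next lemmas read off the coefficients of u^0 and u^-1; a scalar series
  whose relevant part is the d-th power of 1/v just shifts the exponent of 1/v by d.\<close>

lemma lift2_nth_0:
  assumes "P $ 0 = fps_X ^ d"
  shows "(lift2 sc P * F) $ 0 $ (q + d) = F $ 0 $ q"
proof -
  have "(\<Sum>n=0..q + d. sc (P $ 0 $ n) * F $ 0 $ (q + d - n)) = (\<Sum>n=0..q + d. if n = d then F $ 0 $ q else 0)"
    by (intro sum.cong refl) (auto simp: assms sc_zero sc_one)
  then show ?thesis unfolding lift2_mult_nth by simp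
qed

lemma lift2_nth_0': "P $ 0 = 0 \<Longrightarrow> (lift2 sc P * F) $ 0 $ q = 0"
  unfolding lift2_mult_nth by (simp add: sc_zero)

lemma lift2_nth_1:
  assumes "P $ 0 = fps_X ^ d" "\<And>n. F $ 0 $ n = 0"
  shows "(lift2 sc P * F) $ 1 $ (q + d) = F $ 1 $ q"
proof -
  have "(\<Sum>n=0..q + d. sc (P $ 0 $ n) * F $ 1 $ (q + d - n)) = (\<Sum>n=0..q + d. if n = d then F $ 1 $ q else 0)"
    by (intro sum.cong refl) (auto simp: assms sc_zero sc_one)
  then show ?thesis unfolding lift2_mult_nth by (simp add: assms(2))
qed

lemma lift2_nth_1':
  assumes "P $ 0 = 0" "P $ 1 = fps_X ^ d"
  shows "(lift2 sc P * F) $ 1 $ (q + d) = F $ 0 $ q"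
proof -
  have "(\<Sum>n=0..q + d. sc (P $ 1 $ n) * F $ 0 $ (q + d - n)) = (\<Sum>n=0..q + d. if n = d then F $ 0 $ q else 0)"
    by (intro sum.cong refl) (auto simp: assms(2)[simplified] sc_zero sc_one)
  then show ?thesis unfolding lift2_mult_nth by (simp add: assms(1) sc_zero)
qed

lemma R_nth:
  "(zm * zmk \<kappa>) $ 0 = fps_X ^ 2" "(zp * zpk \<kappa>) $ 0 = fps_X ^ 2"
  "(hp * zmk \<kappa>) $ 0 = 0" "(hp * zm) $ 0 = 0" "(hp * zpk \<kappa>) $ 0 = 0" "(hp * zp) $ 0 = 0"
  "(hp * zmk \<kappa>) $ 1 = fps_X ^ 2" "(hp * zm) $ 1 = fps_X ^ 2" "(hp * zpk \<kappa>) $ 1 = fps_X ^ 2" "(hp * zp) $ 1 = fps_X ^ 2"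
  by (simp_all add: fps_mult_nth zm_def zp_def zmk_def zpk_def hp_def power2_eq_square)

lemma lift2_k2: "(lift2 sc (k2 c) * F) $ m $ n = sc c * F $ m $ n"
proof -
  have "fps_map (fps_map sc) (k2 c) = fps_const (fps_const (sc c))"
    by (auto simp: fps_eq_iff k2_def sc_zero)
  then show ?thesis by simp
qed

text \<open>The coefficient of u^-1 in the reflection equation, where S(u) contributes only its
  constant term G beyond the commutator. P and Q occur in R(u - v) and in R(u + v) with equal
  contributions at this order, whence the factor 2.\<close>

lemma diagonal_commutator:
  assumes fin: "finite I" and th: "\<And>i j. \<theta> i j = k2 (th i j)" and th1: "\<And>i. i \<in> I \<Longrightarrow> th i i = 1"
    and s0: "\<And>i j. i \<in> I \<Longrightarrow> j \<in> I \<Longrightarrow> s i j $ 0 = (if i = j then sc (g i) else 0)"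
    and ij: "i \<in> I" "k \<in> I" "l \<in> I"
  shows "s i i $ 1 * s k l $ q - s k l $ q * s i i $ 1
    = sc (2 * g i * ((if k = i then 1 else 0) - (if k = - i then 1 else 0)
        - (if l = i then 1 else 0) + (if l = - i then 1 else 0))) * s k l $ q"
proof -
  let ?A = "lift2 sc (zm * zmk \<kappa>)" and ?A' = "lift2 sc (zp * zpk \<kappa>)"
  let ?U = "\<lambda>i j. outer (s i j)" and ?V = "\<lambda>i j. fps_const (s i j)"
  define ml where "ml = mid_left (lift2 sc) I \<theta> (zp * zpk \<kappa>) (hp * zpk \<kappa>) (hp * zp) ?U ?V"
  define mr where "mr = mid_right (lift2 sc) I \<theta> (zp * zpk \<kappa>) (hp * zpk \<kappa>) (hp * zp) ?U ?V"
  note nth = lift2_nth_0[OF R_nth(2)] lift2_nth_0'[OF R_nth(5)] lift2_nth_0'[OF R_nth(6)]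
  have ml0: "ml i j k l $ 0 $ (q + 2) = s i j $ 0 * s k l $ q" for i j k l q
    unfolding ml_def mid_left_def fps_add_nth fps_sub_nth nth outer_const_nth by simp
  have mr0: "mr i j k l $ 0 $ (q + 2) = s k l $ q * s i j $ 0" for i j k l q
    unfolding mr_def mid_right_def fps_add_nth fps_sub_nth nth outer_const_nth by simp
  \<comment> \<open>Each of the two cleared R-matrices shifts the exponent of 1/v by 2.\<close>
  have q4: "q + 4 = (q + 2) + 2" by simp
  have scd: "sc c * s a b $ n = s a b $ n * sc c" if "a \<in> I" "b \<in> I" for a b n c
    using that by (rule sc_comm)
  define rl where "rl = ml i i k l - ?A' * (?U i i * ?V k l)"
  define rr where "rr = mr i i k l - ?A' * (?V k l * ?U i i)"
  have rl: "rl = lift2 sc (hp * zp) * (lift2 sc (\<theta> (- k) i) * (?U i (- k) * ?V (- i) l))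
      - lift2 sc (hp * zpk \<kappa>) * (if k = i then \<Sum>m\<in>I. ?U i m * ?V m l else 0)"
    by (simp add: rl_def ml_def mid_left_def)
  have rr: "rr = lift2 sc (hp * zp) * (lift2 sc (\<theta> i (- l)) * (?V k (- i) * ?U (- l) i))
      - lift2 sc (hp * zpk \<kappa>) * (if i = l then \<Sum>m\<in>I. ?V k m * ?U m i else 0)"
    by (simp add: rr_def mr_def mid_right_def)
  have sumL: "(\<Sum>m\<in>I. ?U i m * ?V m l) $ 0 $ q = sc (g i) * s i l $ q"
  proof -
    have "(\<Sum>m\<in>I. ?U i m * ?V m l) $ 0 $ q = (\<Sum>m\<in>I. if m = i then sc (g i) * s i l $ q else 0)"
      unfolding fps_sum_nth outer_const_nth using ij by (intro sum.cong refl) (auto simp: s0)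
    then show ?thesis using fin ij by simp
  qed
  have sumR: "(\<Sum>m\<in>I. ?V k m * ?U m i) $ 0 $ q = sc (g i) * s k i $ q"
  proof -
    have "(\<Sum>m\<in>I. ?V k m * ?U m i) $ 0 $ q = (\<Sum>m\<in>I. if m = i then sc (g i) * s k i $ q else 0)"
      unfolding fps_sum_nth outer_const_nth using ij by (intro sum.cong refl) (auto simp: s0 scd)
    then show ?thesis using fin ij by simp
  qed
  have TL: "(?A * rl) $ 1 $ (q + 4) = (if k = - i then sc (g i) * s k l $ q else 0) - (if k = i then sc (g i) * s k l $ q else 0)"
  proof -
    have "rl $ 0 $ n = 0" for n
      unfolding rl fps_sub_nth nth by simp
    then have "(?A * rl) $ 1 $ (q + 4) = rl $ 1 $ (q + 2)"
      unfolding q4 by (rule lift2_nth_1[OF R_nth(1)])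
    also have "\<dots> = sc (th (- k) i) * (s i (- k) $ 0 * s (- i) l $ q) - (if k = i then \<Sum>m\<in>I. ?U i m * ?V m l else 0) $ 0 $ q"
      unfolding rl fps_sub_nth lift2_nth_1'[OF R_nth(5,9)] lift2_nth_1'[OF R_nth(6,10)] th lift2_k2 outer_const_nth ..
    also have "\<dots> = (if k = - i then sc (g i) * s k l $ q else 0) - (if k = i then sc (g i) * s k l $ q else 0)"
      using ij sumL by (auto simp: s0 neg_I th1 sc_one)
    finally show ?thesis .
  qed
  have TR: "(?A * rr) $ 1 $ (q + 4) = (if l = - i then sc (g i) * s k l $ q else 0) - (if l = i then sc (g i) * s k l $ q else 0)"
  proof -
    have "rr $ 0 $ n = 0" for n
      unfolding rr fps_sub_nth nth by simp
    then have "(?A * rr) $ 1 $ (q + 4) = rr $ 1 $ (q + 2)"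
      unfolding q4 by (rule lift2_nth_1[OF R_nth(1)])
    also have "\<dots> = sc (th i (- l)) * (s k (- i) $ q * s (- l) i $ 0) - (if i = l then \<Sum>m\<in>I. ?V k m * ?U m i else 0) $ 0 $ q"
      unfolding rr fps_sub_nth lift2_nth_1'[OF R_nth(5,9)] lift2_nth_1'[OF R_nth(6,10)] th lift2_k2 outer_const_nth ..
    also have "\<dots> = (if l = - i then sc (g i) * s k l $ q else 0) - (if l = i then sc (g i) * s k l $ q else 0)"
      using ij sumR by (auto simp: s0 neg_I th1 sc_one scd)
    finally show ?thesis .
  qed
  have PL: "(lift2 sc (hp * zmk \<kappa>) * ml k i i l) $ 1 $ (q + 4) = (if k = i then sc (g i) * s k l $ q else 0)"
    unfolding q4 lift2_nth_1'[OF R_nth(3,7)] ml0 using ij by (auto simp: s0)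
  have PR: "(lift2 sc (hp * zmk \<kappa>) * mr i l k i) $ 1 $ (q + 4) = (if l = i then sc (g i) * s k l $ q else 0)"
    unfolding q4 lift2_nth_1'[OF R_nth(3,7)] mr0 using ij by (auto simp: s0 scd)
  have QL: "(if k = - i then lift2 sc (hp * zm) * (\<Sum>m\<in>I. lift2 sc (\<theta> i m) * ml m i (- m) l) else 0) $ 1 $ (q + 4)
      = (if k = - i then sc (g i) * s k l $ q else 0)"
  proof (cases "k = - i")
    case True
    have "(\<Sum>m\<in>I. lift2 sc (\<theta> i m) * ml m i (- m) l) $ 0 $ (q + 2)
        = (\<Sum>m\<in>I. if m = i then sc (g i) * s (- i) l $ q else 0)"
      unfolding fps_sum_nth th lift2_k2 ml0 using ij by (intro sum.cong refl) (auto simp: s0 th1 sc_one)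
    also have "\<dots> = sc (g i) * s (- i) l $ q" using fin ij by simp
    finally show ?thesis unfolding if_P[OF True] q4 lift2_nth_1'[OF R_nth(4,8)] unfolding True .
  qed simp
  have QR: "(if l = - i then lift2 sc (hp * zm) * (\<Sum>m\<in>I. lift2 sc (\<theta> m i) * mr i m k (- m)) else 0) $ 1 $ (q + 4)
      = (if l = - i then sc (g i) * s k l $ q else 0)"
  proof (cases "l = - i")
    case True
    have "(\<Sum>m\<in>I. lift2 sc (\<theta> m i) * mr i m k (- m)) $ 0 $ (q + 2)
        = (\<Sum>m\<in>I. if m = i then sc (g i) * s k (- i) $ q else 0)"
      unfolding fps_sum_nth th lift2_k2 mr0 using ij by (intro sum.cong refl) (auto simp: s0 th1 sc_one scd neg_I)
    also have "\<dots> = sc (g i) * s k (- i) $ q" using fin ij by simp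
    finally show ?thesis unfolding if_P[OF True] q4 lift2_nth_1'[OF R_nth(4,8)] unfolding True .
  qed simp
  have lead: "(?A * (?A' * (?U i i * ?V k l - ?V k l * ?U i i))) $ 1 $ (q + 4) = s i i $ 1 * s k l $ q - s k l $ q * s i i $ 1"
  proof -
    have l0: "lead \<kappa> $ 0 = fps_X ^ 4" by (simp add: fps_eq_iff lead_0)
    have "(?U i i * ?V k l - ?V k l * ?U i i) $ 0 $ n = 0" for n
      unfolding fps_sub_nth outer_const_nth using ij by (simp add: s0 scd)
    from lift2_nth_1[OF l0 this, of q] show ?thesis
      unfolding lift2_lead fps_sub_nth outer_const_nth .
  qed
  have "refl_left (lift2 sc) I \<theta> (zm * zmk \<kappa>) (hp * zmk \<kappa>) (hp * zm) ml i i k l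
      = refl_right (lift2 sc) I \<theta> (zm * zmk \<kappa>) (hp * zmk \<kappa>) (hp * zm) mr i i k l"
    unfolding ml_def mr_def using ij by (intro reflection)
  then have "?A * (?A' * (?U i i * ?V k l - ?V k l * ?U i i)) =
      ?A * rr - lift2 sc (hp * zmk \<kappa>) * mr i l k i
        + (if l = - i then lift2 sc (hp * zm) * (\<Sum>m\<in>I. lift2 sc (\<theta> m i) * mr i m k (- m)) else 0)
      - (?A * rl - lift2 sc (hp * zmk \<kappa>) * ml k i i l
        + (if k = - i then lift2 sc (hp * zm) * (\<Sum>m\<in>I. lift2 sc (\<theta> i m) * ml m i (- m) l) else 0))"
    unfolding refl_left_def refl_right_def rl_def rr_def by (simp add: right_diff_distrib algebra_simps)
  from arg_cong[OF this, of "\<lambda>F. F $ 1 $ (q + 4)"]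
  have main: "s i i $ 1 * s k l $ q - s k l $ q * s i i $ 1 =
      ((if l = - i then sc (g i) * s k l $ q else 0) - (if l = i then sc (g i) * s k l $ q else 0)
       - (if l = i then sc (g i) * s k l $ q else 0) + (if l = - i then sc (g i) * s k l $ q else 0))
      - ((if k = - i then sc (g i) * s k l $ q else 0) - (if k = i then sc (g i) * s k l $ q else 0)
       - (if k = i then sc (g i) * s k l $ q else 0) + (if k = - i then sc (g i) * s k l $ q else 0))"
    unfolding fps_add_nth fps_sub_nth[of _ _ 1] fps_sub_nth[of _ _ "q + 4"] lead TL TR PL PR QL QR .
  have scm: "sc (- a) = - sc a" for a
    using sc_add[of a "- a"] by (simp add: sc_zero eq_neg_iff_add_eq_0 add.commute)
  have scd': "sc (a - b) = sc a - sc b" for a b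
    using sc_add[of a "- b"] by (simp add: scm)
  have s2: "sc (2 * a) = sc a + sc a" for a
    by (simp only: mult_2 sc_add)
  have F: "sc (g i * (if b then 1 else 0)) * s k l $ q = (if b then sc (g i) * s k l $ q else 0)" for b
    by (simp add: sc_zero)
  have ab: "(d - c - c + d) - (b - a - a + b) = (a - b - c + d) + (a - b - c + d)" for a b c d :: 'a
    by (simp add: algebra_simps)
  show ?thesis
    unfolding main ab mult.assoc[of 2] s2 right_diff_distrib[of "g i"] distrib_left[of "g i"] scd' sc_add
      left_diff_distrib distrib_right F ..
qed

end

section \<open>Highest weight vectors\<close>

lemma g_frac_0: "p \<noteq> q \<Longrightarrow> g_frac p q g $ 0 = g"
  by (simp add: g_frac_def Let_def)

lemma gmat_series_0:
  assumes "type_for ty N"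
  shows "gmat_series ty i $ 0 = gmat ty i"
proof (cases "\<exists>p q. frac_type ty p q")
  case True
  then obtain p q where "frac_type ty p q" by blast
  then show ?thesis
    using gmat_series_frac frac_type_neq[OF assms] by (simp add: g_frac_0)
qed (simp add: gmat_series_const)

lemma gmat_neq_0: "gmat ty i \<noteq> 0"
  by (metis gmat_sq mult_zero_left zero_neq_one)

lemma s_series_0:
  assumes "type_for ty N" "i \<in> idx N" "j \<in> idx N"
  shows "s_series ty N i j $ 0 = (if i = j then scalar (gmat ty i) else 0)"
proof -
  have t: "fps_subst scalar \<alpha> (t_series a b) $ 0 = (if a = b then 1 else 0)" for \<alpha> a b
    by (simp add: fps_subst_def t_series_def t_coeff_def)
  have "s_series ty N i j $ 0 = (\<Sum>a\<in>idx N. if a = i then (if i = j then scalar (gmat ty i * theta ty i i) else 0) else 0)"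
    unfolding s_series_eq[OF assms] fps_sum_nth
    by (rule sum.cong) (auto simp: t gmat_series_0[OF assms(1)] scalar_mult)
  also have "\<dots> = (if i = j then scalar (gmat ty i * theta ty i i) else 0)"
    using assms(2) finite_idx by simp
  also have "theta ty i i = 1"
    using idx_sgn[OF assms(1) _ assms(2)] by (cases i rule: linorder_cases[of _ 0]) (auto simp: theta_def)
  finally show ?thesis by simp
qed

context tw_rep
begin

abbreviation "I \<equiv> idx N"

lemma sigma_0: "i \<in> I \<Longrightarrow> j \<in> I \<Longrightarrow> \<sigma> i j $ 0 = (if i = j then sc (gmat ty i) else 0)"
proof -
  assume ij: "i \<in> I" "j \<in> I"
  have "1 \<in> D" 
    unfolding D_def twisted_yangian_def
    by (simp add: free_ring_1 yangian_class_one generate_ring.one)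
  then have "op (scalar c) = sc c" for c
    using pD.map_scalar[of 1 c] rho_scalar[of 1]
    by (intro endo_eqI) (simp add: app_op yangian_scalar_def)
  then show ?thesis using ij by (simp add: \<sigma>_def s_series_0[OF type] pD.map_zero)
qed

lemma theta_diag: "i \<in> I \<Longrightarrow> theta ty i i = 1"
  using idx_sgn[OF type] by (cases i rule: linorder_cases[of _ 0]) (auto simp: theta_def)

lemma app_scale: "a \<in> S.letter_set \<Longrightarrow> app (S.sl a) (scale c v) = scale c (app (S.sl a) v)"
  using arg_cong[OF S.sc_comm_sl[of a c], of "\<lambda>f. app f v"] by simp

lemma app_ev_scale: "w \<in> lists S.letter_set \<Longrightarrow> app (S.ev w) (scale c v) = scale c (app (S.ev w) v)"
  using arg_cong[OF S.sc_comm_ev[of w c], of "\<lambda>f. app f v"] by simp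

section \<open>Words in the generators and their action\<close>

definition words :: "'v endo set"
  where "words = S.ev ` lists S.letter_set"

lemma wordsI: "w \<in> lists S.letter_set \<Longrightarrow> S.ev w \<in> words"
  by (simp add: words_def)

lemma words_mult:
  assumes "a \<in> S.vs.span words" "b \<in> S.vs.span words"
  shows "a * b \<in> S.vs.span words"
  using assms(1)
proof (induct rule: S.vs.span_induct_alt)
  case base
  show ?case by (simp add: S.vs.span_zero)
next
  case (step c x y)
  then obtain u where u: "u \<in> lists S.letter_set" "x = S.ev u" by (auto simp: words_def)
  have "x * b \<in> S.vs.span words"
    using assms(2)
  proof (induct rule: S.vs.span_induct_alt)
    case (step d x' y')
    then obtain v where v: "v \<in> lists S.letter_set" "x' = S.ev v" by (auto simp: words_def)
    have "x * x' \<in> words" using wordsI[of "u @ v"] u v by simp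
    then have "sc d * (x * x') \<in> S.vs.span words" by (intro S.vs.span_scale S.vs.span_base)
    moreover have "x * (sc d * x') = sc d * (x * x')"
      using S.sc_comm_ev[OF u(1), of d] by (simp add: u(2) flip: mult.assoc)
    ultimately show ?case using step(2) by (simp add: distrib_left S.vs.span_add)
  qed (simp add: S.vs.span_zero)
  then have "sc c * (x * b) \<in> S.vs.span words" by (rule S.vs.span_scale)
  then show ?case using step(2) by (simp add: distrib_right mult.assoc S.vs.span_add)
qed

text \<open>The generated subring is compared with words at the level of operators, so the spanning
  result for \<open>refl_alg\<close> becomes applicable.\<close>

lemma TY_words:
  assumes "x \<in> TY"
  shows "\<exists>a\<in>S.vs.span words. \<forall>v. \<rho> x v = app a v"
  using assms unfolding twisted_yangian_def
proof (induct rule: generate_ring.induct)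
  case one
  have "\<rho> \<one>\<^bsub>EY\<^esub> v = app (S.ev []) v" for v
    using rho_scalar[of 1] by (simp add: yangian_scalar_def yangian_class_one)
  moreover have "S.ev [] \<in> S.vs.span words" by (intro S.vs.span_base wordsI) simp
  ultimately show ?case by blast
next
  case (incl h)
  then consider c where "h = yangian_scalar ty N c" | i j r where "h = s_coeff ty N i j r" "i \<in> I" "j \<in> I"
    by blast
  then show ?case
  proof cases
    case 1
    have "sc c * S.ev [] \<in> S.vs.span words"
      by (intro S.vs.span_scale S.vs.span_base wordsI) simp
    moreover have "\<rho> h v = app (sc c * S.ev []) v" for v by (simp add: 1 rho_scalar)
    ultimately show ?thesis by blast
  next
    case 2
    have "S.ev [(i, j, r)] \<in> S.vs.span words"
      using 2 by (intro S.vs.span_base wordsI) (simp add: S.letter_set_def)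
    moreover have "\<rho> h v = app (S.ev [(i, j, r)]) v" for v by (simp add: 2 S.sl_def app_sigma)
    ultimately show ?thesis by blast
  qed
next
  case (a_inv h)
  then obtain a where a: "a \<in> S.vs.span words" "\<And>v. \<rho> h v = app a v" by blast
  have h: "h \<in> TY" using a_inv(1) by (simp add: twisted_yangian_def)
  then have h': "\<ominus>\<^bsub>EY\<^esub> h \<in> TY" unfolding twisted_yangian_def by (rule generate_ring.a_inv)
  \<comment> \<open>A representation is specified on sums, products and scalars; its value on an
    additive inverse follows from the action of the scalar 0.\<close>
  have z: "\<zero>\<^bsub>EY\<^esub> = yangian_scalar ty N 0" by (simp add: yangian_scalar_def yangian_class_zero')
  have "\<rho> (h \<oplus>\<^bsub>EY\<^esub> \<ominus>\<^bsub>EY\<^esub> h) v = 0" for v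
    using EY.r_neg[OF TY_carrier[OF h]] by (simp add: z rho_scalar)
  then have "\<rho> (\<ominus>\<^bsub>EY\<^esub> h) v = app (- a) v" for v
  proof -
    have "app a v + \<rho> (\<ominus>\<^bsub>EY\<^esub> h) v = 0"
      using \<open>\<And>v. \<rho> (h \<oplus>\<^bsub>EY\<^esub> \<ominus>\<^bsub>EY\<^esub> h) v = 0\<close>[of v] unfolding rho_plus[OF h h'] a(2) .
    then show ?thesis by (simp add: eq_neg_iff_add_eq_0 add.commute)
  qed
  then show ?case using S.vs.span_neg[OF a(1)] by blast
next
  case (eng_add h1 h2)
  then obtain a b where a: "a \<in> S.vs.span words" "\<And>v. \<rho> h1 v = app a v"
    and b: "b \<in> S.vs.span words" "\<And>v. \<rho> h2 v = app b v" by blast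
  have "h1 \<in> TY" "h2 \<in> TY" using eng_add by (simp_all add: twisted_yangian_def)
  then have "\<rho> (h1 \<oplus>\<^bsub>EY\<^esub> h2) v = app (a + b) v" for v by (simp add: rho_plus a b)
  then show ?case using S.vs.span_add[OF a(1) b(1)] by blast
next
  case (eng_mult h1 h2)
  then obtain a b where a: "a \<in> S.vs.span words" "\<And>v. \<rho> h1 v = app a v"
    and b: "b \<in> S.vs.span words" "\<And>v. \<rho> h2 v = app b v" by blast
  have "h1 \<in> TY" "h2 \<in> TY" using eng_mult by (simp_all add: twisted_yangian_def)
  then have "\<rho> (h1 \<otimes>\<^bsub>EY\<^esub> h2) v = app (a * b) v" for v by (simp add: rho_mult a b)
  then show ?case using words_mult[OF a(1) b(1)] by blast
qed

lemma words_pieces: "S.vs.span words \<subseteq> S.vs.span S.pieces"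
  unfolding words_def by (rule S.vs.span_minimal) (blast intro: S.triangular_span, rule S.vs.subspace_span)

lemma invariant_TY:
  assumes Y: "V.subspace Y" "\<And>a y. a \<in> S.letter_set \<Longrightarrow> y \<in> Y \<Longrightarrow> app (S.sl a) y \<in> Y"
    and "x \<in> TY" "y \<in> Y"
  shows "\<rho> x y \<in> Y"
proof -
  obtain a where a: "a \<in> S.vs.span words" "\<And>v. \<rho> x v = app a v" using TY_words[OF assms(3)] by blast
  have ev: "app (S.ev w) y \<in> Y" if "w \<in> lists S.letter_set" for w
    using that by (induct w) (use assms in auto)
  have "app a y \<in> Y"
    using a(1)
  proof (induct rule: S.vs.span_induct_alt)
    case (step c x z)
    then obtain w where w: "w \<in> lists S.letter_set" "x = S.ev w" by (auto simp: words_def)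
    then show ?case
      using ev[OF w(1)] step(2) Y(1) by (simp add: V.subspace_add V.subspace_scale)
  qed (simp add: V.subspace_0[OF Y(1)])
  then show ?thesis by (simp add: a)
qed

text \<open>The weight -i/(2 g_ii) cancels the factor 2 g_ii of \<open>diagonal_commutator\<close>.
  With i restricted to positive values, the deltas at i and -i combine to the signed index, which
  yields the shift l - k.\<close>

definition H :: "'v endo"
  where "H = (\<Sum>i\<in>{i\<in>I. 0 < i}. sc (- of_int i / (2 * gmat ty i)) * \<sigma> i i $ 1)"

text \<open>Only i = |k| contributes, with the sign of k; for k = 0 nothing does.\<close>

lemma sum_pos_delta:
  assumes "k \<in> I"
  shows "(\<Sum>i\<in>{i\<in>I. 0 < i}. of_int i * ((if k = i then 1 else 0) - (if k = - i then 1 else 0))) = (of_int k :: complex)"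
proof -
  have fin: "finite {i\<in>I. 0 < i}" using finite_idx[of N] by simp
  have "(\<Sum>i\<in>{i\<in>I. 0 < i}. of_int i * ((if k = i then 1 else 0) - (if k = - i then 1 else 0)))
      = (\<Sum>i\<in>{i\<in>I. 0 < i}. if i = \<bar>k\<bar> then of_int k else (0::complex))"
    by (rule sum.cong) auto
  also have "\<dots> = of_int k"
    using assms fin neg_idx[of k N] by (auto simp: abs_if)
  finally show ?thesis .
qed

lemma H_commutator:
  assumes "k \<in> I" "l \<in> I"
  shows "H * \<sigma> k l $ q = \<sigma> k l $ q * H + sc (of_int (l - k)) * \<sigma> k l $ q"
proof -
  let ?J = "{i\<in>I. 0 < i}" and ?d = "\<lambda>(k::int) i. (if k = i then 1 else 0 :: complex)"
  let ?n = "\<lambda>i. ?d k i - ?d k (- i) - ?d l i + ?d l (- i)"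
  have "H * \<sigma> k l $ q - \<sigma> k l $ q * H
      = (\<Sum>i\<in>?J. sc (- of_int i / (2 * gmat ty i)) * (\<sigma> i i $ 1 * \<sigma> k l $ q - \<sigma> k l $ q * \<sigma> i i $ 1))"
    unfolding H_def sum_distrib_left sum_distrib_right sum_subtractf[symmetric]
  proof (rule sum.cong[OF refl])
    fix i
    have "\<sigma> k l $ q * (sc c * \<sigma> i i $ 1) = sc c * (\<sigma> k l $ q * \<sigma> i i $ 1)" for c
      using S.sc_comm[OF assms, of c q] by (simp flip: mult.assoc)
    then show "sc (- of_int i / (2 * gmat ty i)) * \<sigma> i i $ 1 * \<sigma> k l $ q
        - \<sigma> k l $ q * (sc (- of_int i / (2 * gmat ty i)) * \<sigma> i i $ 1)
      = sc (- of_int i / (2 * gmat ty i)) * (\<sigma> i i $ 1 * \<sigma> k l $ q - \<sigma> k l $ q * \<sigma> i i $ 1)"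
      by (simp only: right_diff_distrib mult.assoc)
  qed
  also have "\<dots> = (\<Sum>i\<in>?J. sc (- (of_int i * ?n i)) * \<sigma> k l $ q)"
  proof (rule sum.cong[OF refl])
    fix i assume i: "i \<in> ?J"
    then have c: "\<sigma> i i $ 1 * \<sigma> k l $ q - \<sigma> k l $ q * \<sigma> i i $ 1 = sc (2 * gmat ty i * ?n i) * \<sigma> k l $ q"
      by (intro S.diagonal_commutator[OF finite_idx refl]) (auto simp: assms theta_diag sigma_0)
    have "- of_int i / (2 * gmat ty i) * (2 * gmat ty i * ?n i) = - (of_int i * ?n i)"
      using gmat_neq_0[of ty i] by simp
    then show "sc (- of_int i / (2 * gmat ty i)) * (\<sigma> i i $ 1 * \<sigma> k l $ q - \<sigma> k l $ q * \<sigma> i i $ 1)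
        = sc (- (of_int i * ?n i)) * \<sigma> k l $ q"
      unfolding c by (simp only: mult.assoc[symmetric] S.sc_mult[symmetric])
  qed
  also have "\<dots> = sc (\<Sum>i\<in>?J. - (of_int i * ?n i)) * \<sigma> k l $ q"
  proof -
    have "additive sc" by (simp add: additive_def S.sc_add)
    show ?thesis unfolding additive.sum[OF \<open>additive sc\<close>] sum_distrib_right ..
  qed
  also have "(\<Sum>i\<in>?J. - (of_int i * ?n i)) = of_int (l - k)"
  proof -
    have "(\<Sum>i\<in>?J. - (of_int i * ?n i))
        = (\<Sum>i\<in>?J. of_int i * (?d l i - ?d l (- i))) - (\<Sum>i\<in>?J. of_int i * (?d k i - ?d k (- i)))"
      unfolding sum_subtractf[symmetric] by (rule sum.cong) (simp_all add: algebra_simps)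
    then show ?thesis using sum_pos_delta[OF assms(1)] sum_pos_delta[OF assms(2)] by simp
  qed
  finally show ?thesis by (simp add: algebra_simps)
qed

definition E :: "complex \<Rightarrow> 'v set"
  where "E \<mu> = {v. app H v = scale \<mu> v}"

lemma H_scale: "app H (scale c v) = scale c (app H v)"
proof -
  have "app (\<sigma> i i $ 1) (scale c v) = scale c (app (\<sigma> i i $ 1) v)" if "i \<in> I" for i
    using app_scale[of "(i, i, 1)"] that by (simp add: S.sl_def S.letter_set_def)
  then show ?thesis
    by (simp add: H_def sum_app V.scale_sum_right mult.commute)
qed

lemma subspace_E: "V.subspace (E \<mu>)"
  by (simp add: V.subspace_def E_def V.scale_right_distrib H_scale V.scale_left_commute)

lemma E_move:
  assumes "(k, l, q) \<in> S.letter_set" "v \<in> E \<mu>"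
  shows "app (S.sl (k, l, q)) v \<in> E (\<mu> + of_int (l - k))"
proof -
  have kl: "k \<in> I" "l \<in> I" using assms(1) by (auto simp: S.letter_set_def)
  have "app (H * \<sigma> k l $ q) v = app (\<sigma> k l $ q * H + sc (of_int (l - k)) * \<sigma> k l $ q) v"
    using H_commutator[OF kl] by simp
  then show ?thesis
    using assms(2) app_scale[OF assms(1)]
    by (simp add: E_def S.sl_def V.scale_left_distrib)
qed

end

section \<open>Irreducible representations of finite dimension\<close>

locale tw_irrep = tw_rep ty N scale \<rho>
  for ty :: pair_type and N :: nat and scale :: "complex \<Rightarrow> 'v::ab_group_add \<Rightarrow> 'v"
    and \<rho> :: "gen free_alg set \<Rightarrow> 'v \<Rightarrow> 'v" +
  fixes B :: "'v set"
  assumes fd: "finite_dimensional_vector_space scale B"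
    and irr: "irreducible_representation ty N scale \<rho>"
begin

lemma irreducible:
  assumes "V.subspace Y" "\<And>a y. a \<in> S.letter_set \<Longrightarrow> y \<in> Y \<Longrightarrow> app (S.sl a) y \<in> Y" "y \<in> Y" "y \<noteq> 0"
  shows "Y = UNIV"
proof -
  have "\<rho> x ` Y \<subseteq> Y" if "x \<in> TY" for x
    using invariant_TY[OF assms(1,2) that] by blast
  then have "Y = {0} \<or> Y = UNIV"
    using irr assms(1) unfolding irreducible_representation_def by blast
  then show ?thesis using assms(3,4) by blast
qed

lemma nontrivial: "\<exists>v::'v. v \<noteq> 0"
  using irr unfolding irreducible_representation_def by blast

text \<open>Starting from any eigenvalue \<omega>0 of H, eigenvectors for the distinct values
  \<omega>0 + m are independent, so only finitely many of these occur and the largest can be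
  taken.\<close>

lemma top_eigenvalue:
  "\<exists>\<omega> w. w \<in> E \<omega> \<and> w \<noteq> 0 \<and> (\<forall>n. n > 0 \<longrightarrow> E (\<omega> + of_nat n) = {0})"
proof -
  interpret finite_dimensional_vector_space scale B by (rule fd)
  obtain v0 :: 'v where "v0 \<noteq> 0" using nontrivial by blast
  then obtain \<omega>\<^sub>0 v where v: "v \<noteq> 0" "v \<in> E \<omega>\<^sub>0"
    using eigenvector_exists[OF fd, of "app H" UNIV v0] H_scale by (auto simp: E_def)
  define M where "M = {m::nat. E (\<omega>\<^sub>0 + of_nat m) \<noteq> {0}}"
  have "\<exists>x. x \<in> E (\<omega>\<^sub>0 + of_nat m) \<and> x \<noteq> 0" if "m \<in> M" for m
    using that V.subspace_0[OF subspace_E[of "\<omega>\<^sub>0 + of_nat m"]] unfolding M_def by blast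
  then obtain e where e: "\<And>m. m \<in> M \<Longrightarrow> e m \<in> E (\<omega>\<^sub>0 + of_nat m) \<and> e m \<noteq> 0" by metis
  have inj: "inj_on e M"
  proof (rule inj_onI)
    fix m n assume mn: "m \<in> M" "n \<in> M" "e m = e n"
    have "app H (e m) = scale (\<omega>\<^sub>0 + of_nat m) (e m)" using e[OF mn(1)] by (simp add: E_def)
    moreover have "app H (e m) = scale (\<omega>\<^sub>0 + of_nat n) (e m)" using e[OF mn(2)] mn(3) by (simp add: E_def)
    ultimately have "scale (\<omega>\<^sub>0 + of_nat m) (e m) = scale (\<omega>\<^sub>0 + of_nat n) (e m)" by (rule trans[OF sym])
    then show "m = n" using e[OF mn(1)] by auto
  qed
  have "V.independent (e ` M)"
  proof (rule V.eigenvectors_independent[where f = "app H" and \<mu> = "\<lambda>v. \<omega>\<^sub>0 + of_nat (the_inv_into M e v)"])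
    show "v \<noteq> 0 \<and> app H v = scale (\<omega>\<^sub>0 + of_nat (the_inv_into M e v)) v" if "v \<in> e ` M" for v
      using that e by (auto simp: the_inv_into_f_f[OF inj] E_def)
    show "inj_on (\<lambda>v. \<omega>\<^sub>0 + of_nat (the_inv_into M e v)) (e ` M)"
      by (auto simp: inj_on_def the_inv_into_f_f[OF inj])
  qed (simp_all add: H_scale)
  then have "finite M" using finiteI_independent finite_imageD[OF _ inj] by blast
  moreover have "0 \<in> M" using v by (auto simp: M_def)
  ultimately have M: "Max M \<in> M" "\<And>n. n > 0 \<Longrightarrow> Max M + n \<notin> M"
    by (auto intro: Max_in) (metis Max_ge add.right_neutral add_le_cancel_left leD)
  define \<omega> where "\<omega> = \<omega>\<^sub>0 + of_nat (Max M)"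
  have "E (\<omega> + of_nat n) = {0}" if "n > 0" for n
    using M(2)[OF that] by (auto simp: M_def \<omega>_def add.assoc)
  moreover have "e (Max M) \<in> E \<omega>" "e (Max M) \<noteq> 0" using e[OF M(1)] by (simp_all add: \<omega>_def)
  ultimately show ?thesis by blast
qed

end

section \<open>The top eigenspace of H\<close>

locale tw_top = tw_irrep ty N scale \<rho> B
  for ty N and scale :: "complex \<Rightarrow> 'v::ab_group_add \<Rightarrow> 'v" and \<rho> B +
  fixes \<omega> :: complex and w0 :: 'v
  assumes w0: "w0 \<in> E \<omega>" "w0 \<noteq> 0" and top: "\<And>n. n > 0 \<Longrightarrow> E (\<omega> + of_nat n) = {0}"
begin

text \<open>\<open>below m\<close> is the product of \<open>H - \<omega> + j\<close> for \<open>1 \<le> j \<le> m\<close>; it detects the eigenspaces below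
  the top one.\<close>

primrec below :: "nat \<Rightarrow> 'v \<Rightarrow> 'v" where
  "below 0 v = v"
| "below (Suc m) v = app H (below m v) - scale (\<omega> - of_nat (Suc m)) (below m v)"

lemma below_add: "below m (v + w) = below m v + below m w"
  by (induct m) (simp_all add: V.scale_right_distrib)

lemma below_scale: "below m (scale c v) = scale c (below m v)"
  by (induct m) (simp_all add: H_scale V.scale_right_diff_distrib V.scale_left_commute)

lemma below_zero: "below m 0 = 0"
  by (induct m) simp_all

lemma below_mono: "below m v = 0 \<Longrightarrow> m \<le> n \<Longrightarrow> below n v = 0"
  by (induct n) (auto simp: le_Suc_eq)

text \<open>A subspace containing every \<open>E (\<omega> - of_nat n)\<close> with n > 0 and
  meeting \<open>E \<omega>\<close> in 0; it acts as a complement of the top eigenspace, with no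
  projections to be defined.\<close>

definition lower :: "'v set"
  where "lower = {v. \<exists>m. below m v = 0}"

lemma subspace_lower: "V.subspace lower"
  unfolding V.subspace_def lower_def
proof (intro conjI ballI allI)
  show "0 \<in> {v. \<exists>m. below m v = 0}" using below_zero by blast
  fix x y assume "x \<in> {v. \<exists>m. below m v = 0}" "y \<in> {v. \<exists>m. below m v = 0}"
  then obtain m n where "below m x = 0" "below n y = 0" by blast
  then have "below (max m n) (x + y) = 0"
    using below_mono[of m x "max m n"] below_mono[of n y "max m n"] by (simp add: below_add)
  then show "x + y \<in> {v. \<exists>m. below m v = 0}" by blast
next
  fix c x assume "x \<in> {v. \<exists>m. below m v = 0}"
  then show "scale c x \<in> {v. \<exists>m. below m v = 0}" by (auto simp: below_scale)
qed

lemma below_E: "v \<in> E \<mu> \<Longrightarrow> below m v = scale (\<Prod>j<m. \<mu> - \<omega> + of_nat (Suc j)) v"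
proof (induct m)
  case (Suc m)
  then have H: "app H v = scale \<mu> v" by (simp add: E_def)
  show ?case
    unfolding below.simps Suc(1)[OF Suc(2)]
    by (simp add: H_scale H algebra_simps flip: V.scale_left_diff_distrib)
qed simp

lemma E_lower:
  assumes "v \<in> E (\<omega> - of_nat n)" "n > 0"
  shows "v \<in> lower"
proof -
  obtain k where "n = Suc k" using assms(2) by (cases n) auto
  \<comment> \<open>The factor with j = n - 1 vanishes.\<close>
  then have "below n v = 0"
    unfolding below_E[OF assms(1)] by simp
  then show ?thesis by (auto simp: lower_def)
qed

text \<open>On \<open>E \<omega>\<close> the operator \<open>below m\<close> is multiplication by
  m!.\<close>

lemma top_lower:
  assumes "v \<in> E \<omega>" "v \<in> lower"
  shows "v = 0"
proof -
  obtain m where "below m v = 0" using assms(2) by (auto simp: lower_def)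
  then have "scale (\<Prod>j<m. of_nat (Suc j)) v = 0" using below_E[OF assms(1), of m] by simp
  moreover have "(\<Prod>j<m. of_nat (Suc j) :: complex) \<noteq> 0"
    by (simp add: prod_zero_iff del: of_nat_Suc)
  ultimately show ?thesis by (simp only: V.scale_eq_0_iff) simp
qed

lemma E_int:
  assumes "v \<in> E (\<omega> + of_int n)" "n > 0"
  shows "v = 0"
  using assms top[of "nat n"] by (auto simp: of_nat_nat)

text \<open>The span is invariant: a letter shifts the eigenvalue by an integer, and a shift past
  \<omega> gives 0. It contains \<open>w0\<close>, so irreducibility makes it everything.\<close>

lemma weight_span: "V.span (\<Union>k. E (\<omega> - of_nat k)) = UNIV"
proof (rule irreducible)
  fix a y assume a: "a \<in> S.letter_set" and "y \<in> V.span (\<Union>k. E (\<omega> - of_nat k))"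
  obtain k l q where akl: "a = (k, l, q)" by (metis prod_cases3)
  from \<open>y \<in> _\<close> show "app (S.sl a) y \<in> V.span (\<Union>k. E (\<omega> - of_nat k))"
  proof (induct rule: V.span_induct_alt)
    case (step c x y)
    then obtain n where "x \<in> E (\<omega> - of_nat n)" by blast
    then have "app (S.sl a) x \<in> E (\<omega> - of_nat n + of_int (l - k))"
      using E_move a unfolding akl by blast
    then have x: "app (S.sl a) x \<in> E (\<omega> + of_int (l - k - int n))"
      by (simp add: algebra_simps)
    have "app (S.sl a) x \<in> V.span (\<Union>k. E (\<omega> - of_nat k))"
    proof (cases "l - k - int n > 0")
      case True
      then show ?thesis using E_int[OF x] V.span_zero by simp
    next
      case False
      then have "\<omega> + of_int (l - k - int n) = \<omega> - of_nat (nat (int n + k - l))"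
        by (simp add: of_nat_nat)
      then show ?thesis using x by (intro V.span_base UN_I) (simp_all only: UNIV_I)
    qed
    then show ?case
      using step(2) by (simp add: app_scale[OF a] V.span_add V.span_scale)
  qed (simp add: V.span_zero)
next
  show "w0 \<in> V.span (\<Union>k. E (\<omega> - of_nat k))"
    using w0(1) by (intro V.span_base UN_I[of 0]) auto
qed (use w0 in \<open>auto simp: V.subspace_span\<close>)

text \<open>Every vector is a sum of eigenvectors for values \<omega> - n, each of which a lowering
  letter takes strictly below \<omega>.\<close>

lemma lowering_lower:
  assumes "a \<in> S.lowering"
  shows "app (S.sl a) v \<in> lower"
proof -
  obtain k l q where akl: "a = (k, l, q)" "l < k" and a: "a \<in> S.letter_set"
    using assms by (auto simp: S.lowering_def S.letter_set_def)
  have "v \<in> V.span (\<Union>k. E (\<omega> - of_nat k))" using weight_span by simp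
  then show ?thesis
  proof (induct rule: V.span_induct_alt)
    case (step c x y)
    then obtain n where "x \<in> E (\<omega> - of_nat n)" by blast
    then have "app (S.sl a) x \<in> E (\<omega> - of_nat n + of_int (l - k))"
      using E_move a unfolding akl by blast
    moreover have "\<omega> - of_nat n + of_int (l - k) = \<omega> - of_nat (n + nat (k - l))"
      using akl(2) by (simp add: of_nat_nat)
    ultimately have "app (S.sl a) x \<in> E (\<omega> - of_nat (n + nat (k - l)))" by (simp only:)
    then have "app (S.sl a) x \<in> lower" by (rule E_lower) (use akl(2) in simp)
    then show ?case
      using step(2) by (simp add: app_scale[OF a] V.subspace_add V.subspace_scale subspace_lower)
  qed (simp add: V.subspace_0[OF subspace_lower])
qed

lemma raising_top:
  assumes "a \<in> S.raising" "v \<in> E \<omega>"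
  shows "app (S.sl a) v = 0"
proof -
  obtain k l q where akl: "a = (k, l, q)" "k < l" and a: "a \<in> S.letter_set"
    using assms by (auto simp: S.raising_def S.letter_set_def)
  have "app (S.sl a) v \<in> E (\<omega> + of_int (l - k))"
    using E_move a assms(2) unfolding akl by blast
  then show ?thesis using akl(2) by (intro E_int[of _ "l - k"]) auto
qed

lemma diag_E:
  assumes "a \<in> S.diag" "v \<in> E \<mu>"
  shows "app (S.sl a) v \<in> E \<mu>"
proof -
  obtain i r where a: "a = (i, i, r)" "(i, i, r) \<in> S.letter_set"
    using assms by (auto simp: S.diag_def S.letter_set_def)
  show ?thesis using E_move[OF a(2) assms(2)] a(1) by simp
qed

lemma diag_letter: "S.diag \<subseteq> S.letter_set"
  by (auto simp: S.diag_def S.letter_set_def)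

text \<open>Gelfand's trick: modulo the words that begin with a lowering or end with a raising letter,
  every element is fixed by the transposition, which reverses products of diagonal letters.\<close>

lemma diag_commute:
  assumes "a \<in> S.diag" "b \<in> S.diag" "v \<in> E \<omega>"
  shows "app (S.sl a) (app (S.sl b) v) = app (S.sl b) (app (S.sl a) v)"
proof -
  interpret T: refl_alg "\<lambda>c. Dbl (sc c) (sc c)" I "\<lambda>i j. k2 (theta ty i j)" "kappa ty N"
    "\<lambda>i j. Abs_fps (\<lambda>r. Dbl (\<sigma> i j $ r) (\<sigma> j i $ r))"
    by (rule refl_alg_dbl[OF S.refl_alg_axioms]) (simp add: theta_def mult.commute)
  define tr :: "letter \<Rightarrow> letter" where "tr = (\<lambda>(i, j, r). (j, i, r))"
  have sl: "T.sl a = Dbl (S.sl a) (S.sl (tr a))" for a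
    by (cases a) (simp add: T.sl_def S.sl_def tr_def)
  have ev: "T.ev w = Dbl (S.ev w) (S.ev (rev (map tr w)))" for w
    by (induct w) (simp_all add: sl one_dbl_def times_dbl_def)
  have tr: "a \<in> S.lowering \<Longrightarrow> tr a \<in> S.raising" "a \<in> S.raising \<Longrightarrow> tr a \<in> S.lowering"
    "a \<in> S.letter_set \<Longrightarrow> tr a \<in> S.letter_set" for a
    by (auto simp: tr_def S.lowering_def S.raising_def S.letter_set_def)
  have tr_diag: "map tr w = w" if "w \<in> lists S.diag" for w
    using that by (induct w) (auto simp: tr_def S.diag_def)
  have trw: "rev (map tr w) \<in> lists S.letter_set" if "w \<in> lists S.letter_set" for w
    using that tr(3) by auto
  have low: "S.lowering \<subseteq> S.letter_set" "S.raising \<subseteq> S.letter_set"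
    by (auto simp: S.lowering_def S.raising_def S.letter_set_def)
  \<comment> \<open>The second conjunct is carried along because scaling a pair puts the scalar on
    the right of the second component, from where it must be pulled out.\<close>
  have "(\<forall>v\<in>E \<omega>. app (dfst x - dsnd x) v \<in> lower) \<and> (\<forall>c v. app (dsnd x) (scale c v) = scale c (app (dsnd x) v))"
    if "x \<in> T.vs.span T.pieces" for x
    using that
  proof (induct rule: T.vs.span_induct_alt)
    case base
    show ?case by (simp add: V.subspace_0[OF subspace_lower])
  next
    case (step c x y)
    have "(\<forall>v\<in>E \<omega>. app (dfst x - dsnd x) v \<in> lower) \<and> (\<forall>c v. app (dsnd x) (scale c v) = scale c (app (dsnd x) v))"
      using step(1) unfolding T.pieces_def
    proof (elim UnE CollectE exE conjE)
      fix w assume w: "x = T.ev w + T.ev (rev w)" "w \<in> lists S.diag"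
      then have w': "rev w \<in> lists S.diag" "w \<in> lists S.letter_set" "rev w \<in> lists S.letter_set"
        using diag_letter by auto
      have d: "dfst x = S.ev w + S.ev (rev w)" "dsnd x = S.ev (rev w) + S.ev w"
        using tr_diag[OF w(2)] tr_diag[OF w'(1)] by (simp_all add: w(1) ev)
      show ?thesis
        unfolding d by (simp add: add.commute V.subspace_0[OF subspace_lower] app_ev_scale w' V.scale_right_distrib)
    next
      fix a w assume x: "x = T.sl a * T.ev w" and a: "a \<in> S.lowering" and w: "w \<in> lists S.letter_set"
      have d: "dfst x = S.sl a * S.ev w" "dsnd x = S.ev (rev (map tr w)) * S.sl (tr a)"
        by (simp_all add: x sl ev)
      have "tr a \<in> S.letter_set" using a low tr(3) by blast
      then show ?thesis
        unfolding d by (simp add: raising_top[OF tr(1)[OF a]] lowering_lower[OF a] app_scale app_ev_scale[OF trw[OF w]])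
    next
      fix a w assume x: "x = T.ev w * T.sl a" and a: "a \<in> S.raising" and w: "w \<in> lists S.letter_set"
      have d: "dfst x = S.ev w * S.sl a" "dsnd x = S.sl (tr a) * S.ev (rev (map tr w))"
        by (simp_all add: x sl ev)
      have "tr a \<in> S.letter_set" using a low tr(3) by blast
      then show ?thesis
        unfolding d by (simp add: raising_top[OF a] V.subspace_neg[OF subspace_lower lowering_lower[OF tr(2)[OF a]]]
            app_scale app_ev_scale[OF trw[OF w]])
    qed
    then have x: "\<And>v. v \<in> E \<omega> \<Longrightarrow> app (dfst x) v - app (dsnd x) v \<in> lower"
      "\<And>c v. app (dsnd x) (scale c v) = scale c (app (dsnd x) v)" by simp_all
    have y: "\<And>v. v \<in> E \<omega> \<Longrightarrow> app (dfst y) v - app (dsnd y) v \<in> lower"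
      "\<And>c v. app (dsnd y) (scale c v) = scale c (app (dsnd y) v)" using step(2) by simp_all
    have "scale c (app (dfst x) v) + app (dfst y) v - (scale c (app (dsnd x) v) + app (dsnd y) v) \<in> lower"
      if "v \<in> E \<omega>" for v
    proof -
      have "scale c (app (dfst x) v - app (dsnd x) v) + (app (dfst y) v - app (dsnd y) v) \<in> lower"
        using x(1)[OF that] y(1)[OF that] by (intro V.subspace_add V.subspace_scale subspace_lower)
      then show ?thesis by (simp add: V.scale_right_diff_distrib algebra_simps)
    qed
    then show ?case
      by (simp add: x(2) y(2) V.scale_right_distrib mult.commute)
  qed
  \<comment> \<open>The components of this pair are the two products of the letters a and b in
    either order, since \<open>tr\<close> fixes diagonal letters.\<close>
  moreover have "T.ev [a, b] \<in> T.vs.span T.pieces"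
    using assms(1,2) diag_letter by (intro T.triangular_span) auto
  ultimately have "app (dfst (T.ev [a, b]) - dsnd (T.ev [a, b])) v \<in> lower" using assms(3) by blast
  moreover have "tr a = a" "tr b = b" using assms(1,2) by (auto simp: tr_def S.diag_def)
  ultimately have "app (S.sl a) (app (S.sl b) v) - app (S.sl b) (app (S.sl a) v) \<in> lower"
    by (simp add: ev del: T.ev_simps)
  moreover have "app (S.sl a) (app (S.sl b) v) - app (S.sl b) (app (S.sl a) v) \<in> E \<omega>"
    by (intro V.subspace_diff[OF subspace_E] diag_E assms)
  ultimately have "app (S.sl a) (app (S.sl b) v) - app (S.sl b) (app (S.sl a) v) = 0"
    using top_lower by blast
  then show ?thesis by simp
qed

lemma top_eigenvector:
  "\<exists>\<eta>\<in>E \<omega>. \<eta> \<noteq> 0 \<and> (\<forall>a\<in>S.diag. \<exists>\<mu>. app (S.sl a) \<eta> = scale \<mu> \<eta>)"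
proof -
  have "\<exists>\<eta>\<in>E \<omega>. \<eta> \<noteq> 0 \<and> (\<forall>f\<in>(\<lambda>a. app (S.sl a)) ` S.diag. \<exists>\<mu>. f \<eta> = scale \<mu> \<eta>)"
    by (rule common_eigenvector[OF fd])
       (use w0 diag_letter diag_E diag_commute subspace_E app_scale in auto)
  then show ?thesis by simp
qed

text \<open>Of the three kinds of pieces, diagonal words keep \<eta> in Y, lowering letters end in
  \<open>lower\<close>, raising letters kill \<eta>. Applied with Y the line of \<eta> and with Y an
  eigenspace of H whose eigenvalue is not yet known to be \<omega>.\<close>

lemma words_eigenspace:
  assumes \<eta>: "\<eta> \<in> E \<mu>" and raise: "\<And>a. a \<in> S.raising \<Longrightarrow> app (S.sl a) \<eta> = 0"
    and Y: "V.subspace Y" "\<eta> \<in> Y" "\<And>a y. a \<in> S.diag \<Longrightarrow> y \<in> Y \<Longrightarrow> app (S.sl a) y \<in> Y"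
    and a: "a \<in> S.vs.span words"
  shows "\<exists>y\<in>Y. app a \<eta> - y \<in> lower"
proof -
  have ev: "app (S.ev w) \<eta> \<in> Y" if "w \<in> lists S.diag" for w
    using that by (induct w) (use Y in auto)
  have low0: "0 \<in> lower" by (rule V.subspace_0[OF subspace_lower])
  from a have "a \<in> S.vs.span S.pieces" using words_pieces by blast
  then show ?thesis
  proof (induct rule: S.vs.span_induct_alt)
    case base
    show ?case using low0 V.subspace_0[OF Y(1)] by (intro bexI[of _ 0]) simp_all
  next
    case (step c x z)
    have "\<exists>y\<in>Y. app x \<eta> - y \<in> lower"
      using step(1) unfolding S.pieces_def
    proof (elim UnE CollectE exE conjE)
      fix w assume w: "x = S.ev w + S.ev (rev w)" "w \<in> lists S.diag"
      then have "rev w \<in> lists S.diag" by auto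
      then have "app x \<eta> \<in> Y" using ev[OF w(2)] ev[of "rev w"] V.subspace_add[OF Y(1)] by (simp add: w(1))
      then show ?thesis using low0 by (intro bexI[of _ "app x \<eta>"]) simp_all
    next
      fix b w assume "x = S.sl b * S.ev w" "b \<in> S.lowering"
      then have "app x \<eta> \<in> lower" using lowering_lower by simp
      then show ?thesis using V.subspace_0[OF Y(1)] by (intro bexI[of _ 0]) simp_all
    next
      fix b w assume "x = S.ev w * S.sl b" "b \<in> S.raising"
      then have "app x \<eta> = 0" using raise by simp
      then show ?thesis using V.subspace_0[OF Y(1)] low0 by (intro bexI[of _ 0]) simp_all
    qed
    then obtain y where y: "y \<in> Y" "app x \<eta> - y \<in> lower" by blast
    obtain y' where y': "y' \<in> Y" "app z \<eta> - y' \<in> lower" using step(2) by blast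
    have "scale c (app x \<eta> - y) + (app z \<eta> - y') \<in> lower"
      using y(2) y'(2) by (intro V.subspace_add V.subspace_scale subspace_lower)
    then have "app (sc c * x + z) \<eta> - (scale c y + y') \<in> lower"
      by (simp add: V.scale_right_diff_distrib algebra_simps)
    moreover have "scale c y + y' \<in> Y" using y(1) y'(1) Y(1) by (intro V.subspace_add V.subspace_scale)
    ultimately show ?case by blast
  qed
qed

lemma cyclic:
  assumes "\<eta> \<noteq> 0"
  shows "(\<lambda>x. \<rho> x \<eta>) ` TY = UNIV"
proof (rule irreducible)
  show "V.subspace ((\<lambda>x. \<rho> x \<eta>) ` TY)"
    unfolding V.subspace_def
  proof (intro conjI ballI allI)
    show "0 \<in> (\<lambda>x. \<rho> x \<eta>) ` TY"
      using scalar_in_TY[of 0] rho_scalar[of 0] by (intro image_eqI[of _ _ "yangian_scalar ty N 0"]) simp_all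
    fix v w assume "v \<in> (\<lambda>x. \<rho> x \<eta>) ` TY" "w \<in> (\<lambda>x. \<rho> x \<eta>) ` TY"
    then obtain x y where "x \<in> TY" "y \<in> TY" "v = \<rho> x \<eta>" "w = \<rho> y \<eta>" by blast
    then show "v + w \<in> (\<lambda>x. \<rho> x \<eta>) ` TY"
      by (intro image_eqI[of _ _ "x \<oplus>\<^bsub>EY\<^esub> y"]) (simp_all add: rho_plus TY_add)
  next
    fix c v assume "v \<in> (\<lambda>x. \<rho> x \<eta>) ` TY"
    then obtain x where "x \<in> TY" "v = \<rho> x \<eta>" by blast
    then show "scale c v \<in> (\<lambda>x. \<rho> x \<eta>) ` TY"
      using scalar_in_TY[of c]
      by (intro image_eqI[of _ _ "yangian_scalar ty N c \<otimes>\<^bsub>EY\<^esub> x"]) (simp_all add: rho_mult rho_scalar TY_mult)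
  qed
  fix a v assume a: "a \<in> S.letter_set" and "v \<in> (\<lambda>x. \<rho> x \<eta>) ` TY"
  then obtain x where x: "x \<in> TY" "v = \<rho> x \<eta>" by blast
  obtain i j r where ij: "a = (i, j, r)" "i \<in> I" "j \<in> I" using a by (auto simp: S.letter_set_def)
  have "app (S.sl a) v = \<rho> (s_coeff ty N i j r \<otimes>\<^bsub>EY\<^esub> x) \<eta>"
    using ij x s_coeff_in_TY[OF ij(2,3), of r] by (simp add: S.sl_def app_sigma rho_mult)
  then show "app (S.sl a) v \<in> (\<lambda>x. \<rho> x \<eta>) ` TY"
    using ij x s_coeff_in_TY[OF ij(2,3), of r] TY_mult by blast
next
  show "\<eta> \<in> (\<lambda>x. \<rho> x \<eta>) ` TY"
    using scalar_in_TY[of 1] rho_scalar[of 1] by (intro image_eqI[of _ _ "yangian_scalar ty N 1"]) simp_all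
qed (rule assms)

lemma all_words:
  assumes "\<eta> \<noteq> 0"
  shows "\<exists>a\<in>S.vs.span words. v = app a \<eta>"
proof -
  have "v \<in> (\<lambda>x. \<rho> x \<eta>) ` TY" using cyclic[OF assms] by simp
  then show ?thesis using TY_words by blast
qed

text \<open>Any v is obtained from \<eta> by words, hence is congruent to a multiple of \<eta>
  modulo \<open>lower\<close>; inside \<open>E \<omega>\<close> the congruence is an
  equality.\<close>

lemma top_line:
  assumes \<eta>: "\<eta> \<in> E \<omega>" "\<eta> \<noteq> 0" and diag: "\<And>a. a \<in> S.diag \<Longrightarrow> \<exists>\<mu>. app (S.sl a) \<eta> = scale \<mu> \<eta>"
    and v: "v \<in> E \<omega>"
  shows "\<exists>c. v = scale c \<eta>"
proof -
  obtain a where a: "a \<in> S.vs.span words" "v = app a \<eta>" using all_words[OF \<eta>(2)] by blast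
  have "\<exists>y\<in>range (\<lambda>c. scale c \<eta>). app a \<eta> - y \<in> lower"
  proof (rule words_eigenspace[OF \<eta>(1) _ _ _ _ a(1)])
    show "app (S.sl b) \<eta> = 0" if "b \<in> S.raising" for b by (rule raising_top[OF that \<eta>(1)])
    show "V.subspace (range (\<lambda>c. scale c \<eta>))"
      using V.subspace_span[of "{\<eta>}"] by (simp add: V.span_singleton)
    show "\<eta> \<in> range (\<lambda>c. scale c \<eta>)" by (rule range_eqI[of _ _ 1]) simp
    fix b y assume b: "b \<in> S.diag" and "y \<in> range (\<lambda>c. scale c \<eta>)"
    then obtain c \<mu> where "y = scale c \<eta>" "app (S.sl b) \<eta> = scale \<mu> \<eta>" using diag by blast
    then show "app (S.sl b) y \<in> range (\<lambda>c. scale c \<eta>)"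
      using app_scale[of b c \<eta>] b diag_letter by auto
  qed
  then obtain c where "v - scale c \<eta> \<in> lower" using a(2) by blast
  moreover have "v - scale c \<eta> \<in> E \<omega>"
    using v \<eta>(1) by (intro V.subspace_diff V.subspace_scale subspace_E)
  ultimately have "v - scale c \<eta> = 0" using top_lower by blast
  then show ?thesis by auto
qed

section \<open>Existence and uniqueness of the highest weight vector\<close>

lemma letterI: "i \<in> I \<Longrightarrow> j \<in> I \<Longrightarrow> app (S.sl (i, j, r)) v = \<rho> (s_coeff ty N i j r) v"
  by (simp add: S.sl_def app_sigma)

lemma highest_weight_exists: "\<exists>\<eta>. highest_weight_vector ty N scale \<rho> \<eta>"
proof -
  obtain \<eta> where \<eta>: "\<eta> \<in> E \<omega>" "\<eta> \<noteq> 0" and d: "\<And>a. a \<in> S.diag \<Longrightarrow> \<exists>\<mu>. app (S.sl a) \<eta> = scale \<mu> \<eta>"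
    using top_eigenvector by blast
  have "\<exists>\<mu>. \<rho> (s_coeff ty N i i r) \<eta> = scale \<mu> \<eta>" if "i \<in> I" for i r
    using d[of "(i, i, r)"] that by (simp add: S.diag_def letterI)
  then obtain \<nu> where \<nu>: "\<And>i r. i \<in> I \<Longrightarrow> \<rho> (s_coeff ty N i i r) \<eta> = scale (\<nu> i r) \<eta>" by metis
  have "highest_weight_vector ty N scale \<rho> \<eta>"
    unfolding highest_weight_vector_def
  proof (intro conjI ballI impI allI exI[of _ "\<lambda>i. Abs_fps (\<nu> i)"])
    show "\<eta> \<noteq> 0" "(\<lambda>x. \<rho> x \<eta>) ` TY = UNIV" using \<eta>(2) cyclic by auto
    show "\<rho> (s_coeff ty N i j r) \<eta> = 0" if "i \<in> I" "j \<in> I" "i < j" for i j r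
      using raising_top[OF _ \<eta>(1), of "(i, j, r)"] that by (simp add: S.raising_def letterI)
    fix i assume i: "i \<in> I"
    show "\<rho> (s_coeff ty N i i r) \<eta> = scale (Abs_fps (\<nu> i) $ r) \<eta>" for r using \<nu>[OF i] by simp
    \<comment> \<open>The coefficient of superscript 0 is the scalar g_ii, which fixes the constant
      term of the weight.\<close>
    have "scale (gmat ty i) \<eta> = scale (\<nu> i 0) \<eta>"
      using \<nu>[OF i, of 0] app_sigma[OF i i, of 0 \<eta>] by (simp add: sigma_0 i)
    then show "Abs_fps (\<nu> i) $ 0 = gmat ty i" using \<eta>(2) by auto
  qed
  then show ?thesis by blast
qed

text \<open>A highest weight vector is an eigenvector of H, say for \<mu>, and generates V. So
  \<open>w0\<close> lies in \<open>E \<mu>\<close> modulo \<open>lower\<close>, and applying a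
  suitable \<open>below m\<close> yields a nonzero common element of \<open>E \<mu>\<close> and
  \<open>E \<omega>\<close>.\<close>

lemma highest_weight_top:
  assumes "highest_weight_vector ty N scale \<rho> \<eta>"
  shows "\<eta> \<in> E \<omega>"
proof -
  obtain \<nu> where "\<eta> \<noteq> 0" and raise: "\<And>i j r. i \<in> I \<Longrightarrow> j \<in> I \<Longrightarrow> i < j \<Longrightarrow> \<rho> (s_coeff ty N i j r) \<eta> = 0"
    and \<nu>: "\<And>i r. i \<in> I \<Longrightarrow> i \<ge> 0 \<Longrightarrow> \<rho> (s_coeff ty N i i r) \<eta> = scale (\<nu> i $ r) \<eta>"
    using assms unfolding highest_weight_vector_def by blast
  define \<mu> where "\<mu> = (\<Sum>i\<in>{i\<in>I. 0 < i}. - of_int i / (2 * gmat ty i) * \<nu> i $ 1)"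
  have "app H \<eta> = (\<Sum>i\<in>{i\<in>I. 0 < i}. scale (- of_int i / (2 * gmat ty i) * \<nu> i $ 1) \<eta>)"
    unfolding H_def sum_app by (rule sum.cong) (simp_all add: app_sigma \<nu>)
  then have \<mu>: "\<eta> \<in> E \<mu>" by (simp add: E_def \<mu>_def V.scale_sum_left)
  obtain a where a: "a \<in> S.vs.span words" "w0 = app a \<eta>" using all_words[OF \<open>\<eta> \<noteq> 0\<close>] by blast
  have "\<exists>y\<in>E \<mu>. app a \<eta> - y \<in> lower"
    by (rule words_eigenspace[OF \<mu> _ subspace_E \<mu> diag_E a(1)])
       (auto simp: S.raising_def letterI raise)
  then obtain y where y: "y \<in> E \<mu>" "w0 - y \<in> lower" using a(2) by blast
  then obtain m where "below m (w0 - y) = 0" by (auto simp: lower_def)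
  \<comment> \<open>This vector lies in both eigenspaces and is nonzero by \<open>top_lower\<close>,
    which forces \<mu> = \<omega>.\<close>
  then have "below m w0 = below m y"
    using below_add[of m "w0 - y" y] by simp
  moreover have "below m y \<in> E \<mu>" unfolding below_E[OF y(1)] by (intro V.subspace_scale subspace_E y)
  moreover have "below m w0 \<in> E \<omega>" unfolding below_E[OF w0(1)] by (intro V.subspace_scale subspace_E w0)
  moreover have "below m w0 \<noteq> 0" using top_lower[OF w0(1)] w0(2) by (auto simp: lower_def)
  ultimately have "scale \<mu> (below m w0) = scale \<omega> (below m w0)" by (simp add: E_def)
  then have "\<mu> = \<omega>" using \<open>below m w0 \<noteq> 0\<close> by auto
  then show ?thesis using \<mu> by simp
qed

lemma highest_weight_unique:
  assumes "highest_weight_vector ty N scale \<rho> \<eta>" "highest_weight_vector ty N scale \<rho> \<eta>'"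
  shows "\<exists>c. \<eta>' = scale c \<eta>"
proof -
  obtain \<xi> where \<xi>: "\<xi> \<in> E \<omega>" "\<xi> \<noteq> 0" "\<And>a. a \<in> S.diag \<Longrightarrow> \<exists>\<mu>. app (S.sl a) \<xi> = scale \<mu> \<xi>"
    using top_eigenvector by blast
  obtain c c' where c: "\<eta> = scale c \<xi>" "\<eta>' = scale c' \<xi>"
    using top_line[OF \<xi>] assms highest_weight_top by meson
  have "\<eta> \<noteq> 0" using assms(1) by (simp add: highest_weight_vector_def)
  then have "\<eta>' = scale (c' / c) \<eta>" using c by auto
  then show ?thesis by blast
qed

end

theorem theorem4p5:
  fixes ty :: pair_type and N :: nat
    and scale :: "complex \<Rightarrow> 'v::ab_group_add \<Rightarrow> 'v" and B :: "'v set"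
    and \<rho> :: "gen free_alg set \<Rightarrow> 'v \<Rightarrow> 'v"
  assumes "type_for ty N"
    and "finite_dimensional_vector_space scale B"
    and "irreducible_representation ty N scale \<rho>"
  shows "highest_weight_representation ty N scale \<rho>
    \<and> (\<forall>\<eta> \<eta>'. highest_weight_vector ty N scale \<rho> \<eta> \<and> highest_weight_vector ty N scale \<rho> \<eta>'
         \<longrightarrow> (\<exists>c. \<eta>' = scale c \<eta>))"
proof -
  have rep: "representation ty N scale \<rho>"
    using assms(3) by (simp add: irreducible_representation_def)
  interpret tw_irrep ty N scale \<rho> B
    by (intro tw_irrep.intro tw_rep.intro tw_irrep_axioms.intro assms rep)
  obtain \<omega> w where "w \<in> E \<omega>" "w \<noteq> 0" "\<And>n. n > 0 \<Longrightarrow> E (\<omega> + of_nat n) = {0}"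
    using top_eigenvalue by blast
  then interpret tw_top ty N scale \<rho> B \<omega> w
    by unfold_locales auto
  show ?thesis
    using rep highest_weight_exists highest_weight_unique
    unfolding highest_weight_representation_def by blast
qed

end
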